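(* For every $d\ge 2$, the measure $\mu$ is tail trivial: every event in the tail $\sigma$-field $\mathcal{F}_\infty=\bigcap_{n\in\mathbb{N}}\sigma\{\eta(x):|x|\ge n\}$ has $\mu$-probability $0$ or $1$.
   Context: Abelian sandpile on $\mathbb{Z}^d$: $\Delta_{xx}=2d$, $\Delta_{xy}=-1$ if $|x-y|=1$, $0$ otherwise; $\Delta_V$ its restriction to $V\times V$. $\Omega=\{1,\dots,2d\}^{\mathbb{Z}^d}$ with product topology. For finite $V$, toppling $z\in V$ maps $\xi$ to $\xi-(\Delta_V)_{z\cdot}$ and is legal if $\xi(z)>2d$; $a_{x,V}\xi$ is the stable result of legal topplings applied to $\xi+\delta_x$. $\mathcal{R}_V$ is the set of recurrent states of the Markov chain on $\{1,\dots,2d\}^V$ applying $a_{X,V}$ with $X$ i.i.d. from a strictly positive distribution on $V$; $\mu_V$ is the uniform measure on $\mathcal{R}_V$ (regarded as a measure on $\Omega$ via cylinder events). For $d\ge 2$ it is known that $\mu_V$ converges weakly to a probability measure $\mu$ on $\Omega$ as $V\uparrow\mathbb{Z}^d$. *)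

theory Defs
  imports "HOL-Analysis.Analysis" "HOL-Probability.Probability"
begin

text \<open>Sites of Z^d are functions 'd => int with 'd a finite type, d = CARD('d).
  Configurations are functions from sites to int.\<close>

type_synonym 'd site = "'d \<Rightarrow> int"
type_synonym 'd config = "'d site \<Rightarrow> int"

definition dd :: "'d::finite itself \<Rightarrow> int" where
  "dd _ = int CARD('d)"

definition norm1 :: "'d::finite site \<Rightarrow> int" where
  "norm1 x = (\<Sum>i\<in>UNIV. \<bar>x i\<bar>)"

definition adj :: "'d::finite site \<Rightarrow> 'd site \<Rightarrow> bool" where
  "adj x y \<longleftrightarrow> norm1 (\<lambda>i. x i - y i) = 1"

definition Omega :: "('d::finite) config set" where
  "Omega = {\<eta>. \<forall>x. \<eta> x \<in> {1..2 * dd TYPE('d)}}"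

text \<open>Omega with its product sigma-algebra (= Borel sigma-algebra of the product topology)\<close>
definition OmegaM :: "('d::finite) config measure" where
  "OmegaM = PiM UNIV (\<lambda>_. count_space {1..2 * dd TYPE('d)})"

text \<open>Toppling of z in V: xi - (Delta_V)_{z.}\<close>
definition topple :: "'d::finite site set \<Rightarrow> 'd site \<Rightarrow> 'd config \<Rightarrow> 'd config" where
  "topple V z \<xi> = (\<lambda>y. if y = z then \<xi> y - 2 * dd TYPE('d)
                        else if y \<in> V \<and> adj z y then \<xi> y + 1 else \<xi> y)"

definition legal_step :: "'d::finite site set \<Rightarrow> 'd config \<Rightarrow> 'd config \<Rightarrow> bool" where
  "legal_step V \<xi> \<xi>' \<longleftrightarrow> (\<exists>z\<in>V. \<xi> z > 2 * dd TYPE('d) \<and> \<xi>' = topple V z \<xi>)"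

definition stable :: "'d::finite site set \<Rightarrow> 'd config \<Rightarrow> bool" where
  "stable V \<xi> \<longleftrightarrow> (\<forall>z\<in>V. \<xi> z \<le> 2 * dd TYPE('d))"

definition stabilize :: "'d::finite site set \<Rightarrow> 'd config \<Rightarrow> 'd config" where
  "stabilize V \<xi> = (THE \<eta>. (legal_step V)\<^sup>*\<^sup>* \<xi> \<eta> \<and> stable V \<eta>)"

definition addop :: "'d::finite site set \<Rightarrow> 'd site \<Rightarrow> 'd config \<Rightarrow> 'd config" where
  "addop V x \<xi> = stabilize V (\<xi>(x := \<xi> x + 1))"

text \<open>State space {1..2d}^V, embedded in Omega by the fixed value 1 outside V.\<close>
definition states :: "'d::finite site set \<Rightarrow> 'd config set" where
  "states V = {\<xi>. (\<forall>x\<in>V. \<xi> x \<in> {1..2 * dd TYPE('d)}) \<and> (\<forall>x. x \<notin> V \<longrightarrow> \<xi> x = 1)}"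

text \<open>Positive-probability transitions of the Markov chain (X i.i.d. strictly positive on V)\<close>
definition chain_step :: "'d::finite site set \<Rightarrow> 'd config \<Rightarrow> 'd config \<Rightarrow> bool" where
  "chain_step V \<xi> \<eta> \<longleftrightarrow> \<xi> \<in> states V \<and> (\<exists>x\<in>V. \<eta> = addop V x \<xi>)"

text \<open>Recurrent states of a finite-state Markov chain: states from which every reachable
  state leads back.\<close>
definition recurrent :: "'d::finite site set \<Rightarrow> 'd config set" where
  "recurrent V = {\<xi> \<in> states V. \<forall>\<eta>. (chain_step V)\<^sup>*\<^sup>* \<xi> \<eta> \<longrightarrow> (chain_step V)\<^sup>*\<^sup>* \<eta> \<xi>}"

definition weak_limit :: "('d::finite) config measure \<Rightarrow> bool" where
  "weak_limit \<mu> \<longleftrightarrow> (\<forall>f :: 'd config \<Rightarrow> real. continuous_on Omega f \<longrightarrow>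
     ((\<lambda>V. (\<Sum>\<xi>\<in>recurrent V. f \<xi>) / real (card (recurrent V)))
        \<longlongrightarrow> integral\<^sup>L \<mu> f) (finite_subsets_at_top UNIV))"

definition tail_field :: "('d::finite) config set set" where
  "tail_field = (\<Inter>n::nat. sigma_sets Omega
      {{\<eta> \<in> Omega. \<eta> x \<in> B} | x B. norm1 x \<ge> int n})"

end

theory Submission
  imports Defs
begin

text \<open>Recurrent sandpiles and wired spanning trees are both labellings in which no non-empty set of
  sites is blocked, and the number of labels at \<open>x\<close> blocked by \<open>F\<close> is the number of neighbours of \<open>x\<close> in
  \<open>F\<close> in both cases. Hence the largest set \<open>D\<^sub>B\<close> that is blocked apart from the sites of \<open>B\<close> has the same law for
  both; for the tree it consists of the descendants of \<open>B\<close>. Given \<open>D\<^sub>B = W\<close>, the sandpile inside \<open>W\<close> is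
  independent of the sandpile outside. The law of \<open>D\<^sub>B\<close> converges, because \<open>D\<^sub>B = W\<close> has, up to a factor
  depending only on \<open>W\<close> and \<open>B\<close>, the probability that the sandpile is a certain minimal configuration on \<open>W\<close>.

  The main point is that the limit is carried by finite \<open>W\<close>. If a site had a large branch below it with
  positive density, one could reroot this branch through an exit edge at every distance from the site,
  which preserves the uniform measure, so that the possible roots are far apart. On the other hand most
  large branches consist of a long path with few short side branches, and along such a path the root of
  the branch can be located up to a bounded distance.

  For the tail, let \<open>E\<close> depend on \<open>B\<close> and choose \<open>B \<subseteq> V\<^sub>0\<close>, \<open>C\<close> and \<open>F\<close> such that \<open>D\<close> of \<open>V\<^sub>0\<close> lies in \<open>C\<close> and \<open>D\<close> of \<open>C\<close>
  lies in \<open>F\<close> with high probability. Given \<open>D\<^sub>C = W\<close>, events outside \<open>F\<close> are independent of \<open>E\<close>, and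
  resampling the tree below \<open>C\<close> shows that \<open>E\<close> has nearly its unconditional probability. So a tail event
  is asymptotically independent of every cylinder event, in particular of those that approximate its
  complement.\<close>

text \<open>The only quantitative fact about large branches is monotonicity: the limiting
  probability \<open>q a\<close> that a site has at least \<open>a\<close> descendants decreases to
  some \<open>ql\<close>, so sizes between two large bounds have density at most
  \<open>q a - ql\<close>, up to errors. All exceptional shapes of a branch are charged by
  deterministic counting to vertices of such intermediate size, or to the whole volume divided by a
  large constant. Each error term multiplies the rarity at one scale by constants of earlier scales,
  which forces the order \<open>a\<close>, \<open>b\<close>, \<open>C\<close>, \<open>g\<close>,
  \<open>K\<close> of the choices. Dimension at least two enters through the connectedness of
  spheres: a branch that meets a sphere without covering it has an exit edge there. The inside of
  \<open>D\<close> of \<open>C\<close>, given \<open>D\<close> of \<open>C\<close> equal to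
  \<open>W\<close>, is not the sandpile of a smaller volume. The law of \<open>D\<close> of
  \<open>B\<close> is therefore passed to trees, where conditioning on the paths coming from outside
  \<open>C\<close> does leave a uniform tree on a smaller volume. A one-sided bound on the
  probability of an intersection suffices, because it is applied to an event close to a tail event
  and one close to its complement.\<close>

section \<open>Abstract blocking systems and the decomposition along the blocked core\<close>

text \<open>\<open>b x l F\<close> means that the label \<open>l\<close> at \<open>x\<close> is blocked by \<open>F\<close>.\<close>

definition Rec :: "'v set \<Rightarrow> ('v \<Rightarrow> 'l set) \<Rightarrow> ('v \<Rightarrow> 'l \<Rightarrow> 'v set \<Rightarrow> bool) \<Rightarrow> ('v \<Rightarrow> 'l) set" where
  "Rec V L b = {s \<in> PiE V L. \<forall>F\<subseteq>V. F \<noteq> {} \<longrightarrow> (\<exists>x\<in>F. \<not> b x (s x) F)}"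

text \<open>For monotone \<open>b\<close> a union of admissible sets is again admissible, so this
  union is itself the greatest admissible set.\<close>

definition blocked_core :: "'v set \<Rightarrow> ('v \<Rightarrow> 'l \<Rightarrow> 'v set \<Rightarrow> bool) \<Rightarrow> 'v set \<Rightarrow> ('v \<Rightarrow> 'l) \<Rightarrow> 'v set" where
  "blocked_core V b B s = \<Union>{F. F \<subseteq> V \<and> (\<forall>x\<in>F - B. b x (s x) F)}"

text \<open>The rule seen by the sites outside \<open>W\<close> while all of \<open>W\<close> counts
  as present: \<open>W\<close> helps to block but is never tested itself.\<close>

definition outer_b :: "('v \<Rightarrow> 'l \<Rightarrow> 'v set \<Rightarrow> bool) \<Rightarrow> 'v set \<Rightarrow> 'v \<Rightarrow> 'l \<Rightarrow> 'v set \<Rightarrow> bool" where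
  "outer_b b W = (\<lambda>x l F. b x l (F \<union> W))"

text \<open>If \<open>W\<close> is the core, sites of \<open>W - B\<close> carry labels blocked by
  \<open>W\<close>. Moving this condition into the label sets keeps the rule \<open>b\<close>
  unchanged, so the inner system is again of the form \<open>Rec\<close> and the decomposition can
  be iterated.\<close>

definition inner_L :: "('v \<Rightarrow> 'l set) \<Rightarrow> ('v \<Rightarrow> 'l \<Rightarrow> 'v set \<Rightarrow> bool) \<Rightarrow> 'v set \<Rightarrow> 'v set \<Rightarrow> 'v \<Rightarrow> 'l set" where
  "inner_L L b W B = (\<lambda>x. if x \<in> B then L x else {l \<in> L x. b x l W})"

definition mono_b :: "('v \<Rightarrow> 'l \<Rightarrow> 'v set \<Rightarrow> bool) \<Rightarrow> bool" where
  "mono_b b \<longleftrightarrow> (\<forall>x l F F'. F \<subseteq> F' \<longrightarrow> b x l F \<longrightarrow> b x l F')"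

lemma mono_bD: "mono_b b \<Longrightarrow> F \<subseteq> F' \<Longrightarrow> b x l F \<Longrightarrow> b x l F'"
  unfolding mono_b_def by blast

lemma mono_outer_b: "mono_b b \<Longrightarrow> mono_b (outer_b b W)"
  unfolding mono_b_def outer_b_def by (meson Un_mono order_refl)

lemma finite_Rec: "finite V \<Longrightarrow> (\<And>x. x \<in> V \<Longrightarrow> finite (L x)) \<Longrightarrow> finite (Rec V L b)"
  unfolding Rec_def using finite_PiE[of V L] by (auto intro: finite_subset)

lemma Rec_unblocked: "s \<in> Rec V L b \<Longrightarrow> F \<subseteq> V \<Longrightarrow> F \<noteq> {} \<Longrightarrow> \<exists>x\<in>F. \<not> b x (s x) F"
  unfolding Rec_def by simp

lemma Rec_empty: "Rec {} L b = {\<lambda>_. undefined}"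
  unfolding Rec_def by auto

lemma blocked_core_sub: "blocked_core V b B s \<subseteq> V"
  unfolding blocked_core_def by auto

lemma blocked_core_greatest: "F \<subseteq> V \<Longrightarrow> (\<And>x. x \<in> F - B \<Longrightarrow> b x (s x) F) \<Longrightarrow> F \<subseteq> blocked_core V b B s"
  unfolding blocked_core_def by blast

lemma blocked_core_base: "B \<subseteq> V \<Longrightarrow> B \<subseteq> blocked_core V b B s"
  by (rule blocked_core_greatest) auto

lemma blocked_core_blocked:
  assumes "mono_b b" "x \<in> blocked_core V b B s" "x \<notin> B"
  shows "b x (s x) (blocked_core V b B s)"
proof -
  obtain F where F: "x \<in> F" "F \<subseteq> V" "\<forall>x\<in>F - B. b x (s x) F"
    using assms(2) unfolding blocked_core_def by blast
  have "F \<subseteq> blocked_core V b B s" using F by (intro blocked_core_greatest) auto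
  then show ?thesis using F assms mono_bD by (metis DiffI)
qed

lemma blocked_core_eqI:
  assumes "W \<subseteq> V" "\<And>x. x \<in> W - B \<Longrightarrow> b x (s x) W" "B \<subseteq> W" "mono_b b"
    and "\<And>F. F \<subseteq> V - W \<Longrightarrow> F \<noteq> {} \<Longrightarrow> \<exists>x\<in>F. \<not> b x (s x) (F \<union> W)"
  shows "blocked_core V b B s = W"
proof
  let ?D = "blocked_core V b B s"
  show "W \<subseteq> ?D" using assms by (intro blocked_core_greatest) auto
  then have eq: "?D = (?D - W) \<union> W" by auto
  show "?D \<subseteq> W"
  proof (rule ccontr)
    assume "\<not> ?D \<subseteq> W"
    then obtain x where x: "x \<in> ?D - W" "\<not> b x (s x) ((?D - W) \<union> W)"
      using assms(5)[of "?D - W"] blocked_core_sub[of V b B s] by blast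
    then have "x \<notin> B" using assms by auto
    then have "b x (s x) ?D" using blocked_core_blocked[OF assms(4)] x by blast
    with x eq show False by metis
  qed
qed

lemma blocked_core_cong:
  assumes "\<And>x. x \<in> V \<Longrightarrow> s x = s' x"
  shows "blocked_core V b B s = blocked_core V b B s'"
proof -
  have "{F. F \<subseteq> V \<and> (\<forall>x\<in>F - B. b x (s x) F)} = {F. F \<subseteq> V \<and> (\<forall>x\<in>F - B. b x (s' x) F)}"
    using assms by (metis (no_types, lifting) DiffD1 subsetD)
  then show ?thesis unfolding blocked_core_def by simp
qed

text \<open>A set admissible for \<open>B\<close> is admissible for the larger \<open>C\<close>,
  hence contained in \<open>W\<close>. So the core of \<open>B\<close> can be read off inside
  \<open>W\<close>.\<close>

lemma blocked_core_nested:
  assumes "blocked_core V b C s = W" "B \<subseteq> C"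
  shows "blocked_core V b B s = blocked_core W b B s"
proof -
  have "W \<subseteq> V" using assms(1) blocked_core_sub[of V b C s] by simp
  have "{F. F \<subseteq> V \<and> (\<forall>x\<in>F - B. b x (s x) F)} = {F. F \<subseteq> W \<and> (\<forall>x\<in>F - B. b x (s x) F)}" (is "?A = ?B")
  proof
    show "?A \<subseteq> ?B"
    proof
      fix F assume F: "F \<in> ?A"
      then have "F \<subseteq> blocked_core V b C s" using assms(2) by (intro blocked_core_greatest) auto
      then show "F \<in> ?B" using F assms(1) by auto
    qed
    show "?B \<subseteq> ?A" using \<open>W \<subseteq> V\<close> by blast
  qed
  then show ?thesis unfolding blocked_core_def by simp
qed

lemma merge_PiE_eq:
  assumes "W \<subseteq> V" "s \<in> PiE V L"
  shows "(\<lambda>x. if x \<in> W then restrict s W x else restrict s (V - W) x) = s"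
  using assms by (auto simp: fun_eq_iff PiE_def extensional_def)

text \<open>Outside \<open>W\<close>, a set blocked together with \<open>W\<close> could be added to
  the core, contradicting maximality; this is exactly the condition for \<open>outer_b\<close>.
  Conversely, after merging, a set \<open>F\<close> not inside \<open>W\<close> has a site of
  \<open>F - W\<close> unblocked by \<open>(F - W) \<union> W\<close>, hence by the smaller
  \<open>F\<close>. The two parts do not constrain each other.\<close>

lemma Rec_core_decomp:
  assumes mb: "mono_b b" and BW: "B \<subseteq> W" and WV: "W \<subseteq> V"
  shows "bij_betw (\<lambda>s. (restrict s (V - W), restrict s W))
     {s \<in> Rec V L b. blocked_core V b B s = W}
     (Rec (V - W) L (outer_b b W) \<times> Rec W (inner_L L b W B) b)"
proof (rule bij_betw_byWitness[where f' = "\<lambda>(t, u) x. if x \<in> W then u x else t x"])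
  let ?R1 = "Rec (V - W) L (outer_b b W)" and ?R2 = "Rec W (inner_L L b W B) b"
  show "\<forall>s\<in>{s \<in> Rec V L b. blocked_core V b B s = W}.
       (case (restrict s (V - W), restrict s W) of (t, u) \<Rightarrow> \<lambda>x. if x \<in> W then u x else t x) = s"
    using merge_PiE_eq[OF WV] by (auto simp: Rec_def)
  show "\<forall>p\<in>?R1 \<times> ?R2. (\<lambda>s. (restrict s (V - W), restrict s W))
      ((case p of (t, u) \<Rightarrow> \<lambda>x. if x \<in> W then u x else t x)) = p"
    using WV by (auto simp: Rec_def PiE_def extensional_def fun_eq_iff)
  show "(\<lambda>s. (restrict s (V - W), restrict s W)) ` {s \<in> Rec V L b. blocked_core V b B s = W} \<subseteq> ?R1 \<times> ?R2"
  proof clarify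
    fix s assume s: "s \<in> Rec V L b" and W: "W = blocked_core V b B s"
    have sL: "s \<in> PiE V L" and sF: "\<And>F. F \<subseteq> V \<Longrightarrow> F \<noteq> {} \<Longrightarrow> \<exists>x\<in>F. \<not> b x (s x) F"
      using s by (auto simp: Rec_def)
    have 1: "restrict s (V - W) \<in> ?R1"
    proof -
      have "\<exists>x\<in>F. \<not> b x (s x) (F \<union> W)" if "F \<subseteq> V - W" "F \<noteq> {}" for F
      proof (rule ccontr)
        assume a: "\<not> (\<exists>x\<in>F. \<not> b x (s x) (F \<union> W))"
        have "F \<union> W \<subseteq> W"
          unfolding W
        proof (rule blocked_core_greatest)
          show "F \<union> blocked_core V b B s \<subseteq> V" using that WV W by auto
          fix x assume x: "x \<in> F \<union> blocked_core V b B s - B"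
          show "b x (s x) (F \<union> blocked_core V b B s)"
          proof (cases "x \<in> F")
            case True then show ?thesis using a W by blast
          next
            case False
            then have "b x (s x) (blocked_core V b B s)" using x blocked_core_blocked[OF mb] by blast
            then show ?thesis using mono_bD[OF mb] by (metis Un_upper2)
          qed
        qed
        then show False using that by blast
      qed
      then have "\<exists>x\<in>F. \<not> outer_b b W x (restrict s (V - W) x) F" if "F \<subseteq> V - W" "F \<noteq> {}" for F
        using that unfolding outer_b_def by (metis restrict_apply' subsetD)
      then show ?thesis using sL by (auto simp: Rec_def)
    qed
    have 2: "restrict s W \<in> ?R2"
    proof -
      have "restrict s W \<in> PiE W (inner_L L b W B)"
        using sL WV blocked_core_blocked[OF mb, of _ V B s] W by (auto simp: inner_L_def PiE_def Pi_def)
      moreover have "\<exists>x\<in>F. \<not> b x (restrict s W x) F" if "F \<subseteq> W" "F \<noteq> {}" for F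
        using sF[of F] that WV by (metis restrict_apply' subset_trans subsetD)
      ultimately show ?thesis by (auto simp: Rec_def)
    qed
    from 1 2 show "restrict s (V - blocked_core V b B s) \<in> Rec (V - blocked_core V b B s) L (outer_b b (blocked_core V b B s)) \<and>
      restrict s (blocked_core V b B s) \<in> Rec (blocked_core V b B s) (inner_L L b (blocked_core V b B s) B) b" using W by simp
  qed
  show "(\<lambda>(t, u) x. if x \<in> W then u x else t x) ` (?R1 \<times> ?R2) \<subseteq> {s \<in> Rec V L b. blocked_core V b B s = W}"
  proof clarify
    fix t u assume t: "t \<in> ?R1" and u: "u \<in> ?R2"
    let ?s = "\<lambda>x. if x \<in> W then u x else t x"
    have ta: "\<exists>x\<in>F. \<not> b x (?s x) (F \<union> W)" if F: "F \<subseteq> V - W" "F \<noteq> {}" for F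
    proof -
      obtain x where "x \<in> F" "\<not> b x (t x) (F \<union> W)"
        using Rec_unblocked[OF t F] unfolding outer_b_def by auto
      then show ?thesis using F by (intro bexI[of _ x]) auto
    qed
    have ua: "\<exists>x\<in>F. \<not> b x (?s x) F" if F: "F \<subseteq> W" "F \<noteq> {}" for F
    proof -
      obtain x where "x \<in> F" "\<not> b x (u x) F" using Rec_unblocked[OF u F] by auto
      then show ?thesis using F by (intro bexI[of _ x]) auto
    qed
    have ub: "b x (?s x) W" if "x \<in> W - B" for x
      using that u by (auto simp: Rec_def inner_L_def PiE_def Pi_def split: if_splits)
    have "?s \<in> PiE V L"
    proof
      fix x assume "x \<in> V"
      then show "?s x \<in> L x" using t u by (auto simp: Rec_def inner_L_def PiE_def Pi_def split: if_splits)
    next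
      fix x assume "x \<notin> V" then show "?s x = undefined" using t u WV by (auto simp: Rec_def PiE_def extensional_def)
    qed
    moreover have "\<exists>x\<in>F. \<not> b x (?s x) F" if F: "F \<subseteq> V" "F \<noteq> {}" for F
    proof (cases "F \<subseteq> W")
      case True then show ?thesis using ua F by blast
    next
      case False
      then obtain x where x: "x \<in> F - W" "\<not> b x (?s x) ((F - W) \<union> W)" using ta[of "F - W"] F by blast
      then have "\<not> b x (?s x) F" using mono_bD[OF mb, of F "(F - W) \<union> W" x] by blast
      then show ?thesis using x by blast
    qed
    moreover have "blocked_core V b B ?s = W"
      using WV ub BW mb ta by (rule blocked_core_eqI)
    ultimately show "?s \<in> Rec V L b \<and> blocked_core V b B ?s = W" by (auto simp: Rec_def)
  qed
qed

lemma Rec_core_card: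
  assumes "mono_b b" "B \<subseteq> W" "W \<subseteq> V"
  shows "card {s \<in> Rec V L b. blocked_core V b B s = W}
    = card (Rec (V - W) L (outer_b b W)) * card (Rec W (inner_L L b W B) b)"
  using bij_betw_same_card[OF Rec_core_decomp[OF assms]] by (simp add: card_cartesian_product)

lemma Rec_core_card_event:
  assumes "mono_b b" "B \<subseteq> W" "W \<subseteq> V"
  shows "card {s \<in> Rec V L b. blocked_core V b B s = W \<and> P (restrict s (V - W)) \<and> Q (restrict s W)}
    = card {t \<in> Rec (V - W) L (outer_b b W). P t} * card {u \<in> Rec W (inner_L L b W B) b. Q u}"
proof -
  let ?g = "\<lambda>s. (restrict s (V - W), restrict s W)"
  let ?A = "{s \<in> Rec V L b. blocked_core V b B s = W}"
  let ?X = "{s \<in> Rec V L b. blocked_core V b B s = W \<and> P (restrict s (V - W)) \<and> Q (restrict s W)}"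
  let ?Y = "{t \<in> Rec (V - W) L (outer_b b W). P t} \<times> {u \<in> Rec W (inner_L L b W B) b. Q u}"
  note bij = Rec_core_decomp[OF assms, of L]
  have "inj_on ?g ?X" using bij by (auto simp: bij_betw_def inj_on_def)
  moreover have "?g ` ?X = ?Y"
  proof
    show "?g ` ?X \<subseteq> ?Y" using bij unfolding bij_betw_def by auto
    show "?Y \<subseteq> ?g ` ?X"
    proof
      fix p assume p: "p \<in> ?Y"
      then have "p \<in> ?g ` ?A" using bij unfolding bij_betw_def by auto
      then obtain s where "s \<in> ?A" "p = ?g s" by auto
      then show "p \<in> ?g ` ?X" using p by (intro image_eqI[of _ _ s]) auto
    qed
  qed
  ultimately have "card ?X = card ?Y" using card_image by fastforce
  then show ?thesis by (simp add: card_cartesian_product)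
qed

text \<open>\<open>W\<close> itself must contain an unblocked site, and all sites but
  \<open>x\<close> only have labels blocked by \<open>W\<close>; so the label at \<open>x\<close> is
  not blocked by \<open>W\<close>. Then every set containing \<open>x\<close> is harmless by
  monotonicity, and only subsets of \<open>W - {x}\<close> remain to be tested. This makes the inner
  factor accessible to induction even when \<open>W\<close> is all of \<open>V\<close>.\<close>

lemma Rec_root_card:
  assumes mb: "mono_b b" and fW: "finite W" and x: "x \<in> W"
  shows "card (Rec W (inner_L L b W {x}) b)
     = card {l \<in> L x. \<not> b x l W} * card (Rec (W - {x}) (inner_L L b W {x}) b)"
proof -
  let ?L = "inner_L L b W {x}"
  have "bij_betw (\<lambda>s. (s x, restrict s (W - {x}))) (Rec W ?L b) ({l \<in> L x. \<not> b x l W} \<times> Rec (W - {x}) ?L b)"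
  proof (rule bij_betw_byWitness[where f' = "\<lambda>(l, u). u(x := l)"])
    show "\<forall>s\<in>Rec W ?L b. (case (s x, restrict s (W - {x})) of (l, u) \<Rightarrow> u(x := l)) = s"
      by (auto simp: Rec_def PiE_def extensional_def fun_eq_iff)
    show "\<forall>p\<in>{l \<in> L x. \<not> b x l W} \<times> Rec (W - {x}) ?L b.
       (\<lambda>s. (s x, restrict s (W - {x}))) (case p of (l, u) \<Rightarrow> u(x := l)) = p"
      by (auto simp: Rec_def PiE_def extensional_def fun_eq_iff)
    show "(\<lambda>s. (s x, restrict s (W - {x}))) ` Rec W ?L b \<subseteq> {l \<in> L x. \<not> b x l W} \<times> Rec (W - {x}) ?L b"
    proof (rule image_subsetI)
      fix s assume s: "s \<in> Rec W ?L b"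
      then have sL: "s \<in> PiE W ?L" and sF: "\<And>F. F \<subseteq> W \<Longrightarrow> F \<noteq> {} \<Longrightarrow> \<exists>x\<in>F. \<not> b x (s x) F"
        by (auto simp: Rec_def)
      have "s x \<in> L x" using sL x by (auto simp: inner_L_def PiE_def Pi_def)
      moreover have "\<not> b x (s x) W"
      proof -
        obtain y where "y \<in> W" "\<not> b y (s y) W" using sF[of W] x by auto
        moreover have "y = x" using sL calculation by (auto simp: inner_L_def PiE_def Pi_def split: if_splits)
        ultimately show ?thesis by simp
      qed
      moreover have "restrict s (W - {x}) \<in> Rec (W - {x}) ?L b"
      proof -
        have "\<exists>y\<in>F. \<not> b y (restrict s (W - {x}) y) F" if "F \<subseteq> W - {x}" "F \<noteq> {}" for F
          using sF[of F] that by (metis (no_types, lifting) Diff_subset dual_order.trans restrict_apply' subsetD)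
        then show ?thesis using sL by (auto simp: Rec_def)
      qed
      ultimately show "(s x, restrict s (W - {x})) \<in> {l \<in> L x. \<not> b x l W} \<times> Rec (W - {x}) ?L b" by simp
    qed
    show "(\<lambda>(l, u). u(x := l)) ` ({l \<in> L x. \<not> b x l W} \<times> Rec (W - {x}) ?L b) \<subseteq> Rec W ?L b"
    proof clarify
      fix l u assume l: "l \<in> L x" "\<not> b x l W" and u: "u \<in> Rec (W - {x}) ?L b"
      have "u(x := l) \<in> PiE W ?L" using u l x by (auto simp: Rec_def PiE_def Pi_def extensional_def inner_L_def)
      moreover have "\<exists>y\<in>F. \<not> b y ((u(x := l)) y) F" if F: "F \<subseteq> W" "F \<noteq> {}" for F
      proof (cases "x \<in> F")
        case True
        then show ?thesis using l(2) mono_bD[OF mb F(1)] by (intro bexI[of _ x]) auto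
      next
        case False
        then have "F \<subseteq> W - {x}" using F by auto
        then obtain y where "y \<in> F" "\<not> b y (u y) F" using Rec_unblocked[OF u _ F(2)] by auto
        then show ?thesis using False by (intro bexI[of _ y]) auto
      qed
      ultimately show "u(x := l) \<in> Rec W ?L b" by (auto simp: Rec_def)
    qed
  qed
  then show ?thesis using bij_betw_same_card card_cartesian_product by fastforce
qed

definition same_counts where
  "same_counts V L b L' b' \<longleftrightarrow> (\<forall>x\<in>V. finite (L x) \<and> finite (L' x) \<and> card (L x) = card (L' x)
     \<and> (\<forall>F\<subseteq>V. card {l \<in> L x. b x l F} = card {l \<in> L' x. b' x l F}))"

lemma same_counts_outer:
  assumes "same_counts V L b L' b'" "W \<subseteq> V"
  shows "same_counts (V - W) L (outer_b b W) L' (outer_b b' W)"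
proof -
  have "F \<union> W \<subseteq> V" if "F \<subseteq> V - W" for F using that assms by auto
  then show ?thesis using assms unfolding same_counts_def outer_b_def by auto
qed

text \<open>A label blocked by \<open>F \<subseteq> W\<close> is blocked by \<open>W\<close>, so
  discarding the labels not blocked by \<open>W\<close> does not alter the counts for subsets of
  \<open>W\<close>.\<close>

lemma same_counts_inner:
  assumes "same_counts V L b L' b'" "W \<subseteq> V" and mb: "mono_b b" "mono_b b'"
  shows "same_counts W (inner_L L b W B) b (inner_L L' b' W B) b'"
  unfolding same_counts_def
proof (intro ballI conjI allI impI)
  fix x assume x: "x \<in> W"
  then show "finite (inner_L L b W B x)" "finite (inner_L L' b' W B x)"
    using assms by (auto simp: same_counts_def inner_L_def)
  show "card (inner_L L b W B x) = card (inner_L L' b' W B x)"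
    using assms x by (auto simp: same_counts_def inner_L_def)
  fix F assume F: "F \<subseteq> W"
  have "{l \<in> inner_L L b W B x. b x l F} = {l \<in> L x. b x l F}"
    "{l \<in> inner_L L' b' W B x. b' x l F} = {l \<in> L' x. b' x l F}"
    using mono_bD[OF mb(1) F] mono_bD[OF mb(2) F] by (auto simp: inner_L_def)
  moreover have "F \<subseteq> V" "x \<in> V" using x F assms by auto
  ultimately show "card {l \<in> inner_L L b W B x. b x l F} = card {l \<in> inner_L L' b' W B x. b' x l F}"
    using assms(1) unfolding same_counts_def by simp
qed

lemma same_counts_unblocked:
  assumes "same_counts V L b L' b'" "W \<subseteq> V" "x \<in> V"
  shows "card {l \<in> L x. \<not> b x l W} = card {l \<in> L' x. \<not> b' x l W}"
proof -
  have "{l \<in> L x. \<not> b x l W} = L x - {l \<in> L x. b x l W}" "{l \<in> L' x. \<not> b' x l W} = L' x - {l \<in> L' x. b' x l W}" by auto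
  then show ?thesis using assms unfolding same_counts_def by (simp add: card_Diff_subset)
qed

lemma same_counts_subset: "same_counts V L b L' b' \<Longrightarrow> W \<subseteq> V \<Longrightarrow> same_counts W L b L' b'"
  unfolding same_counts_def by blast

text \<open>Induction on the volume, splitting by the core of a single site \<open>x\<close>. The
  outer factor lives on \<open>V - W\<close> and the inner one, after \<open>Rec_root_card\<close>,
  on \<open>W - {x}\<close>; both are smaller than \<open>V\<close> because \<open>x\<close> lies in
  \<open>W\<close>. No explicit bijection between the two systems is needed.\<close>

theorem card_Rec_same_counts:
  fixes L :: "'v \<Rightarrow> 'l set" and L' :: "'v \<Rightarrow> 'm set"
  assumes "finite V" "same_counts V L b L' b'" "mono_b b" "mono_b b'"
  shows "card (Rec V L b) = card (Rec V L' b')"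
  using assms
proof (induction "card V" arbitrary: V L b L' b' rule: less_induct)
  case less
  note mb = less.prems(3,4) and sc = less.prems(2) and fV = less.prems(1)
  show ?case
  proof (cases "V = {}")
    case True then show ?thesis by (simp add: Rec_empty)
  next
    case False
    then obtain x where x: "x \<in> V" by auto
    let ?WW = "{W. {x} \<subseteq> W \<and> W \<subseteq> V}"
    have fin: "finite ?WW" using fV by (auto intro: finite_subset[of _ "Pow V"])
    have sum: "card (Rec V M c) = (\<Sum>W\<in>?WW. card {s \<in> Rec V M c. blocked_core V c {x} s = W})"
      if "\<And>x. x \<in> V \<Longrightarrow> finite (M x)" for M :: "'v \<Rightarrow> 'k set" and c
    proof -
      have "Rec V M c = (\<Union>W\<in>?WW. {s \<in> Rec V M c. blocked_core V c {x} s = W})"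
        using blocked_core_base[of "{x}" V c] blocked_core_sub[of V c "{x}"] x by auto
      then have "card (Rec V M c) = card (\<Union>W\<in>?WW. {s \<in> Rec V M c. blocked_core V c {x} s = W})" by simp
      also have "\<dots> = (\<Sum>W\<in>?WW. card {s \<in> Rec V M c. blocked_core V c {x} s = W})"
        using fin finite_Rec[OF fV that] by (intro card_UN_disjoint) auto
      finally show ?thesis .
    qed
    have each: "card {s \<in> Rec V L b. blocked_core V b {x} s = W} = card {s \<in> Rec V L' b'. blocked_core V b' {x} s = W}"
      if W: "W \<in> ?WW" for W
    proof -
      have WV: "W \<subseteq> V" "x \<in> W" "{x} \<subseteq> W" using W by auto
      have fW: "finite W" using WV fV finite_subset by blast
      have "card (V - W) < card V" using WV fV x by (intro psubset_card_mono) auto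
      then have 1: "card (Rec (V - W) L (outer_b b W)) = card (Rec (V - W) L' (outer_b b' W))"
        using less.hyps fV same_counts_outer[OF sc WV(1)] mono_outer_b mb by (metis finite_Diff)
      have "card (W - {x}) < card V" using WV fV x by (intro psubset_card_mono) auto
      moreover have "same_counts (W - {x}) (inner_L L b W {x}) b (inner_L L' b' W {x}) b'"
        using same_counts_subset[OF same_counts_inner[OF sc WV(1) mb]] by blast
      ultimately have 2: "card (Rec (W - {x}) (inner_L L b W {x}) b) = card (Rec (W - {x}) (inner_L L' b' W {x}) b')"
        using less.hyps fW mb by (metis finite_Diff)
      show ?thesis
        unfolding Rec_core_card[OF mb(1) WV(3,1)] Rec_core_card[OF mb(2) WV(3,1)]
          Rec_root_card[OF mb(1) fW WV(2)] Rec_root_card[OF mb(2) fW WV(2)]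
        using 1 2 same_counts_unblocked[OF sc WV(1) x] by simp
    qed
    have "card (Rec V L b) = (\<Sum>W\<in>?WW. card {s \<in> Rec V L b. blocked_core V b {x} s = W})"
      using sc by (intro sum) (auto simp: same_counts_def)
    also have "\<dots> = (\<Sum>W\<in>?WW. card {s \<in> Rec V L' b'. blocked_core V b' {x} s = W})"
      using each by (intro sum.cong) auto
    also have "\<dots> = card (Rec V L' b')" using sc by (intro sum[symmetric]) (auto simp: same_counts_def)
    finally show ?thesis .
  qed
qed

section \<open>Nearest neighbours in the lattice and the squared norm\<close>

definition nb :: "'d::finite site \<Rightarrow> 'd site set" where
  "nb x = {y. adj x y}"

abbreviation deg :: "'d::finite itself \<Rightarrow> nat" where
  "deg _ \<equiv> 2 * CARD('d)"

lemma adj_sym: "adj x y \<longleftrightarrow> adj y x"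
  unfolding adj_def norm1_def by (simp add: abs_minus_commute)

lemma not_adj_self: "\<not> adj x x"
  unfolding adj_def norm1_def by simp

lemma mem_nb: "y \<in> nb x \<longleftrightarrow> adj x y"
  unfolding nb_def by simp

lemma nb_sym: "y \<in> nb x \<longleftrightarrow> x \<in> nb y"
  using adj_sym mem_nb by blast

lemma not_mem_nb_self: "x \<notin> nb x"
  using not_adj_self mem_nb by blast

lemma adj_iff: "adj x y \<longleftrightarrow> (\<exists>i. \<exists>s\<in>{1, -1}. y = x(i := x i + s))"
proof
  assume a: "adj x y"
  then have s: "(\<Sum>i\<in>UNIV. \<bar>x i - y i\<bar>) = 1" unfolding adj_def norm1_def .
  then obtain i where i: "\<bar>x i - y i\<bar> \<noteq> 0"
    by (metis (no_types, lifting) sum.neutral zero_neq_one)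
  have "(\<Sum>j\<in>UNIV - {i}. \<bar>x j - y j\<bar>) = 1 - \<bar>x i - y i\<bar>"
    using s by (simp add: sum_diff1)
  moreover have "(\<Sum>j\<in>UNIV - {i}. \<bar>x j - y j\<bar>) \<ge> 0" by (intro sum_nonneg) auto
  ultimately have z: "(\<Sum>j\<in>UNIV - {i}. \<bar>x j - y j\<bar>) = 0" "\<bar>x i - y i\<bar> = 1"
    using i by linarith+
  then have "\<forall>j\<in>UNIV - {i}. \<bar>x j - y j\<bar> = 0"
    by (subst (asm) sum_nonneg_eq_0_iff) auto
  then have "y = x(i := x i + (y i - x i))" by (auto simp: fun_eq_iff)
  moreover have "y i - x i \<in> {1, -1}" using z(2) by auto
  ultimately show "\<exists>i. \<exists>s\<in>{1, -1}. y = x(i := x i + s)" by blast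
next
  assume "\<exists>i. \<exists>s\<in>{1, -1}. y = x(i := x i + s)"
  then obtain i s where s: "s \<in> {1, -1}" "y = x(i := x i + s)" by blast
  have "(\<Sum>j\<in>UNIV. \<bar>x j - y j\<bar>) = (\<Sum>j\<in>UNIV. if j = i then 1 else 0)"
    using s by (intro sum.cong) auto
  also have "\<dots> = 1" by simp
  finally show "adj x y" unfolding adj_def norm1_def .
qed

lemma nb_image: "nb x = (\<lambda>(i, s). x(i := x i + s)) ` (UNIV \<times> {1, -1})"
  unfolding nb_def adj_iff by (auto simp: image_iff Bex_def)

lemma nb_inj: "inj_on (\<lambda>(i, s). x(i := x i + s)) (UNIV \<times> {1, -1 :: int})"
proof (rule inj_onI, clarify)
  fix i j and s t :: int
  assume s: "s \<in> {1, -1}" "t \<in> {1, -1}" and e: "x(i := x i + s) = x(j := x j + t)"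
  have "i = j"
  proof (rule ccontr)
    assume "i \<noteq> j" then have "x i + s = x i" using fun_cong[OF e, of i] by simp
    then show False using s by auto
  qed
  moreover then have "s = t" using fun_cong[OF e, of i] by simp
  ultimately show "i = j \<and> s = t" by simp
qed

lemma finite_nb [simp]: "finite (nb x)"
  unfolding nb_image by simp

lemma card_nb: "card (nb (x :: 'd::finite site)) = deg TYPE('d)"
  unfolding nb_image card_image[OF nb_inj] card_cartesian_product by simp

lemma card_nb_le: "card (nb (x :: 'd::finite site) \<inter> F) \<le> deg TYPE('d)"
  using card_mono[OF finite_nb, of "nb x \<inter> F" x] card_nb by (metis inf_le1)

lemma dd_deg: "2 * dd TYPE('d::finite) = int (deg TYPE('d))"
  unfolding dd_def by simp

text \<open>The squared Euclidean norm. Its discrete Laplacian is a positive constant, which gives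
  stabilizing toppling numbers and excludes local maxima, and it separates neighbours, which orders
  the sites for the minimal configurations.\<close>

definition sq2 :: "'d::finite site \<Rightarrow> int" where
  "sq2 x = (\<Sum>i\<in>UNIV. (x i)\<^sup>2)"

lemma sq2_upd: "sq2 (x(i := x i + s)) = sq2 x + 2 * s * x i + s\<^sup>2"
proof -
  have "sq2 (x(i := x i + s)) = (\<Sum>j\<in>UNIV. (x j)\<^sup>2 + (if j = i then 2 * s * x i + s\<^sup>2 else 0))"
    unfolding sq2_def by (intro sum.cong) (auto simp: power2_eq_square algebra_simps)
  then show ?thesis unfolding sq2_def by (simp add: sum.distrib)
qed

lemma sum_sq2_nb: "(\<Sum>y\<in>nb x. sq2 y) = int (deg TYPE('d)) * (sq2 (x :: 'd::finite site) + 1)"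
proof -
  have "(\<Sum>y\<in>nb x. sq2 y) = (\<Sum>i\<in>UNIV. \<Sum>s\<in>{1, -1}. sq2 (x(i := x i + s)))"
    unfolding nb_image sum.cartesian_product
    by (subst sum.reindex[OF nb_inj]) (simp add: case_prod_unfold comp_def)
  also have "\<dots> = (\<Sum>i\<in>(UNIV :: 'd set). 2 * (sq2 x + 1))"
    by (intro sum.cong) (auto simp: sq2_upd simp del: fun_upd_apply)
  also have "\<dots> = int (deg TYPE('d)) * (sq2 x + 1)" by simp
  finally show ?thesis .
qed

subsection \<open>Stabilization\<close>

definition topple_by :: "'d::finite site set \<Rightarrow> 'd config \<Rightarrow> ('d site \<Rightarrow> int) \<Rightarrow> 'd config" where
  "topple_by V \<xi> m = (\<lambda>y. if y \<in> V then \<xi> y - 2 * dd TYPE('d) * m y + (\<Sum>z\<in>nb y \<inter> V. m z) else \<xi> y)"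

text \<open>Legal toppling sequences recorded with their odometer \<open>u\<close>. The result
  depends on \<open>u\<close> alone, by \<open>run_topple_by\<close>, so that independence of the
  order reduces to comparing odometers.\<close>

inductive run :: "'d::finite site set \<Rightarrow> 'd config \<Rightarrow> ('d site \<Rightarrow> int) \<Rightarrow> 'd config \<Rightarrow> bool" for V \<xi> where
  run_base: "run V \<xi> (\<lambda>_. 0) \<xi>"
| run_step: "run V \<xi> u \<eta> \<Longrightarrow> z \<in> V \<Longrightarrow> \<eta> z > 2 * dd TYPE('d::finite) \<Longrightarrow> run V \<xi> (u(z := u z + 1)) (topple V z \<eta>)"

lemma topple_by_upd:
  assumes "z \<in> V"
  shows "topple_by V \<xi> (u(z := u z + 1)) = topple V z (topple_by V \<xi> u)"
proof
  fix y
  have "(\<Sum>w\<in>nb y \<inter> V. (u(z := u z + 1)) w) = (\<Sum>w\<in>nb y \<inter> V. u w + (if w = z then 1 else 0))"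
    by (intro sum.cong) auto
  also have "\<dots> = (\<Sum>w\<in>nb y \<inter> V. u w) + (if z \<in> nb y then 1 else 0)"
    using assms by (simp add: sum.distrib)
  finally show "topple_by V \<xi> (u(z := u z + 1)) y = topple V z (topple_by V \<xi> u) y"
    using not_mem_nb_self[of y] assms nb_sym[of z y] mem_nb[of y z]
    by (auto simp: topple_by_def topple_def algebra_simps)
qed

lemma run_topple_by: "run V \<xi> u \<eta> \<Longrightarrow> \<eta> = topple_by V \<xi> u"
proof (induction rule: run.induct)
  case run_base then show ?case by (simp add: topple_by_def fun_eq_iff)
next
  case (run_step u \<eta> z) then show ?case using topple_by_upd by metis
qed

lemma run_nonneg: "run V \<xi> u \<eta> \<Longrightarrow> u x \<ge> 0"
  by (induction rule: run.induct) auto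

lemma run_outside: "run V \<xi> u \<eta> \<Longrightarrow> x \<notin> V \<Longrightarrow> u x = 0"
  by (induction rule: run.induct) auto

lemma run_iff: "(legal_step V)\<^sup>*\<^sup>* \<xi> \<eta> \<longleftrightarrow> (\<exists>u. run V \<xi> u \<eta>)"
proof
  assume "(legal_step V)\<^sup>*\<^sup>* \<xi> \<eta>"
  then show "\<exists>u. run V \<xi> u \<eta>"
    by (induction) (auto simp: legal_step_def intro: run.intros)
next
  assume "\<exists>u. run V \<xi> u \<eta>"
  then obtain u where "run V \<xi> u \<eta>" ..
  then show "(legal_step V)\<^sup>*\<^sup>* \<xi> \<eta>"
    by (induction rule: run.induct) (auto simp: legal_step_def intro: rtranclp.rtrancl_into_rtrancl)
qed

text \<open>Least action principle. A first excess over \<open>m\<close> would be a toppling at some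
  \<open>z\<close> with \<open>u z = m z\<close> while \<open>u \<le> m\<close> elsewhere; then the
  height at \<open>z\<close> is at most its value under \<open>m\<close>, which is stable, so the
  toppling is not legal.\<close>

lemma run_least:
  assumes "run V \<xi> u \<eta>" "\<And>x. x \<in> V \<Longrightarrow> m x \<ge> 0" "stable V (topple_by V \<xi> m)" "x \<in> V"
  shows "u x \<le> m x"
  using assms(1,4)
proof (induction arbitrary: x rule: run.induct)
  case run_base then show ?case using assms(2) by simp
next
  case (run_step u \<eta> z)
  have "u z < m z"
  proof (rule ccontr)
    assume "\<not> u z < m z"
    then have eq: "u z = m z" using run_step.IH[of z] run_step.hyps by force
    have "\<eta> z = topple_by V \<xi> u z" using run_topple_by run_step.hyps by blast
    also have "\<dots> \<le> topple_by V \<xi> m z"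
      using eq run_step.hyps run_step.IH by (auto simp: topple_by_def intro!: sum_mono)
    also have "\<dots> \<le> 2 * dd TYPE('a)" using assms(3) run_step.hyps by (auto simp: stable_def)
    finally show False using run_step.hyps by simp
  qed
  then show ?case using run_step.IH[of x] run_step.prems by auto
qed

text \<open>An inverted paraboloid. The constant is large enough to make it nonnegative on
  \<open>V\<close> and its neighbours, so that cutting off the neighbours outside \<open>V\<close>
  only helps in \<open>bowl_lap\<close>.\<close>

definition bowl :: "'d::finite site set \<Rightarrow> 'd site \<Rightarrow> int" where
  "bowl V x = (\<Sum>y\<in>V. \<Sum>z\<in>insert y (nb y). sq2 z) - sq2 x"

lemma sq2_nonneg: "sq2 x \<ge> 0"
  unfolding sq2_def by (intro sum_nonneg) auto

lemma bowl_nonneg: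
  assumes "finite V" "y \<in> V" "x = y \<or> x \<in> nb y"
  shows "bowl V x \<ge> 0"
proof -
  have "sq2 x \<le> (\<Sum>z\<in>insert y (nb y). sq2 z)"
    using assms by (intro member_le_sum) (auto simp: sq2_nonneg)
  also have "\<dots> \<le> (\<Sum>y\<in>V. \<Sum>z\<in>insert y (nb y). sq2 z)"
    using assms by (intro member_le_sum[of y V "\<lambda>y. \<Sum>z\<in>insert y (nb y). sq2 z"]) (auto intro!: sum_nonneg add_nonneg_nonneg simp: sq2_nonneg)
  finally show ?thesis unfolding bowl_def by simp
qed

lemma bowl_lap:
  fixes y :: "'d::finite site"
  assumes "finite V" "y \<in> V"
  shows "2 * dd TYPE('d) * bowl V y - (\<Sum>z\<in>nb y \<inter> V. bowl V z) \<ge> 2 * dd TYPE('d)"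
proof -
  let ?C = "\<Sum>y\<in>V. \<Sum>z\<in>insert y (nb y). sq2 z"
  have "(\<Sum>z\<in>nb y \<inter> V. bowl V z) \<le> (\<Sum>z\<in>nb y. bowl V z)"
    using assms bowl_nonneg by (intro sum_mono2) auto
  also have "\<dots> = int (card (nb y)) * ?C - (\<Sum>z\<in>nb y. sq2 z)"
    unfolding bowl_def by (simp add: sum_subtractf)
  also have "\<dots> = 2 * dd TYPE('d) * bowl V y - 2 * dd TYPE('d)"
    unfolding card_nb sum_sq2_nb dd_deg bowl_def by (simp add: algebra_simps)
  finally show ?thesis by simp
qed

text \<open>Toppling according to a multiple of \<open>bowl\<close> lowers every height by at least
  that multiple; the sum of all absolute heights is a sufficient factor.\<close>

lemma ex_stabilizing:
  fixes \<xi> :: "'d::finite config"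
  assumes "finite V"
  shows "\<exists>m. (\<forall>x\<in>V. m x \<ge> 0) \<and> stable V (topple_by V \<xi> m)"
proof -
  define k where "k = (\<Sum>x\<in>V. \<bar>\<xi> x\<bar>)"
  have k: "k \<ge> 0" "\<And>x. x \<in> V \<Longrightarrow> \<xi> x \<le> k"
  proof -
    show "k \<ge> 0" unfolding k_def by (intro sum_nonneg) auto
    fix x assume "x \<in> V" then have "\<bar>\<xi> x\<bar> \<le> k" unfolding k_def using assms by (intro member_le_sum) auto
    then show "\<xi> x \<le> k" by simp
  qed
  have d: "dd TYPE('d) \<ge> 1" unfolding dd_def using card_gt_0_iff[of "UNIV :: 'd set"] by simp
  have "topple_by V \<xi> (\<lambda>x. k * bowl V x) y \<le> 2 * dd TYPE('d)" if y: "y \<in> V" for y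
  proof -
    have "topple_by V \<xi> (\<lambda>x. k * bowl V x) y = \<xi> y - k * (2 * dd TYPE('d) * bowl V y - (\<Sum>z\<in>nb y \<inter> V. bowl V z))"
      using y by (simp add: topple_by_def sum_distrib_left algebra_simps)
    also have "\<dots> \<le> \<xi> y - k * (2 * dd TYPE('d))"
      using mult_left_mono[OF bowl_lap[OF assms y] k(1)] by linarith
    also have "\<dots> \<le> \<xi> y - k * 1" using k(1) d by (intro diff_left_mono mult_left_mono) auto
    finally show ?thesis using k(2)[OF y] d by simp
  qed
  then show ?thesis using k bowl_nonneg[OF assms] by (intro exI[of _ "\<lambda>x. k * bowl V x"]) (auto simp: stable_def)
qed

lemma run_stable_unique:
  assumes "run V \<xi> u \<eta>" "stable V \<eta>" "run V \<xi> u' \<eta>'" "stable V \<eta>'"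
  shows "u = u'" "\<eta> = \<eta>'"
proof -
  have "u x \<le> u' x" "u' x \<le> u x" if "x \<in> V" for x
    using run_least[OF assms(1) _ _ that, of u'] run_least[OF assms(3) _ _ that, of u] assms run_topple_by run_nonneg
    by metis+
  then show "u = u'" using run_outside assms by (metis antisym ext)
  then show "\<eta> = \<eta>'" using assms run_topple_by by metis
qed

text \<open>By \<open>run_least\<close> the total number of topplings is bounded, and a run of
  maximal length must end in a stable configuration.\<close>

lemma ex_stable_run:
  assumes fV: "finite V"
  shows "\<exists>u \<eta>. run V \<xi> u \<eta> \<and> stable V \<eta>"
proof -
  obtain m where m: "\<And>x. x \<in> V \<Longrightarrow> m x \<ge> 0" "stable V (topple_by V \<xi> m)"
    using ex_stabilizing[OF fV] by blast
  define P where "P n \<longleftrightarrow> (\<exists>u \<eta>. run V \<xi> u \<eta> \<and> nat (\<Sum>x\<in>V. u x) = n)" for n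
  have "P 0" unfolding P_def using run_base[of V \<xi>] by (intro exI[of _ "\<lambda>_. 0"] exI[of _ \<xi>]) simp
  moreover have "n \<le> nat (\<Sum>x\<in>V. m x)" if "P n" for n
    using that run_least m unfolding P_def by (metis nat_mono sum_mono)
  ultimately obtain n where n: "P n" "\<And>k. P k \<Longrightarrow> k \<le> n"
    using Nat.ex_has_greatest_nat[of P 0 "nat (\<Sum>x\<in>V. m x)"] by blast
  then obtain u \<eta> where u: "run V \<xi> u \<eta>" "nat (\<Sum>x\<in>V. u x) = n" unfolding P_def by blast
  have "stable V \<eta>"
  proof (rule ccontr)
    assume "\<not> stable V \<eta>"
    then obtain z where z: "z \<in> V" "\<eta> z > 2 * dd TYPE('a)" unfolding stable_def by fastforce
    have "run V \<xi> (u(z := u z + 1)) (topple V z \<eta>)" using u z by (intro run_step) auto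
    moreover have "(\<Sum>x\<in>V. (u(z := u z + 1)) x) = (\<Sum>x\<in>V. u x + (if x = z then 1 else 0))"
      by (intro sum.cong) auto
    then have "(\<Sum>x\<in>V. (u(z := u z + 1)) x) = (\<Sum>x\<in>V. u x) + 1" using fV z by (simp add: sum.distrib)
    moreover have "(\<Sum>x\<in>V. u x) \<ge> 0" using u run_nonneg by (metis sum_nonneg)
    ultimately have "P (n + 1)" unfolding P_def using u by (intro exI[of _ "u(z := u z + 1)"] exI[of _ "topple V z \<eta>"]) (simp add: nat_add_distrib)
    then show False using n(2) by fastforce
  qed
  then show ?thesis using u by blast
qed

lemma stabilize_eqI:
  assumes "finite V" "(legal_step V)\<^sup>*\<^sup>* \<xi> \<eta>" "stable V \<eta>"
  shows "stabilize V \<xi> = \<eta>"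
  unfolding stabilize_def
proof (rule the_equality)
  fix \<eta>' assume "(legal_step V)\<^sup>*\<^sup>* \<xi> \<eta>' \<and> stable V \<eta>'"
  then show "\<eta>' = \<eta>" using assms(2,3) run_stable_unique(2) unfolding run_iff by blast
qed (use assms in simp)

lemma stabilize_props:
  assumes "finite V"
  shows "(legal_step V)\<^sup>*\<^sup>* \<xi> (stabilize V \<xi>)" "stable V (stabilize V \<xi>)"
proof -
  obtain \<eta> where e: "(legal_step V)\<^sup>*\<^sup>* \<xi> \<eta>" "stable V \<eta>" using ex_stable_run[OF assms] run_iff by blast
  then have "stabilize V \<xi> = \<eta>" using stabilize_eqI[OF assms] by blast
  then show "(legal_step V)\<^sup>*\<^sup>* \<xi> (stabilize V \<xi>)" "stable V (stabilize V \<xi>)" using e by auto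
qed

lemma legal_add:
  assumes "(legal_step V)\<^sup>*\<^sup>* \<xi> \<eta>" "\<And>x. c x \<ge> 0"
  shows "(legal_step V)\<^sup>*\<^sup>* (\<lambda>x. \<xi> x + c x) (\<lambda>x. \<eta> x + c x)"
  using assms(1)
proof (induction)
  case (step y z)
  then obtain w where w: "w \<in> V" "y w > 2 * dd TYPE('a)" "z = topple V w y" unfolding legal_step_def by blast
  have "legal_step V (\<lambda>x. y x + c x) (\<lambda>x. z x + c x)"
    unfolding legal_step_def
  proof (intro bexI conjI)
    show "y w + c w > 2 * dd TYPE('a)" using w assms(2)[of w] by simp
    show "(\<lambda>x. z x + c x) = topple V w (\<lambda>x. y x + c x)" using w by (auto simp: topple_def)
  qed (use w in auto)
  then show ?case using step.IH by simp
qed simp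

text \<open>The abelian property: topplings legal before adding grains stay legal afterwards, so
  stabilizing in two stages is one legal stabilization and uniqueness applies.\<close>

lemma stabilize_add:
  assumes "finite V" "\<And>x. c x \<ge> 0"
  shows "stabilize V (\<lambda>x. \<xi> x + c x) = stabilize V (\<lambda>x. stabilize V \<xi> x + c x)"
  using legal_add[OF stabilize_props(1)[OF assms(1), of \<xi>] assms(2)] stabilize_props[OF assms(1)]
  by (intro stabilize_eqI[OF assms(1)]) (meson rtranclp_trans)+

lemma stabilize_stable: "finite V \<Longrightarrow> stable V \<xi> \<Longrightarrow> stabilize V \<xi> = \<xi>"
  by (rule stabilize_eqI) auto

subsection \<open>Recurrent configurations are the allowed ones\<close>

text \<open>Absence of forbidden subconfigurations, in the normalization where heights start at
  1.\<close>

definition no_fsc :: "'d::finite site set \<Rightarrow> 'd config \<Rightarrow> bool" where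
  "no_fsc V \<xi> \<longleftrightarrow> (\<forall>F\<subseteq>V. F \<noteq> {} \<longrightarrow> (\<exists>x\<in>F. \<xi> x > int (card (nb x \<inter> F))))"

text \<open>Positivity without the upper bound of \<open>states\<close>, because the intermediate
  configurations of a stabilization are unstable.\<close>

definition pos_on :: "'d::finite site set \<Rightarrow> 'd config \<Rightarrow> bool" where
  "pos_on V \<xi> \<longleftrightarrow> (\<forall>x\<in>V. \<xi> x \<ge> 1) \<and> (\<forall>x. x \<notin> V \<longrightarrow> \<xi> x = 1)"

definition allowed :: "'d::finite site set \<Rightarrow> 'd config set" where
  "allowed V = {\<xi> \<in> states V. no_fsc V \<xi>}"

definition full :: "'d::finite site set \<Rightarrow> 'd config" where
  "full V = (\<lambda>x. if x \<in> V then 2 * dd TYPE('d) else 1)"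

lemma states_iff: "\<xi> \<in> states V \<longleftrightarrow> pos_on V \<xi> \<and> stable V \<xi>"
  unfolding states_def pos_on_def stable_def by auto

lemma pos_on_legal: "(legal_step V)\<^sup>*\<^sup>* \<xi> \<eta> \<Longrightarrow> pos_on V \<xi> \<Longrightarrow> pos_on V \<eta>"
proof (induction rule: rtranclp_induct)
  case (step y z)
  then obtain w where w: "w \<in> V" "y w > 2 * dd TYPE('a)" "z = topple V w y" unfolding legal_step_def by blast
  then show ?case using step by (auto simp: pos_on_def topple_def)
qed

text \<open>Test \<open>F - {z}\<close> before the toppling of \<open>z\<close>: the site found
  there gains one grain exactly when putting \<open>z\<close> back gives it one more neighbour in
  \<open>F\<close>. For \<open>F = {z}\<close> the height stays positive, as it exceeded
  \<open>2d\<close> before.\<close>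

lemma no_fsc_legal:
  assumes "(legal_step V)\<^sup>*\<^sup>* \<xi> \<eta>" "no_fsc V \<xi>" "finite V"
  shows "no_fsc V \<eta>"
  using assms(1,2)
proof (induction rule: rtranclp_induct)
  case (step \<xi> \<eta>)
  then obtain z where z: "z \<in> V" "\<xi> z > 2 * dd TYPE('a)" "\<eta> = topple V z \<xi>" unfolding legal_step_def by blast
  have nf: "no_fsc V \<xi>" using step by simp
  show ?case
    unfolding no_fsc_def
  proof (intro allI impI)
    fix F assume F: "F \<subseteq> V" "F \<noteq> {}"
    show "\<exists>x\<in>F. \<eta> x > int (card (nb x \<inter> F))"
    proof (cases "F - {z} = {}")
      case True
      then have "F = {z}" using F by auto
      moreover have "\<eta> z > 0" using z by (simp add: topple_def)
      ultimately show ?thesis using not_mem_nb_self[of z] by auto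
    next
      case False
      then obtain x where x: "x \<in> F - {z}" "\<xi> x > int (card (nb x \<inter> (F - {z})))"
        using nf F unfolding no_fsc_def by (meson Diff_subset subset_trans)
      have e: "\<eta> x = \<xi> x + (if adj z x then 1 else 0)" using x F z by (auto simp: topple_def)
      show ?thesis
      proof (cases "z \<in> F \<and> adj z x")
        case True
        then have "nb x \<inter> F = insert z (nb x \<inter> (F - {z}))" using adj_sym mem_nb by auto
        then have "card (nb x \<inter> F) = Suc (card (nb x \<inter> (F - {z})))" by (simp add: card_insert_if)
        then show ?thesis using x e True by (intro bexI[of _ x]) auto
      next
        case False
        then have "nb x \<inter> F = nb x \<inter> (F - {z})" using adj_sym mem_nb by auto
        then show ?thesis using x e by (intro bexI[of _ x]) auto
      qed
    qed
  qed
qed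

lemma no_fsc_mono: "no_fsc V \<xi> \<Longrightarrow> (\<And>x. x \<in> V \<Longrightarrow> \<xi> x \<le> \<eta> x) \<Longrightarrow> no_fsc V \<eta>"
  unfolding no_fsc_def by (meson less_le_trans subsetD)

lemma addop_states:
  assumes "finite V" "x \<in> V" "\<xi> \<in> states V"
  shows "addop V x \<xi> \<in> states V"
proof -
  have "pos_on V (\<xi>(x := \<xi> x + 1))" using assms by (auto simp: states_iff pos_on_def)
  then show ?thesis
    unfolding addop_def states_iff using pos_on_legal stabilize_props[OF assms(1)] by blast
qed

lemma addop_allowed:
  assumes "finite V" "x \<in> V" "\<xi> \<in> allowed V"
  shows "addop V x \<xi> \<in> allowed V"
proof -
  have "no_fsc V (\<xi>(x := \<xi> x + 1))" using assms by (auto simp: allowed_def intro: no_fsc_mono[of V \<xi>])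
  then have "no_fsc V (addop V x \<xi>)"
    unfolding addop_def using no_fsc_legal stabilize_props(1)[OF assms(1)] assms(1) by blast
  then show ?thesis using addop_states assms by (auto simp: allowed_def)
qed

lemma dd_pos: "dd TYPE('d::finite) \<ge> 1"
  unfolding dd_def using card_gt_0_iff[of "UNIV :: 'd set"] by simp

lemma full_states: "full V \<in> states V"
  using dd_pos[where 'd = 'a] unfolding full_def states_def by auto

text \<open>A site of \<open>F\<close> with maximal \<open>sq2\<close> has a neighbour outside
  \<open>F\<close>, since the mean of \<open>sq2\<close> over its neighbours is larger than its own
  value.\<close>

lemma full_allowed:
  fixes V :: "'d::finite site set"
  assumes fV: "finite V"
  shows "full V \<in> allowed V"
proof -
  have "\<exists>x\<in>F. full V x > int (card (nb x \<inter> F))" if F: "F \<subseteq> V" "F \<noteq> {}" for F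
  proof -
    have fF: "finite F" using F fV finite_subset by blast
    obtain x where x: "x \<in> F" "\<And>y. y \<in> F \<Longrightarrow> sq2 y \<le> sq2 x"
    proof -
      have "Max (sq2 ` F) \<in> sq2 ` F" using fF F by (intro Max_in) auto
      then obtain x where "x \<in> F" "sq2 x = Max (sq2 ` F)" by auto
      then show ?thesis using fF by (intro that[of x]) auto
    qed
    have "nb x \<inter> F \<noteq> nb x"
    proof
      assume "nb x \<inter> F = nb x"
      then have "(\<Sum>y\<in>nb x. sq2 y) \<le> (\<Sum>y\<in>nb x. sq2 x)" using x by (intro sum_mono) auto
      then have "int (deg TYPE('d)) * (sq2 x + 1) \<le> int (deg TYPE('d)) * sq2 x"
        unfolding sum_sq2_nb by (simp add: card_nb)
      then show False using dd_pos[where 'd='d] by (simp add: dd_def algebra_simps)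
    qed
    then have "card (nb x \<inter> F) < card (nb x)" by (intro psubset_card_mono) auto
    then have "int (card (nb x \<inter> F)) < 2 * dd TYPE('d)" unfolding card_nb dd_deg by simp
    then show ?thesis using x F by (intro bexI[of _ x]) (auto simp: full_def)
  qed
  then show ?thesis using full_states by (auto simp: allowed_def no_fsc_def)
qed

lemma reach_full:
  assumes fV: "finite V" and "\<xi> \<in> states V"
  shows "(chain_step V)\<^sup>*\<^sup>* \<xi> (full V)"
  using assms(2)
proof (induction "nat (\<Sum>x\<in>V. 2 * dd TYPE('a) - \<xi> x)" arbitrary: \<xi> rule: less_induct)
  case less
  show ?case
  proof (cases "\<xi> = full V")
    case False
    then obtain x where x: "x \<in> V" "\<xi> x < 2 * dd TYPE('a)"
      using less.prems by (fastforce simp: full_def states_def fun_eq_iff)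
    let ?\<eta> = "\<xi>(x := \<xi> x + 1)"
    have st: "?\<eta> \<in> states V" using less.prems x by (auto simp: states_def)
    then have a: "addop V x \<xi> = ?\<eta>" unfolding addop_def using stabilize_stable[OF fV] states_iff by blast
    have "(\<Sum>y\<in>V. 2 * dd TYPE('a) - ?\<eta> y) = (\<Sum>y\<in>V. (2 * dd TYPE('a) - \<xi> y) - (if y = x then 1 else 0))"
      by (intro sum.cong) auto
    then have 1: "(\<Sum>y\<in>V. 2 * dd TYPE('a) - ?\<eta> y) = (\<Sum>y\<in>V. 2 * dd TYPE('a) - \<xi> y) - 1"
      using x fV by (simp add: sum_subtractf)
    have "(\<Sum>y\<in>V. 2 * dd TYPE('a) - ?\<eta> y) \<ge> 0" using st by (intro sum_nonneg) (auto simp: states_def)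
    then have "(chain_step V)\<^sup>*\<^sup>* ?\<eta> (full V)" using 1 by (intro less.hyps st) linarith
    moreover have "chain_step V \<xi> ?\<eta>" unfolding chain_step_def using a x less.prems by metis
    ultimately show ?thesis by simp
  qed simp
qed

text \<open>Grains can be added one at a time with stabilization in between, by
  \<open>stabilize_add\<close>; each addition is one step of the chain.\<close>

lemma reach_from_full:
  assumes fV: "finite V" and c: "\<And>x. c x \<ge> 0" "\<And>x. x \<notin> V \<Longrightarrow> c x = 0"
  shows "(chain_step V)\<^sup>*\<^sup>* (full V) (stabilize V (\<lambda>x. full V x + c x)) \<and> stabilize V (\<lambda>x. full V x + c x) \<in> states V"
  using c
proof (induction "nat (\<Sum>x\<in>V. c x)" arbitrary: c rule: less_induct)
  case less
  show ?case
  proof (cases "\<forall>x\<in>V. c x = 0")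
    case True
    then have "c = (\<lambda>_. 0)" using less.prems by auto
    moreover have "stable V (full V)" using full_states[of V] states_iff by blast
    ultimately show ?thesis using stabilize_stable[OF fV, of "full V"] full_states[of V] by auto
  next
    case False
    then obtain x where x: "x \<in> V" "c x \<noteq> 0" by blast
    then have cx: "c x \<ge> 1" using less.prems(1)[of x] by simp
    let ?c = "c(x := c x - 1)" and ?e = "\<lambda>y. if y = x then 1 else (0::int)"
    have "(\<Sum>y\<in>V. ?c y) = (\<Sum>y\<in>V. c y - ?e y)" by (intro sum.cong) auto
    then have "(\<Sum>y\<in>V. ?c y) = (\<Sum>y\<in>V. c y) - 1" using x fV by (simp add: sum_subtractf)
    moreover have cn: "\<And>y. ?c y \<ge> 0" using less.prems cx by auto
    then have "(\<Sum>y\<in>V. ?c y) \<ge> 0" by (intro sum_nonneg) auto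
    ultimately have lt: "nat (\<Sum>y\<in>V. ?c y) < nat (\<Sum>y\<in>V. c y)" by linarith
    let ?s = "stabilize V (\<lambda>y. full V y + ?c y)"
    have IH: "(chain_step V)\<^sup>*\<^sup>* (full V) ?s" "?s \<in> states V"
    proof -
      have "\<And>y. y \<notin> V \<Longrightarrow> ?c y = 0" using less.prems x by auto
      then show "(chain_step V)\<^sup>*\<^sup>* (full V) ?s" "?s \<in> states V" using less.hyps[OF lt cn] by blast+
    qed
    have "(\<lambda>y. full V y + c y) = (\<lambda>y. (full V y + ?c y) + ?e y)" by auto
    then have "stabilize V (\<lambda>y. full V y + c y) = stabilize V (\<lambda>y. ?s y + ?e y)"
      using stabilize_add[OF fV, of ?e "\<lambda>y. full V y + ?c y"] by simp
    also have "(\<lambda>y. ?s y + ?e y) = ?s(x := ?s x + 1)" by auto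
    finally have e: "stabilize V (\<lambda>y. full V y + c y) = addop V x ?s" unfolding addop_def .
    then have "chain_step V ?s (stabilize V (\<lambda>y. full V y + c y))" unfolding chain_step_def using IH x by blast
    then show ?thesis using IH e addop_states[OF fV x(1) IH(2)] by simp
  qed
qed

text \<open>If the odometer of \<open>\<xi> + \<Delta>m\<close> falls short of \<open>m\<close>, the sites of maximal deficit form a
  forbidden subconfiguration of \<open>\<xi>\<close>.\<close>

lemma stabilize_lap_add:
  fixes \<xi> :: "'d::finite config"
  assumes fV: "finite V" and \<xi>: "\<xi> \<in> allowed V" and m: "\<And>x. x \<in> V \<Longrightarrow> m x \<ge> 0"
  shows "stabilize V (topple_by V \<xi> (\<lambda>x. - m x)) = \<xi>"
proof -
  let ?\<zeta> = "topple_by V \<xi> (\<lambda>x. - m x)"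
  obtain u \<eta> where u: "run V ?\<zeta> u \<eta>" "stable V \<eta>" using ex_stable_run[OF fV] by blast
  have tm: "topple_by V ?\<zeta> m = \<xi>" by (auto simp: topple_by_def fun_eq_iff sum_negf)
  have st: "stable V \<xi>" using \<xi> by (auto simp: allowed_def states_iff)
  have le: "\<And>x. x \<in> V \<Longrightarrow> u x \<le> m x" using run_least[OF u(1), of m] m tm st by auto
  define w where "w x = m x - u x" for x
  have \<eta>: "\<eta> x = \<xi> x + 2 * dd TYPE('d) * w x - (\<Sum>z\<in>nb x \<inter> V. w z)" if "x \<in> V" for x
    using run_topple_by[OF u(1)] that
    by (simp add: topple_by_def w_def sum_negf sum_subtractf algebra_simps)
  have w0: "w x = 0" if "x \<in> V" for x
  proof (rule ccontr)
    assume "w x \<noteq> 0"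
    then have "w x \<ge> 1" using le[OF that] unfolding w_def by simp
    define M where "M = Max (w ` V)"
    have MV: "\<And>y. y \<in> V \<Longrightarrow> w y \<le> M" unfolding M_def using fV by auto
    then have M: "M \<ge> 1" using \<open>w x \<ge> 1\<close> that by (meson order_trans)
    define F where "F = {y \<in> V. w y = M}"
    have "M \<in> w ` V" unfolding M_def using fV that by (intro Max_in) auto
    then have "F \<noteq> {}" unfolding F_def by auto
    then obtain y where y: "y \<in> F" "\<xi> y > int (card (nb y \<inter> F))"
    proof -
      have "F \<subseteq> V" unfolding F_def by auto
      then have "\<exists>y\<in>F. \<xi> y > int (card (nb y \<inter> F))" using \<xi> \<open>F \<noteq> {}\<close> unfolding allowed_def no_fsc_def by simp
      then show ?thesis using that by blast
    qed
    let ?c = "int (card (nb y \<inter> F))"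
    \<comment> \<open>Neighbours outside the set of maximal deficit have deficit at most
      \<open>M - 1\<close>. Thus the final height at \<open>y\<close> is at least its height in
      \<xi> plus \<open>2d\<close> minus the number of neighbours in \<open>F\<close>, which exceeds
      \<open>2d\<close>.\<close>
    have "(\<Sum>z\<in>nb y \<inter> V. w z) \<le> (\<Sum>z\<in>nb y \<inter> V. (M - 1) + (if z \<in> F then 1 else 0))"
    proof (rule sum_mono)
      fix z assume "z \<in> nb y \<inter> V"
      then show "w z \<le> (M - 1) + (if z \<in> F then 1 else 0)" using MV[of z] by (auto simp: F_def)
    qed
    also have "\<dots> = int (card (nb y \<inter> V)) * (M - 1) + int (card ((nb y \<inter> V) \<inter> F))"
      by (simp add: sum.distrib sum.If_cases)
    also have "(nb y \<inter> V) \<inter> F = nb y \<inter> F" unfolding F_def by auto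
    also have "int (card (nb y \<inter> V)) * (M - 1) + ?c \<le> 2 * dd TYPE('d) * (M - 1) + ?c"
      unfolding dd_deg using M card_nb_le[of y V] by (intro add_right_mono mult_right_mono) auto
    finally have "\<eta> y \<ge> \<xi> y + 2 * dd TYPE('d) - ?c"
      using \<eta>[of y] y unfolding F_def by (simp add: algebra_simps)
    moreover have "\<eta> y \<le> 2 * dd TYPE('d)" using u(2) y unfolding stable_def F_def by auto
    ultimately show False using y by simp
  qed
  have "\<eta> x = \<xi> x" for x
  proof (cases "x \<in> V")
    case True then show ?thesis using \<eta>[OF True] w0 by simp
  next
    case False then show ?thesis using run_topple_by[OF u(1)] by (simp add: topple_by_def)
  qed
  then have "\<eta> = \<xi>" by auto
  then show ?thesis using u stabilize_eqI[OF fV, of ?\<zeta> \<eta>] run_iff by blast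
qed

text \<open>Adding the Laplacian of \<open>bowl\<close> raises \<xi> above the full configuration,
  and stabilization undoes it by \<open>stabilize_lap_add\<close>. So \<xi> is obtained from
  \<open>full V\<close> by adding grains.\<close>

lemma allowed_reachable:
  fixes V :: "'d::finite site set"
  assumes fV: "finite V" and \<xi>: "\<xi> \<in> allowed V"
  shows "(chain_step V)\<^sup>*\<^sup>* (full V) \<xi>"
proof -
  let ?\<zeta> = "topple_by V \<xi> (\<lambda>x. - bowl V x)"
  define c where "c x = ?\<zeta> x - full V x" for x
  have xs: "\<xi> \<in> states V" using \<xi> by (simp add: allowed_def)
  have "c x \<ge> 0" for x
  proof (cases "x \<in> V")
    case True
    have "?\<zeta> x = \<xi> x + (2 * dd TYPE('d) * bowl V x - (\<Sum>z\<in>nb x \<inter> V. bowl V z))"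
      using True by (simp add: topple_by_def sum_negf)
    moreover have "\<xi> x \<ge> 1" using xs True by (auto simp: states_def)
    ultimately show ?thesis using bowl_lap[OF fV True] True by (simp add: c_def full_def)
  next
    case False then show ?thesis using xs by (simp add: c_def full_def topple_by_def states_def)
  qed
  moreover have "c x = 0" if "x \<notin> V" for x
    using that xs by (simp add: c_def full_def topple_by_def states_def)
  ultimately have "(chain_step V)\<^sup>*\<^sup>* (full V) (stabilize V (\<lambda>x. full V x + c x))"
    using reach_from_full[OF fV] by blast
  moreover have "(\<lambda>x. full V x + c x) = ?\<zeta>" by (auto simp: c_def)
  moreover have "stabilize V ?\<zeta> = \<xi>" using bowl_nonneg[OF fV] by (intro stabilize_lap_add[OF fV \<xi>]) auto
  ultimately show ?thesis by simp
qed

text \<open>Every state leads to \<open>full V\<close>, so the recurrent states are those reachable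
  from it. Allowedness is preserved by the chain, and all allowed states are reached.\<close>

theorem recurrent_eq_allowed:
  assumes fV: "finite V"
  shows "recurrent V = allowed V"
proof
  show "allowed V \<subseteq> recurrent V"
  proof
    fix \<xi> assume \<xi>: "\<xi> \<in> allowed V"
    then have xs: "\<xi> \<in> states V" by (simp add: allowed_def)
    have "(chain_step V)\<^sup>*\<^sup>* \<eta> \<xi>" if "(chain_step V)\<^sup>*\<^sup>* \<xi> \<eta>" for \<eta>
    proof -
      have "\<eta> \<in> states V" using that
        by (induction rule: rtranclp_induct) (auto simp: chain_step_def xs intro: addop_states[OF fV])
      then show ?thesis using reach_full[OF fV] allowed_reachable[OF fV \<xi>] by (meson rtranclp_trans)
    qed
    then show "\<xi> \<in> recurrent V" using xs by (simp add: recurrent_def)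
  qed
  show "recurrent V \<subseteq> allowed V"
  proof
    fix \<xi> assume \<xi>: "\<xi> \<in> recurrent V"
    then have "(chain_step V)\<^sup>*\<^sup>* \<xi> (full V)" using reach_full[OF fV] by (auto simp: recurrent_def)
    then have "(chain_step V)\<^sup>*\<^sup>* (full V) \<xi>" using \<xi> by (auto simp: recurrent_def)
    then show "\<xi> \<in> allowed V"
      by (induction rule: rtranclp_induct) (auto simp: chain_step_def full_allowed[OF fV] intro: addop_allowed[OF fV])
  qed
qed

subsection \<open>The sandpile and the spanning tree system\<close>

definition sandL :: "'d::finite site \<Rightarrow> int set" where
  "sandL x = {1..2 * dd TYPE('d)}"

definition sandb :: "'d::finite site \<Rightarrow> int \<Rightarrow> 'd site set \<Rightarrow> bool" where
  "sandb x l F \<longleftrightarrow> l \<le> int (card (nb x \<inter> F))"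

definition treeb :: "'d::finite site \<Rightarrow> 'd site \<Rightarrow> 'd site set \<Rightarrow> bool" where
  "treeb x y F \<longleftrightarrow> y \<in> F"

abbreviation SP :: "'d::finite site set \<Rightarrow> ('d site \<Rightarrow> int) set" where
  "SP V \<equiv> Rec V sandL sandb"

text \<open>A spanning tree of \<open>V\<close> wired to the complement, oriented to the root, is the map sending a
  vertex to its parent.\<close>

abbreviation TR :: "'d::finite site set \<Rightarrow> ('d site \<Rightarrow> 'd site) set" where
  "TR V \<equiv> Rec V nb treeb"

lemma mono_sandb: "mono_b sandb"
  unfolding mono_b_def sandb_def
  by (meson card_mono finite_Int finite_nb inf_mono of_nat_mono order_refl order_trans)

lemma mono_treeb: "mono_b treeb"
  unfolding mono_b_def treeb_def by blast

lemma finite_sandL [simp]: "finite (sandL x)"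
  unfolding sandL_def by simp

text \<open>With \<open>c\<close> neighbours of \<open>x\<close> in \<open>F\<close>, the blocked
  heights are 1 up to \<open>c\<close> and the blocked parents are these neighbours.\<close>

lemma same_counts_sand_tree: "same_counts V sandL sandb nb treeb"
  unfolding same_counts_def
proof (intro ballI conjI allI impI)
  fix x :: "'a site" and F assume "F \<subseteq> V"
  have "{l \<in> sandL x. sandb x l F} = {1..int (card (nb x \<inter> F))}"
    using card_nb_le[of x F] dd_deg[where 'd = 'a] unfolding sandL_def sandb_def by auto
  moreover have "{l \<in> nb x. treeb x l F} = nb x \<inter> F" unfolding treeb_def by auto
  ultimately show "card {l \<in> sandL x. sandb x l F} = card {l \<in> nb x. treeb x l F}" by simp
qed (auto simp: sandL_def card_nb dd_deg)

lemma card_SP_TR: "finite V \<Longrightarrow> card (SP V) = card (TR V)"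
  by (rule card_Rec_same_counts[OF _ same_counts_sand_tree mono_sandb mono_treeb])

lemma card_core_SP_TR:
  assumes fV: "finite V" and "B \<subseteq> W" "W \<subseteq> V"
  shows "card {s \<in> SP V. blocked_core V sandb B s = W} = card {T \<in> TR V. blocked_core V treeb B T = W}"
proof -
  have "finite (V - W)" "finite W" using fV assms finite_subset by auto
  then show ?thesis
    unfolding Rec_core_card[OF mono_sandb assms(2,3)] Rec_core_card[OF mono_treeb assms(2,3)]
    using card_Rec_same_counts[OF _ same_counts_outer[OF same_counts_sand_tree assms(3)] mono_outer_b[OF mono_sandb] mono_outer_b[OF mono_treeb]]
      card_Rec_same_counts[OF _ same_counts_inner[OF same_counts_sand_tree assms(3) mono_sandb mono_treeb] mono_sandb mono_treeb]
    by metis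
qed

text \<open>The comparison once more, now inside the core of \<open>C\<close>: the inner systems
  also have equal counts, so the core of \<open>B\<close> has the same conditional law for sandpile
  and tree.\<close>

lemma card_core_inner_SP_TR:
  assumes fV: "finite V" and "B \<subseteq> W'" "W' \<subseteq> W" "W \<subseteq> V"
  shows "card {s \<in> Rec W (inner_L sandL sandb W C) sandb. blocked_core W sandb B s = W'}
    = card {T \<in> Rec W (inner_L nb treeb W C) treeb. blocked_core W treeb B T = W'}"
proof -
  have fin: "finite (W - W')" "finite W'" using fV assms finite_subset by (auto intro: finite_subset)
  have sc: "same_counts W (inner_L sandL sandb W C) sandb (inner_L nb treeb W C) treeb"
    by (rule same_counts_inner[OF same_counts_sand_tree assms(4) mono_sandb mono_treeb])
  have 1: "card (Rec (W - W') (inner_L sandL sandb W C) (outer_b sandb W')) = card (Rec (W - W') (inner_L nb treeb W C) (outer_b treeb W'))"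
    by (rule card_Rec_same_counts[OF fin(1) same_counts_outer[OF sc assms(3)] mono_outer_b[OF mono_sandb] mono_outer_b[OF mono_treeb]])
  have 2: "card (Rec W' (inner_L (inner_L sandL sandb W C) sandb W' B) sandb) = card (Rec W' (inner_L (inner_L nb treeb W C) treeb W' B) treeb)"
    by (rule card_Rec_same_counts[OF fin(2) same_counts_inner[OF sc assms(3) mono_sandb mono_treeb] mono_sandb mono_treeb])
  show ?thesis
    unfolding Rec_core_card[OF mono_sandb assms(2,3)] Rec_core_card[OF mono_treeb assms(2,3)] using 1 2 by simp
qed

lemma allowed_SP_bij:
  fixes V :: "'d::finite site set"
  shows "bij_betw (\<lambda>\<xi>. restrict \<xi> V) (allowed V) (SP V)"
proof (rule bij_betw_byWitness[where f' = "\<lambda>s x. if x \<in> V then s x else 1"])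
  show "\<forall>\<xi>\<in>allowed V. (\<lambda>x. if x \<in> V then restrict \<xi> V x else 1) = \<xi>"
    by (auto simp: allowed_def states_def)
  show "\<forall>s\<in>SP V. restrict (\<lambda>x. if x \<in> V then s x else 1) V = s"
    by (auto simp: Rec_def PiE_def extensional_def fun_eq_iff)
  show "(\<lambda>\<xi>. restrict \<xi> V) ` allowed V \<subseteq> SP V"
  proof (rule image_subsetI)
    fix \<xi> assume \<xi>: "\<xi> \<in> allowed V"
    have "\<exists>x\<in>F. \<not> sandb x (restrict \<xi> V x) F" if F: "F \<subseteq> V" "F \<noteq> {}" for F
    proof -
      obtain x where "x \<in> F" "\<xi> x > int (card (nb x \<inter> F))" using \<xi> F unfolding allowed_def no_fsc_def by blast
      then show ?thesis using F by (intro bexI[of _ x]) (auto simp: sandb_def)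
    qed
    then show "restrict \<xi> V \<in> SP V" using \<xi> by (auto simp: Rec_def allowed_def states_def sandL_def)
  qed
  show "(\<lambda>s x. if x \<in> V then s x else 1) ` SP V \<subseteq> allowed V"
  proof (rule image_subsetI)
    fix s assume s: "s \<in> SP V"
    let ?\<xi> = "\<lambda>x. if x \<in> V then s x else 1"
    have "\<exists>x\<in>F. ?\<xi> x > int (card (nb x \<inter> F))" if F: "F \<subseteq> V" "F \<noteq> {}" for F
    proof -
      obtain x where "x \<in> F" "\<not> sandb x (s x) F" using Rec_unblocked[OF s F] by auto
      then show ?thesis using F by (intro bexI[of _ x]) (auto simp: sandb_def)
    qed
    then show "?\<xi> \<in> allowed V" using s by (auto simp: Rec_def allowed_def no_fsc_def states_def sandL_def PiE_def Pi_def)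
  qed
qed

lemma card_recurrent_event:
  assumes "finite V" "\<And>\<xi>. P \<xi> \<longleftrightarrow> Q (restrict \<xi> V)"
  shows "card {\<xi> \<in> recurrent V. P \<xi>} = card {s \<in> SP V. Q s}"
proof -
  have b: "bij_betw (\<lambda>\<xi>. restrict \<xi> V) (recurrent V) (SP V)"
    using allowed_SP_bij recurrent_eq_allowed[OF assms(1)] by metis
  have "bij_betw (\<lambda>\<xi>. restrict \<xi> V) {\<xi> \<in> recurrent V. P \<xi>} {s \<in> SP V. Q s}"
    using b assms(2) unfolding bij_betw_def by (auto simp: inj_on_def image_iff)
  then show ?thesis using bij_betw_same_card by blast
qed

lemma card_recurrent: "finite V \<Longrightarrow> card (recurrent V) = card (TR V)"
  using card_recurrent_event[of V "\<lambda>_. True" "\<lambda>_. True"] card_SP_TR by simp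

lemma finite_TR [simp]: "finite V \<Longrightarrow> finite (TR V)"
  by (rule finite_Rec) auto

lemma finite_SP [simp]: "finite V \<Longrightarrow> finite (SP V)"
  by (rule finite_Rec) auto

lemma card_TR_pos: "finite V \<Longrightarrow> card (TR V) > 0"
proof -
  assume fV: "finite V"
  have "restrict (full V) V \<in> SP V" using full_allowed[OF fV] allowed_SP_bij[of V] unfolding bij_betw_def by blast
  then have "card (SP V) > 0" using finite_SP[OF fV] card_gt_0_iff by blast
  then show ?thesis using card_SP_TR[OF fV] by simp
qed

subsection \<open>Minimal configurations\<close>

text \<open>Smallest heights compatible with burning the sites of \<open>W\<close> in the order of
  decreasing \<open>sq2\<close>: at its turn a site still has its lower neighbours in
  \<open>W\<close>.\<close>

definition minc :: "'d::finite site set \<Rightarrow> 'd config" where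
  "minc W x = 1 + int (card {y \<in> nb x \<inter> W. sq2 y < sq2 x})"

text \<open>Moving one step changes \<open>sq2\<close> by an odd number, so neighbours never
  tie.\<close>

lemma sq2_adj_ne: "y \<in> nb x \<Longrightarrow> sq2 y \<noteq> sq2 x"
  unfolding mem_nb adj_iff
proof (clarify)
  fix i and s :: int assume s: "s \<in> {1, -1}" and e: "sq2 (x(i := x i + s)) = sq2 x"
  then have "2 * s * x i + s\<^sup>2 = 0" unfolding sq2_upd by simp
  then have "2 * (s * x i) = -1" using s by (auto simp: power2_eq_square)
  then show False by presburger
qed

lemma ex_higher_nb: "\<exists>y\<in>nb (x :: 'd::finite site). sq2 y > sq2 x"
proof (rule ccontr)
  assume a: "\<not> (\<exists>y\<in>nb x. sq2 y > sq2 x)"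
  then have "(\<Sum>y\<in>nb x. sq2 y) \<le> (\<Sum>y\<in>nb x. sq2 x)" by (intro sum_mono) force
  then have "int (deg TYPE('d)) * (sq2 x + 1) \<le> int (deg TYPE('d)) * sq2 x"
    unfolding sum_sq2_nb by (simp add: card_nb)
  then show False using dd_pos[where 'd='d] by (simp add: dd_def algebra_simps)
qed

lemma minc_range: "minc W x \<in> sandL (x :: 'd::finite site)"
proof -
  obtain y where y: "y \<in> nb x" "sq2 y > sq2 x" using ex_higher_nb by blast
  have "{z \<in> nb x \<inter> W. sq2 z < sq2 x} \<subseteq> nb x - {y}" using y by auto
  then have "card {z \<in> nb x \<inter> W. sq2 z < sq2 x} \<le> card (nb x - {y})" by (intro card_mono) auto
  moreover have "card (nb x - {y}) < card (nb x)" using y by (intro card_Diff1_less) auto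
  ultimately have "card {z \<in> nb x \<inter> W. sq2 z < sq2 x} < card (nb x)" by simp
  then show ?thesis unfolding minc_def sandL_def card_nb using dd_deg[where 'd='d] by simp
qed

text \<open>\<open>F \<union> W\<close> contains an unblocked site \<open>x\<close>, necessarily in
  \<open>W\<close>. Its height only exceeds the number of lower neighbours in \<open>W\<close>, so
  \<open>x\<close> has no neighbour in \<open>F\<close> and no higher one in \<open>W\<close>.
  Removing \<open>x\<close> from \<open>W\<close> therefore changes neither the minimal heights of
  the rest nor the blocking of \<open>F\<close>, and \<open>W\<close> can be exhausted.\<close>

lemma minc_no_blocked_outside:
  assumes s: "s \<in> SP V" and fW: "finite W"
  shows "F \<noteq> {} \<Longrightarrow> F \<union> W \<subseteq> V \<Longrightarrow> F \<inter> W = {} \<Longrightarrow> (\<And>x. x \<in> W \<Longrightarrow> s x = minc W x)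
    \<Longrightarrow> (\<And>x. x \<in> F \<Longrightarrow> sandb x (s x) (F \<union> W)) \<Longrightarrow> False"
  using fW
proof (induction "card W" arbitrary: W rule: less_induct)
  case less
  obtain x where x: "x \<in> F \<union> W" "\<not> sandb x (s x) (F \<union> W)"
    using Rec_unblocked[OF s, of "F \<union> W"] less.prems by auto
  then have xW: "x \<in> W" using less.prems by auto
  let ?low = "{y \<in> nb x \<inter> W. sq2 y < sq2 x}"
  have "card (nb x \<inter> (F \<union> W)) \<le> card ?low"
    using x(2) less.prems(4)[OF xW] unfolding sandb_def minc_def by simp
  then have low: "?low = nb x \<inter> (F \<union> W)" by (intro card_seteq) auto
  let ?W = "W - {x}"
  have "card ?W < card W" using xW less.prems by (intro psubset_card_mono) auto
  moreover have "s y = minc ?W y" if y: "y \<in> ?W" for y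
  proof -
    have "{z \<in> nb y \<inter> ?W. sq2 z < sq2 y} = {z \<in> nb y \<inter> W. sq2 z < sq2 y}"
    proof -
      have "\<not> (x \<in> nb y \<and> sq2 x < sq2 y)"
      proof
        assume a: "x \<in> nb y \<and> sq2 x < sq2 y"
        then have "y \<in> nb x \<inter> (F \<union> W)" using y nb_sym by auto
        then have "sq2 y < sq2 x" using low by blast
        then show False using a by simp
      qed
      then show ?thesis by auto
    qed
    then show ?thesis using less.prems(4)[of y] y unfolding minc_def by simp
  qed
  moreover have "sandb y (s y) (F \<union> ?W)" if y: "y \<in> F" for y
  proof -
    have "x \<notin> nb y"
    proof
      assume "x \<in> nb y" then have "y \<in> nb x \<inter> (F \<union> W)" using y nb_sym by auto
      then have "y \<in> W" using low by blast
      then show False using y less.prems by auto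
    qed
    then have "nb y \<inter> (F \<union> ?W) = nb y \<inter> (F \<union> W)" by auto
    then show ?thesis using less.prems(5)[OF y] unfolding sandb_def by simp
  qed
  ultimately show False using less.hyps[of ?W] less.prems by blast
qed

text \<open>Sites in \<open>W\<close> with minimal labels burn only after their neighbours outside \<open>W\<close>, in a prescribed order.\<close>

lemma card_minc:
  fixes V :: "'d::finite site set"
  assumes fV: "finite V" and WV: "W \<subseteq> V"
  shows "card {s \<in> SP V. \<forall>x\<in>W. s x = minc W x} = card (Rec (V - W) sandL (outer_b sandb W))"
proof -
  have fW: "finite W" using fV WV finite_subset by blast
  have "bij_betw (\<lambda>s. restrict s (V - W)) {s \<in> SP V. \<forall>x\<in>W. s x = minc W x} (Rec (V - W) sandL (outer_b sandb W))"
  proof (rule bij_betw_byWitness[where f' = "\<lambda>t x. if x \<in> W then minc W x else t x"])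
    show "\<forall>s\<in>{s \<in> SP V. \<forall>x\<in>W. s x = minc W x}. (\<lambda>x. if x \<in> W then minc W x else restrict s (V - W) x) = s"
      by (auto simp: Rec_def PiE_def extensional_def fun_eq_iff)
    show "\<forall>t\<in>Rec (V - W) sandL (outer_b sandb W). restrict (\<lambda>x. if x \<in> W then minc W x else t x) (V - W) = t"
      by (auto simp: Rec_def PiE_def extensional_def fun_eq_iff)
    show "(\<lambda>s. restrict s (V - W)) ` {s \<in> SP V. \<forall>x\<in>W. s x = minc W x} \<subseteq> Rec (V - W) sandL (outer_b sandb W)"
    proof (rule image_subsetI)
      fix s assume s: "s \<in> {s \<in> SP V. \<forall>x\<in>W. s x = minc W x}"
      have "\<exists>x\<in>F. \<not> outer_b sandb W x (restrict s (V - W) x) F" if F: "F \<subseteq> V - W" "F \<noteq> {}" for F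
      proof (rule ccontr)
        assume "\<not> (\<exists>x\<in>F. \<not> outer_b sandb W x (restrict s (V - W) x) F)"
        then have "\<And>x. x \<in> F \<Longrightarrow> sandb x (s x) (F \<union> W)" using F unfolding outer_b_def by (metis restrict_apply' subsetD)
        then show False using minc_no_blocked_outside[of s V W F] s F WV fW by blast
      qed
      then show "restrict s (V - W) \<in> Rec (V - W) sandL (outer_b sandb W)" using s by (auto simp: Rec_def)
    qed
    show "(\<lambda>t x. if x \<in> W then minc W x else t x) ` Rec (V - W) sandL (outer_b sandb W) \<subseteq> {s \<in> SP V. \<forall>x\<in>W. s x = minc W x}"
    proof (rule image_subsetI)
      fix t assume t: "t \<in> Rec (V - W) sandL (outer_b sandb W)"
      let ?s = "\<lambda>x. if x \<in> W then minc W x else t x"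
      have "\<exists>x\<in>F. \<not> sandb x (?s x) F" if F: "F \<subseteq> V" "F \<noteq> {}" for F
      proof (cases "F \<subseteq> W")
        case False
        then obtain x where x: "x \<in> F - W" "\<not> sandb x (t x) ((F - W) \<union> W)"
          using Rec_unblocked[OF t, of "F - W"] F unfolding outer_b_def by auto
        then have "\<not> sandb x (t x) F" using mono_bD[OF mono_sandb, of F "(F - W) \<union> W"] by blast
        then show ?thesis using x by (intro bexI[of _ x]) auto
      next
        case True
        have fF: "finite F" using True fW finite_subset by blast
        \<comment> \<open>At a maximum of \<open>sq2\<close> over \<open>F\<close> all neighbours in
          \<open>F\<close> are strictly lower, hence counted in \<open>minc\<close>.\<close>
        obtain x where x: "x \<in> F" "\<And>y. y \<in> F \<Longrightarrow> sq2 y \<le> sq2 x"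
        proof -
          have "Max (sq2 ` F) \<in> sq2 ` F" using fF F by (intro Max_in) auto
          then obtain x where "x \<in> F" "sq2 x = Max (sq2 ` F)" by auto
          then show ?thesis using fF by (intro that[of x]) auto
        qed
        have "nb x \<inter> F \<subseteq> {y \<in> nb x \<inter> W. sq2 y < sq2 x}" using x True sq2_adj_ne by force
        then have "card (nb x \<inter> F) \<le> card {y \<in> nb x \<inter> W. sq2 y < sq2 x}" by (intro card_mono) auto
        then have "\<not> sandb x (?s x) F" using x True by (auto simp: sandb_def minc_def)
        then show ?thesis using x by blast
      qed
      moreover have "?s \<in> PiE V sandL" using t WV minc_range by (fastforce simp: Rec_def PiE_def Pi_def extensional_def)
      ultimately show "?s \<in> {s \<in> SP V. \<forall>x\<in>W. s x = minc W x}" by (simp add: Rec_def)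
    qed
  qed
  then show ?thesis using bij_betw_same_card by blast
qed

text \<open>Core events and minimal configurations have the same outer factor. A non-local tree
  event thus becomes a cylinder event of the sandpile times a number independent of
  \<open>V\<close>, and weak convergence can be applied to it.\<close>

lemma card_core_TR:
  fixes V :: "'d::finite site set"
  assumes fV: "finite V" and "B \<subseteq> W" "W \<subseteq> V"
  shows "card {T \<in> TR V. blocked_core V treeb B T = W}
    = card {\<xi> \<in> recurrent V. \<forall>x\<in>W. \<xi> x = minc W x} * card (Rec W (inner_L sandL sandb W B) sandb)"
proof -
  have "card {\<xi> \<in> recurrent V. \<forall>x\<in>W. \<xi> x = minc W x} = card {s \<in> SP V. \<forall>x\<in>W. s x = minc W x}"
    by (rule card_recurrent_event[OF fV]) (use assms in auto)
  then show ?thesis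
    using card_core_SP_TR[OF assms] Rec_core_card[OF mono_sandb assms(2,3), of sandL] card_minc[OF fV assms(3)] by simp
qed

subsection \<open>Cylinder events in the limit\<close>

lemma open_cylinder: "finite S \<Longrightarrow> open {\<eta> :: 'd::finite config. \<forall>x\<in>S. \<eta> x = \<zeta> x}"
proof -
  assume "finite S"
  then have "finite {i. (if i \<in> S then {\<zeta> i} else UNIV) \<noteq> (UNIV :: int set)}" by (auto intro: finite_subset[of _ S])
  then have "open (PiE UNIV (\<lambda>x. if x \<in> S then {\<zeta> x} else (UNIV :: int set)))"
    by (intro open_PiE) (simp_all only: discrete_topology_class.open_discrete)
  moreover have "PiE UNIV (\<lambda>x. if x \<in> S then {\<zeta> x} else (UNIV :: int set)) = {\<eta>. \<forall>x\<in>S. \<eta> x = \<zeta> x}"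
    by (auto simp: PiE_def Pi_def split: if_splits)
  ultimately show ?thesis by simp
qed

lemma continuous_on_cylinder:
  fixes g :: "'d::finite config \<Rightarrow> real"
  assumes "finite S" "\<And>\<eta> \<zeta>. (\<And>x. x \<in> S \<Longrightarrow> \<eta> x = \<zeta> x) \<Longrightarrow> g \<eta> = g \<zeta>"
  shows "continuous_on A g"
proof -
  have "open (g -` B)" for B
  proof -
    have "g -` B = (\<Union>\<zeta>\<in>g -` B. {\<eta>. \<forall>x\<in>S. \<eta> x = \<zeta> x})" using assms(2) by fastforce
    moreover have "open (\<Union>\<zeta>\<in>g -` B. {\<eta> :: 'd config. \<forall>x\<in>S. \<eta> x = \<zeta> x})"
      using open_cylinder[OF assms(1)] by (intro open_UN) blast
    ultimately show ?thesis by simp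
  qed
  then have "continuous_on UNIV g" by (simp add: continuous_on_open_vimage)
  then show ?thesis using continuous_on_subset by blast
qed

text \<open>Required for all functions, not only those in \<open>Omega\<close>, so that it applies
  to restrictions, which are undefined off their domain.\<close>

definition depends_on :: "('a \<Rightarrow> 'b) set \<Rightarrow> 'a set \<Rightarrow> bool" where
  "depends_on E S \<longleftrightarrow> (\<forall>\<eta> \<zeta>. (\<forall>x\<in>S. \<eta> x = \<zeta> x) \<longrightarrow> (\<eta> \<in> E \<longleftrightarrow> \<zeta> \<in> E))"

lemma depends_onD: "depends_on E S \<Longrightarrow> (\<And>x. x \<in> S \<Longrightarrow> \<eta> x = \<zeta> x) \<Longrightarrow> \<eta> \<in> E \<longleftrightarrow> \<zeta> \<in> E"
  unfolding depends_on_def by blast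

lemma space_OmegaM: "space OmegaM = Omega"
  unfolding OmegaM_def Omega_def space_PiM by (auto simp: PiE_def Pi_def)

lemma point_cylinder_sets:
  fixes \<zeta> :: "'d::finite config"
  assumes "finite S"
  shows "{\<eta> \<in> Omega. \<forall>x\<in>S. \<eta> x = \<zeta> x} \<in> sets OmegaM"
proof -
  have "{\<eta> \<in> space OmegaM. \<eta> x = \<zeta> x} \<in> sets OmegaM" for x
  proof -
    have "(\<lambda>\<eta>. \<eta> x) \<in> measurable OmegaM (count_space {1..2 * dd TYPE('d)})"
      unfolding OmegaM_def by simp
    then have "(\<lambda>\<eta>. \<eta> x) -` ({\<zeta> x} \<inter> {1..2 * dd TYPE('d)}) \<inter> space OmegaM \<in> sets OmegaM"
      by (rule measurable_sets) simp
    moreover have "(\<lambda>\<eta>. \<eta> x) -` ({\<zeta> x} \<inter> {1..2 * dd TYPE('d)}) \<inter> space OmegaM = {\<eta> \<in> space OmegaM. \<eta> x = \<zeta> x}"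
    proof (rule set_eqI)
      fix \<eta> :: "'d config"
      have "\<eta> \<in> Omega \<Longrightarrow> \<eta> x \<in> {1..2 * dd TYPE('d)}" unfolding Omega_def by blast
      then show "\<eta> \<in> (\<lambda>\<eta>. \<eta> x) -` ({\<zeta> x} \<inter> {1..2 * dd TYPE('d)}) \<inter> space OmegaM \<longleftrightarrow> \<eta> \<in> {\<eta> \<in> space OmegaM. \<eta> x = \<zeta> x}"
        unfolding space_OmegaM by auto
    qed
    ultimately show ?thesis by simp
  qed
  then have "{\<eta> \<in> space OmegaM. \<forall>x\<in>S. \<eta> x = \<zeta> x} \<in> sets OmegaM"
    using assms by (intro sets.sets_Collect_finite_All) auto
  then show ?thesis by (simp add: space_OmegaM)
qed

lemma cylinder_sets:
  fixes E :: "'d::finite config set"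
  assumes fS: "finite S" and E: "depends_on E S"
  shows "Omega \<inter> E \<in> sets OmegaM"
proof -
  let ?R = "(\<lambda>\<eta>. restrict \<eta> S) ` (Omega \<inter> E)"
  have "?R \<subseteq> PiE S (\<lambda>_. {1..2 * dd TYPE('d)})" by (auto simp: Omega_def)
  moreover have "finite (PiE S (\<lambda>_. {1..2 * dd TYPE('d)}))" by (rule finite_PiE[OF fS]) simp
  ultimately have "finite ?R" by (rule finite_subset)
  then have "(\<Union>\<zeta>\<in>?R. {\<eta> \<in> Omega. \<forall>x\<in>S. \<eta> x = \<zeta> x}) \<in> sets OmegaM"
    using point_cylinder_sets[OF fS] by (intro sets.finite_UN) auto
  moreover have "(\<Union>\<zeta>\<in>?R. {\<eta> \<in> Omega. \<forall>x\<in>S. \<eta> x = \<zeta> x}) = Omega \<inter> E"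
  proof (intro set_eqI iffI)
    fix \<eta> assume "\<eta> \<in> (\<Union>\<zeta>\<in>?R. {\<eta> \<in> Omega. \<forall>x\<in>S. \<eta> x = \<zeta> x})"
    then obtain \<zeta> where "\<zeta> \<in> Omega \<inter> E" "\<eta> \<in> Omega" "\<forall>x\<in>S. \<eta> x = \<zeta> x" by auto
    then show "\<eta> \<in> Omega \<inter> E" using depends_onD[OF E, of \<eta> \<zeta>] by auto
  qed auto
  ultimately show ?thesis by simp
qed

definition PV :: "'d::finite site set \<Rightarrow> 'd config set \<Rightarrow> real" where
  "PV V E = card (recurrent V \<inter> E) / card (recurrent V)"

lemma weak_limit_cylinder:
  fixes \<mu> :: "('d::finite) config measure"
  assumes "prob_space \<mu>" "sets \<mu> = sets OmegaM" "weak_limit \<mu>" and fS: "finite S" and E: "depends_on E S"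
  shows "((\<lambda>V. PV V E) \<longlongrightarrow> measure \<mu> (Omega \<inter> E)) (finite_subsets_at_top UNIV)"
proof -
  interpret prob_space \<mu> by fact
  let ?f = "indicator E :: 'd config \<Rightarrow> real"
  have "continuous_on Omega ?f"
  proof (rule continuous_on_cylinder[OF fS])
    fix \<eta> \<zeta> :: "'d config" assume "\<And>x. x \<in> S \<Longrightarrow> \<eta> x = \<zeta> x"
    then have "\<eta> \<in> E \<longleftrightarrow> \<zeta> \<in> E" by (rule depends_onD[OF E])
    then show "?f \<eta> = ?f \<zeta>" by (simp add: indicator_def)
  qed
  then have lim: "((\<lambda>V. (\<Sum>\<xi>\<in>recurrent V. ?f \<xi>) / real (card (recurrent V))) \<longlongrightarrow> integral\<^sup>L \<mu> ?f) (finite_subsets_at_top UNIV)"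
    using assms(3) unfolding weak_limit_def by blast
  have sp: "space \<mu> = Omega" using sets_eq_imp_space_eq[OF assms(2)] space_OmegaM by simp
  have "integral\<^sup>L \<mu> ?f = integral\<^sup>L \<mu> (indicator (Omega \<inter> E) :: 'd config \<Rightarrow> real)"
    using sp by (intro Bochner_Integration.integral_cong) (auto simp: indicator_def)
  also have "\<dots> = measure \<mu> (Omega \<inter> E)"
    using cylinder_sets[OF fS E] assms(2) sp by (simp add: Int_ac)
  finally have int: "integral\<^sup>L \<mu> ?f = measure \<mu> (Omega \<inter> E)" .
  have "(\<Sum>\<xi>\<in>recurrent V. ?f \<xi>) / real (card (recurrent V)) = PV V E" if "finite V" for V
  proof -
    have "finite (recurrent V)"
      using card_recurrent[OF that] card_TR_pos[OF that] by (intro card_ge_0_finite) simp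
    then have "(\<Sum>\<xi>\<in>recurrent V. ?f \<xi>) = card (recurrent V \<inter> E)" by (simp add: indicator_def sum.If_cases Int_def)
    then show ?thesis unfolding PV_def by simp
  qed
  then have ev: "\<forall>\<^sub>F V in finite_subsets_at_top UNIV. (\<Sum>\<xi>\<in>recurrent V. ?f \<xi>) / real (card (recurrent V)) = PV V E"
    unfolding eventually_finite_subsets_at_top by (intro exI[of _ "{}"]) auto
  show ?thesis using lim unfolding int by (rule Lim_transform_eventually) (rule ev)
qed

definition PT :: "'d::finite site set \<Rightarrow> ('d site \<Rightarrow> 'd site) set \<Rightarrow> real" where
  "PT V E = card (TR V \<inter> E) / card (TR V)"

text \<open>The limiting probability that the core of \<open>B\<close> is \<open>W\<close>. Nothing
  here ensures that these numbers add up to 1 over the finite \<open>W\<close>; this is the content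
  of one-endedness.\<close>

definition core_prob :: "('d::finite) config measure \<Rightarrow> 'd site set \<Rightarrow> 'd site set \<Rightarrow> real" where
  "core_prob \<mu> B W = measure \<mu> (Omega \<inter> {\<eta>. \<forall>x\<in>W. \<eta> x = minc W x}) * card (Rec W (inner_L sandL sandb W B) sandb)"

lemma PT_core_limit:
  fixes \<mu> :: "('d::finite) config measure"
  assumes "prob_space \<mu>" "sets \<mu> = sets OmegaM" "weak_limit \<mu>" and fW: "finite W" and BW: "B \<subseteq> W"
  shows "((\<lambda>V. PT V {T. blocked_core V treeb B T = W}) \<longlongrightarrow> core_prob \<mu> B W) (finite_subsets_at_top UNIV)"
proof -
  let ?E = "{\<eta> :: 'd config. \<forall>x\<in>W. \<eta> x = minc W x}" and ?z = "card (Rec W (inner_L sandL sandb W B) sandb)"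
  have "depends_on ?E W" unfolding depends_on_def by auto
  then have "((\<lambda>V. PV V ?E * ?z) \<longlongrightarrow> core_prob \<mu> B W) (finite_subsets_at_top UNIV)"
    unfolding core_prob_def using assms by (intro tendsto_mult tendsto_const weak_limit_cylinder)
  moreover have "PV V ?E * ?z = PT V {T. blocked_core V treeb B T = W}" if "finite V" "W \<subseteq> V" for V
    using card_core_TR[OF that(1) BW that(2)] card_recurrent[OF that(1)]
    unfolding PV_def PT_def by (simp add: Int_def)
  then have ev: "\<forall>\<^sub>F V in finite_subsets_at_top UNIV. PV V ?E * ?z = PT V {T. blocked_core V treeb B T = W}"
    unfolding eventually_finite_subsets_at_top using fW by (intro exI[of _ W]) auto
  ultimately show ?thesis by (rule Lim_transform_eventually)
qed

subsection \<open>Descendants in a wired tree\<close>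

text \<open>Sites outside \<open>V\<close> are made fixed points, so iteration is total and an
  ancestral path stops where it leaves \<open>V\<close>.\<close>

definition adv :: "'a set \<Rightarrow> ('a \<Rightarrow> 'a) \<Rightarrow> 'a \<Rightarrow> 'a" where
  "adv V T z = (if z \<in> V then T z else z)"

definition up :: "'a set \<Rightarrow> ('a \<Rightarrow> 'a) \<Rightarrow> nat \<Rightarrow> 'a \<Rightarrow> 'a" where
  "up V T k z = ((adv V T) ^^ k) z"

definition desc :: "'a set \<Rightarrow> ('a \<Rightarrow> 'a) \<Rightarrow> 'a \<Rightarrow> 'a set" where
  "desc V T x = {z \<in> V. \<exists>k. up V T k z = x}"

abbreviation sz :: "'a set \<Rightarrow> ('a \<Rightarrow> 'a) \<Rightarrow> 'a \<Rightarrow> nat" where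
  "sz V T x \<equiv> card (desc V T x)"

definition window :: "'a set \<Rightarrow> ('a \<Rightarrow> 'a) \<Rightarrow> nat \<Rightarrow> nat \<Rightarrow> 'a set" where
  "window V T a h = {w \<in> V. a \<le> sz V T w \<and> sz V T w \<le> h}"

text \<open>\<open>K\<close> makes the path unique, since each next vertex is the only child with at
  least \<open>K\<close> descendants; \<open>H\<close> puts everything hanging off the path into the
  range of sizes controlled by \<open>window\<close>.\<close>

definition spine :: "'a set \<Rightarrow> ('a \<Rightarrow> 'a) \<Rightarrow> nat \<Rightarrow> nat \<Rightarrow> nat \<Rightarrow> 'a \<Rightarrow> (nat \<Rightarrow> 'a) \<Rightarrow> bool" where
  "spine V T K G H x c \<longleftrightarrow> c 0 = x
     \<and> (\<forall>i<G. c (Suc i) \<in> V \<and> T (c (Suc i)) = c i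
          \<and> (\<forall>z\<in>V. T z = c i \<longrightarrow> z \<noteq> c (Suc i) \<longrightarrow> sz V T z < K))
     \<and> K \<le> sz V T (c G) \<and> card (desc V T x - desc V T (c G)) \<le> H"

text \<open>A side branch at least as deep as its foot is far from the start of the spine. That
  comparison is what lets a vertex halfway along the side branch encode the position of the
  foot.\<close>

definition long_bush :: "'a set \<Rightarrow> ('a \<Rightarrow> 'a) \<Rightarrow> nat \<Rightarrow> nat \<Rightarrow> (nat \<Rightarrow> 'a) \<Rightarrow> bool" where
  "long_bush V T G r c \<longleftrightarrow> (\<exists>j<G. \<exists>z l. z \<in> desc V T (c j) - desc V T (c (Suc j)) \<and> up V T l z = c j
     \<and> j \<le> l \<and> r \<le> l)"

text \<open>The exceptional vertices in \<open>spines_dichotomy\<close>. The height is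
  \<open>G - 1\<close> because cutting the edge between the vertices \<open>G - 1\<close> and
  \<open>G\<close> of the path leaves this ancestor's descendants on one side and the end of the
  other spine on the other.\<close>

definition tip :: "'a set \<Rightarrow> ('a \<Rightarrow> 'a) \<Rightarrow> nat \<Rightarrow> nat \<Rightarrow> 'a \<Rightarrow> bool" where
  "tip V T G H y \<longleftrightarrow> up V T (G - 1) y \<in> V \<and> sz V T (up V T (G - 1) y) \<le> H"

lemma up_0 [simp]: "up V T 0 z = z"
  by (simp add: up_def)

lemma up_Suc: "up V T (Suc k) z = adv V T (up V T k z)"
  by (simp add: up_def)

lemma up_Suc': "up V T (Suc k) z = up V T k (adv V T z)"
  by (simp add: up_def funpow_swap1)

lemma up_add: "up V T (a + b) z = up V T a (up V T b z)"
  by (simp add: up_def funpow_add)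

lemma up_out: "z \<notin> V \<Longrightarrow> up V T k z = z"
  by (induction k) (auto simp: up_Suc adv_def)

lemma up_in_le: "up V T k z \<in> V \<Longrightarrow> i \<le> k \<Longrightarrow> up V T i z \<in> V"
proof (rule ccontr)
  assume a: "up V T k z \<in> V" "i \<le> k" "up V T i z \<notin> V"
  have "up V T k z = up V T (k - i) (up V T i z)" using a(2) up_add[of V T "k - i" i z] by simp
  then have "up V T k z = up V T i z" using up_out[OF a(3), of T "k - i"] by simp
  then show False using a by simp
qed

lemma desc_sub: "desc V T x \<subseteq> V"
  by (auto simp: desc_def)

lemma desc_self: "x \<in> V \<Longrightarrow> x \<in> desc V T x"
  by (auto simp: desc_def intro: exI[of _ 0])

lemma descI: "z \<in> V \<Longrightarrow> up V T k z = x \<Longrightarrow> z \<in> desc V T x"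
  by (auto simp: desc_def)

lemma desc_trans:
  assumes "z \<in> desc V T y" "y \<in> desc V T x" shows "z \<in> desc V T x"
proof -
  obtain a b where "up V T a z = y" "up V T b y = x" "z \<in> V" using assms by (auto simp: desc_def)
  then have "up V T (b + a) z = x" by (simp add: up_add)
  then show ?thesis using \<open>z \<in> V\<close> descI[of z V T "b + a" x] by simp
qed

lemma desc_mono: "y \<in> desc V T x \<Longrightarrow> desc V T y \<subseteq> desc V T x"
  by (rule subsetI) (rule desc_trans)

lemma desc_comparable:
  assumes "z \<in> desc V T x" "z \<in> desc V T y" "x \<in> V" "y \<in> V"
  shows "x \<in> desc V T y \<or> y \<in> desc V T x"
proof -
  obtain a b where ab: "up V T a z = x" "up V T b z = y" using assms by (auto simp: desc_def)
  show ?thesis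
  proof (cases "a \<le> b")
    case True
    then have "up V T (b - a) x = y" using ab up_add[of V T "b - a" a z] by simp
    then show ?thesis using assms descI[of x V T "b - a" y] by simp
  next
    case False
    then have "up V T (a - b) y = x" using ab up_add[of V T "a - b" b z] by simp
    then show ?thesis using assms descI[of y V T "a - b" x] by simp
  qed
qed

lemma desc_step: "z \<in> V \<Longrightarrow> z \<in> desc V T (T z)"
  by (rule descI[of _ _ _ 1]) (auto simp: up_Suc adv_def)

locale wtree =
  fixes V :: "'d::finite site set" and T :: "'d site \<Rightarrow> 'd site"
  assumes fin: "finite V" and nbT: "\<And>x. x \<in> V \<Longrightarrow> T x \<in> nb x"
    and acyc: "\<And>F. F \<subseteq> V \<Longrightarrow> F \<noteq> {} \<Longrightarrow> \<exists>x\<in>F. T x \<notin> F"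
begin

abbreviation "upT \<equiv> up V T"
abbreviation "D \<equiv> desc V T"
abbreviation "s \<equiv> sz V T"

lemma finite_desc [simp]: "finite (D x)"
  using desc_sub fin finite_subset by metis

lemma up_no_cycle: "upT k z = z \<Longrightarrow> z \<in> V \<Longrightarrow> k = 0"
proof (rule ccontr)
  assume a: "upT k z = z" "z \<in> V" "k \<noteq> 0"
  let ?F = "(\<lambda>i. upT i z) ` {..<k}"
  have sub: "?F \<subseteq> V" using a up_in_le[of V T k z] by auto
  moreover have "?F \<noteq> {}" using a by auto
  ultimately obtain i where i: "i < k" "T (upT i z) \<notin> ?F" using acyc by blast
  have "T (upT i z) = upT (Suc i) z" using i sub by (auto simp: up_Suc adv_def)
  moreover have "upT (Suc i) z \<in> ?F"
  proof (cases "Suc i = k")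
    case True
    then have "upT (Suc i) z = upT 0 z" using a by simp
    then show ?thesis using a by blast
  next
    case False then show ?thesis using i by auto
  qed
  ultimately show False using i by simp
qed

lemma up_inj:
  assumes "upT i z = upT j z" "upT i z \<in> V" shows "i = j"
proof -
  have *: "i = j" if "i \<le> j" "upT i z = upT j z" "upT i z \<in> V" for i j
  proof -
    have "upT (j - i) (upT i z) = upT i z" using that up_add[of V T "j - i" i z] by simp
    then show ?thesis using up_no_cycle that by fastforce
  qed
  show ?thesis
  proof (cases "i \<le> j")
    case False then show ?thesis using *[of j i] assms by simp
  qed (use * assms in simp)
qed

lemma up_leaves: "\<exists>k. upT k z \<notin> V"
proof (rule ccontr)
  assume a: "\<not> (\<exists>k. upT k z \<notin> V)"
  let ?F = "range (\<lambda>i. upT i z)"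
  obtain i where i: "T (upT i z) \<notin> ?F" using acyc[of ?F] a by blast
  have "T (upT i z) = upT (Suc i) z" using a by (simp add: up_Suc adv_def)
  then show False using i by blast
qed

text \<open>A proper descendant of \<open>B\<close> has its parent among the descendants too.
  Conversely, from a core vertex not below \<open>B\<close> the path to the root would stay in the
  core forever, whereas every path leaves \<open>V\<close>.\<close>

lemma core_eq_desc:
  assumes "B \<subseteq> V"
  shows "blocked_core V treeb B T = (\<Union>x\<in>B. D x)"
proof
  show "(\<Union>x\<in>B. D x) \<subseteq> blocked_core V treeb B T"
  proof (rule blocked_core_greatest)
    show "(\<Union>x\<in>B. D x) \<subseteq> V" using desc_sub by fast
    fix z assume z: "z \<in> (\<Union>x\<in>B. D x) - B"
    then obtain x k where x: "x \<in> B" "z \<in> V" "upT k z = x" by (auto simp: desc_def)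
    then obtain k' where k': "k = Suc k'" using z by (cases k) auto
    have "upT k' (T z) = x" using x k' by (simp add: up_Suc' adv_def)
    moreover have "T z \<in> V" using calculation x assms up_in_le[of V T k' "T z" 0] by auto
    ultimately have "T z \<in> D x" by (intro descI[of _ _ _ k'])
    then show "treeb z (T z) (\<Union>x\<in>B. D x)" using x(1) unfolding treeb_def by blast
  qed
  show "blocked_core V treeb B T \<subseteq> (\<Union>x\<in>B. D x)"
  proof
    let ?C = "blocked_core V treeb B T"
    fix z assume z: "z \<in> ?C"
    show "z \<in> (\<Union>x\<in>B. D x)"
    proof (rule ccontr)
      assume n: "z \<notin> (\<Union>x\<in>B. D x)"
      have CV: "?C \<subseteq> V" by (rule blocked_core_sub)
      have "upT k z \<in> ?C" for k
      proof (induction k)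
        case (Suc k)
        have "upT k z \<notin> B" using n z CV descI[of z V T k] by blast
        then have "T (upT k z) \<in> ?C"
          using blocked_core_blocked[OF mono_treeb Suc] unfolding treeb_def by blast
        then show ?case using Suc CV by (auto simp: up_Suc adv_def)
      qed (use z in simp)
      then show False using up_leaves[of z] CV by blast
    qed
  qed
qed

lemma T_not_desc: "z \<in> V \<Longrightarrow> T z \<notin> D z"
proof
  assume z: "z \<in> V" "T z \<in> D z"
  then obtain k where "upT k (T z) = z" by (auto simp: desc_def)
  then have "upT (Suc k) z = z" using z by (simp add: up_Suc' adv_def)
  then show False using up_no_cycle z by blast
qed

lemma sz_pos: "x \<in> V \<Longrightarrow> 1 \<le> s x"
  using desc_self[of x V T] card_gt_0_iff[of "D x"] finite_desc by fastforce

lemma sz_mono: "y \<in> D x \<Longrightarrow> s y \<le> s x"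
  by (intro card_mono finite_desc desc_mono)

lemma sz_T: "z \<in> V \<Longrightarrow> T z \<in> V \<Longrightarrow> s z < s (T z)"
  using desc_mono[OF desc_step[of z V T]] T_not_desc[of z] desc_self[of "T z" V T]
  by (intro psubset_card_mono) auto

lemma sz_up: "upT i z \<in> V \<Longrightarrow> i + 1 \<le> s (upT i z)"
proof (induction i)
  case (Suc i)
  then have v: "upT i z \<in> V" using up_in_le[of V T "Suc i" z i] by simp
  then have e: "upT (Suc i) z = T (upT i z)" by (simp add: up_Suc adv_def)
  have "s (upT i z) < s (T (upT i z))" using sz_T[OF v] Suc.prems e by simp
  then show ?case using Suc.IH[OF v] e by simp
qed (use sz_pos in simp)

lemma sz_up_mono: "upT j z \<in> V \<Longrightarrow> i \<le> j \<Longrightarrow> s (upT i z) \<le> s (upT j z)"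
proof (rule sz_mono)
  assume a: "upT j z \<in> V" "i \<le> j"
  show "upT i z \<in> D (upT j z)"
    using up_in_le[OF a] a(2) up_add[of V T "j - i" i z] by (intro descI[of _ _ _ "j - i"]) auto
qed

lemma desc_children: "x \<in> V \<Longrightarrow> D x = insert x (\<Union>c\<in>{c \<in> V. T c = x}. D c)"
proof (intro equalityI subsetI)
  fix z assume x: "x \<in> V" and z: "z \<in> D x"
  then obtain k where k: "z \<in> V" "upT k z = x" by (auto simp: desc_def)
  show "z \<in> insert x (\<Union>c\<in>{c \<in> V. T c = x}. D c)"
  proof (cases k)
    case (Suc k')
    then have "upT k' z \<in> V" using up_in_le[of V T k z k'] k x by simp
    then have "upT k' z \<in> {c \<in> V. T c = x}" using k Suc by (auto simp: up_Suc adv_def)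
    then show ?thesis using descI[OF k(1), of T k' "upT k' z"] by blast
  qed (use k in simp)
next
  fix z assume "x \<in> V" "z \<in> insert x (\<Union>c\<in>{c \<in> V. T c = x}. D c)"
  then show "z \<in> D x" using desc_self desc_trans[OF _ desc_step] by fastforce
qed

lemma card_children: "card {c \<in> V. T c = x} \<le> deg TYPE('d)"
proof -
  have "{c \<in> V. T c = x} \<subseteq> nb x" using nbT nb_sym by auto
  then have "card {c \<in> V. T c = x} \<le> card (nb x)" by (intro card_mono) auto
  then show ?thesis by (simp add: card_nb)
qed

text \<open>The path from \<open>z\<close> enters \<open>m\<close> through a child other than
  \<open>c\<close>, which has fewer than \<open>K\<close> descendants, and sizes increase along the
  path.\<close>

lemma foot_unique:
  assumes m: "c \<in> V" "T c = m" "m \<in> V" "K \<le> s m" and small: "\<And>z. z \<in> V \<Longrightarrow> T z = m \<Longrightarrow> z \<noteq> c \<Longrightarrow> s z < K"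
    and z: "z \<in> D m - D c" "upT l z = m" and "i < l"
  shows "s (upT i z) < K"
proof -
  obtain l' where l': "l = Suc l'" using \<open>i < l\<close> by (cases l) auto
  have lv: "upT l' z \<in> V" using up_in_le[of V T l z l'] z(2) m(3) l' by simp
  have "T (upT l' z) = m" using lv z(2) l' by (simp add: up_Suc adv_def)
  moreover have "upT l' z \<noteq> c" using z descI[of z V T l' c] desc_sub by fastforce
  ultimately have "s (upT l' z) < K" using small lv by blast
  moreover have "s (upT i z) \<le> s (upT l' z)" using sz_up_mono[OF lv] \<open>i < l\<close> l' by simp
  ultimately show ?thesis by simp
qed

text \<open>For a vertex on a side branch of a spine this is its distance from the spine, computed
  from the vertex without knowing which spine it belongs to.\<close>

definition depth :: "nat \<Rightarrow> 'd site \<Rightarrow> nat" where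
  "depth K z = (LEAST k. K \<le> s (upT k z))"

lemma depth_eqI: "K \<le> s (upT k z) \<Longrightarrow> (\<And>i. i < k \<Longrightarrow> s (upT i z) < K) \<Longrightarrow> depth K z = k"
  unfolding depth_def by (rule Least_equality) (auto simp: not_less[symmetric])

lemma spine_in:
  assumes "spine V T K G H x c" "x \<in> V" "i \<le> G"
  shows "c i \<in> V" "upT i (c i) = x" "K \<le> s (c i)"
proof -
  note sp = assms(1)[unfolded spine_def]
  show v: "c i \<in> V" using sp assms by (cases i) auto
  have up: "upT i (c i) = x" if "i \<le> G" for i
    using that
  proof (induction i)
    case (Suc i)
    then have "adv V T (c (Suc i)) = c i" using sp by (simp add: adv_def)
    then show ?case using Suc by (simp add: up_Suc')
  qed (use sp in simp)
  then show "upT i (c i) = x" using assms by blast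
  have "c G \<in> D (c i)"
    using assms(3)
  proof (induction "G - i" arbitrary: i)
    case 0 then have "i = G" by simp
    then show ?case using sp assms(2) by (cases G) (auto intro: desc_self)
  next
    case (Suc n)
    then have "c G \<in> D (c (Suc i))" "i < G" by auto
    then show ?case using sp desc_step[of "c (Suc i)" V T] desc_trans by metis
  qed
  then show "K \<le> s (c i)" using sp sz_mono order_trans by blast
qed

lemma spine_desc_mono:
  assumes "spine V T K G H x c" "x \<in> V" "i \<le> j" "j \<le> G"
  shows "D (c j) \<subseteq> D (c i)"
  using assms(3,4)
proof (induction j rule: dec_induct)
  case (step j)
  have "c (Suc j) \<in> D (c j)" using assms(1) step desc_step[of "c (Suc j)" V T] unfolding spine_def by force
  then show ?case using step desc_mono by fastforce
qed simp

lemma spine_foot: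
  assumes sp: "spine V T K G H x c" and x: "x \<in> V" and j: "j < G"
    and z: "z \<in> D (c j) - D (c (Suc j))" "upT l z = c j" and "i < l"
  shows "s (upT i z) < K"
proof (rule foot_unique)
  show "c (Suc j) \<in> V" "T (c (Suc j)) = c j" using sp j unfolding spine_def by auto
  show "\<And>z. z \<in> V \<Longrightarrow> T z = c j \<Longrightarrow> z \<noteq> c (Suc j) \<Longrightarrow> s z < K" using sp j unfolding spine_def by auto
  show "c j \<in> V" "K \<le> s (c j)" using spine_in[OF sp x] j by auto
qed (use assms in auto)

text \<open>Let \<open>w\<close> be the vertex at distance \<open>j div 2 + 1\<close> below \<open>c j\<close> on the long side branch. Then \<open>c j\<close> is the first
  vertex above \<open>w\<close> with \<open>K\<close> descendants, so \<open>w\<close> determines \<open>j\<close> and hence \<open>x\<close> up to two choices.\<close>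

lemma card_long_bush:
  assumes KH: "H < K" and a: "1 \<le> a"
  shows "card {x \<in> V. \<exists>c. spine V T K G H x c \<and> long_bush V T G (2 * a) c} \<le> 2 * card (window V T a H)"
proof -
  let ?w = "window V T a H"
  have fw: "finite ?w" using fin by (simp add: window_def)
  have sub: "{x \<in> V. \<exists>c. spine V T K G H x c \<and> long_bush V T G (2 * a) c}
     \<subseteq> (\<lambda>w. upT (3 * depth K w - 2) w) ` ?w \<union> (\<lambda>w. upT (3 * depth K w - 1) w) ` ?w"
  proof
    fix x assume "x \<in> {x \<in> V. \<exists>c. spine V T K G H x c \<and> long_bush V T G (2 * a) c}"
    then obtain c j z l where x: "x \<in> V" and sp: "spine V T K G H x c" and j: "j < G"
      and z: "z \<in> D (c j) - D (c (Suc j))" "upT l z = c j" and l: "j \<le> l" "2 * a \<le> l"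
      unfolding long_bush_def by blast
    have cj: "c j \<in> V" "upT j (c j) = x" "K \<le> s (c j)" using spine_in[OF sp x, of j] j by auto
    have cS: "c (Suc j) \<in> V" "K \<le> s (c (Suc j))" using spine_in[OF sp x, of "Suc j"] j by auto
    \<comment> \<open>Half of \<open>j\<close> plus one: \<open>k\<close> is readable from
      \<open>w\<close> as its depth, and determines \<open>j\<close> up to its parity.\<close>
    define k where "k = 1 + j div 2"
    have kl: "k \<le> l" "1 \<le> k" unfolding k_def using l a by auto
    define w where "w = upT (l - k) z"
    have kw: "upT k w = c j" unfolding w_def using z(2) kl up_add[of V T k "l - k" z] by simp
    have wV: "w \<in> V" unfolding w_def using up_in_le[of V T l z "l - k"] z(2) cj by simp
    have small: "s (upT i w) < K" if "i < k" for i
    proof -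
      have "upT i w = upT (i + (l - k)) z" unfolding w_def by (simp add: up_add)
      then show ?thesis using spine_foot[OF sp x j z, of "i + (l - k)"] that kl by simp
    qed
    have dw: "depth K w = k" by (rule depth_eqI) (use kw cj small in auto)
    have zw: "z \<in> D w" using z(1) desc_sub[of V T "c j"] by (intro descI[of _ _ _ "l - k"]) (auto simp: w_def)
    have wj: "w \<in> D (c j)" using descI[OF wV kw] .
    \<comment> \<open>Disjointness from the continuation of the spine places the branch of
      \<open>w\<close> among the at most \<open>H\<close> vertices hanging off it.\<close>
    have "D w \<inter> D (c (Suc j)) = {}"
    proof (rule ccontr)
      assume "D w \<inter> D (c (Suc j)) \<noteq> {}"
      then obtain u where "u \<in> D w" "u \<in> D (c (Suc j))" by blast
      then have "w \<in> D (c (Suc j)) \<or> c (Suc j) \<in> D w" by (rule desc_comparable) (use wV cS in auto)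
      then show False
      proof
        assume "w \<in> D (c (Suc j))" then show False using desc_trans[OF zw] z(1) by blast
      next
        assume "c (Suc j) \<in> D w"
        then have "s (c (Suc j)) \<le> s w" by (rule sz_mono)
        then show False using small[of 0] kl cS(2) by simp
      qed
    qed
    moreover have "D (c G) \<subseteq> D (c (Suc j))" using spine_desc_mono[OF sp x, of "Suc j" G] j by simp
    moreover have "D (c j) \<subseteq> D x" using spine_desc_mono[OF sp x, of 0 j] j sp by (simp add: spine_def)
    ultimately have "D w \<subseteq> D x - D (c G)" using desc_mono[OF wj] by blast
    then have "s w \<le> card (D x - D (c G))" by (intro card_mono) auto
    then have "s w \<le> H" using sp unfolding spine_def by simp
    \<comment> \<open>The path from \<open>z\<close> up to \<open>w\<close> has
      \<open>l - k + 1 = l - j div 2\<close> vertices, at least \<open>l / 2\<close> since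
      \<open>j \<le> l\<close>, and \<open>l\<close> is at least \<open>2 * a\<close>.\<close>
    moreover have "a \<le> s w"
    proof -
      have "l - k + 1 \<le> s w" using sz_up[of "l - k" z] wV unfolding w_def by simp
      moreover have "a \<le> l - k + 1" unfolding k_def using l a by linarith
      ultimately show ?thesis by simp
    qed
    ultimately have ww: "w \<in> ?w" using wV by (simp add: window_def)
    have xw: "x = upT (j + k) w" using cj(2) kw by (simp add: up_add)
    have "j + k = 3 * k - 2 \<or> j + k = 3 * k - 1" 
    proof -
      obtain q where "j = 2 * q \<or> j = 2 * q + 1" by (metis oddE evenE)
      then have "j = 2 * q \<and> k = q + 1 \<or> j = 2 * q + 1 \<and> k = q + 1" unfolding k_def by auto
      then show ?thesis by auto
    qed
    then show "x \<in> (\<lambda>w. upT (3 * depth K w - 2) w) ` ?w \<union> (\<lambda>w. upT (3 * depth K w - 1) w) ` ?w"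
      using ww xw dw by (metis (no_types, lifting) UnCI image_eqI)
  qed
  have "card {x \<in> V. \<exists>c. spine V T K G H x c \<and> long_bush V T G (2 * a) c}
    \<le> card ((\<lambda>w. upT (3 * depth K w - 2) w) ` ?w \<union> (\<lambda>w. upT (3 * depth K w - 1) w) ` ?w)"
    using fw by (intro card_mono[OF _ sub]) auto
  also have "\<dots> \<le> card ?w + card ?w"
    using card_Un_le add_mono[OF card_image_le[OF fw] card_image_le[OF fw]] order_trans by blast
  finally show ?thesis by simp
qed

text \<open>Each tip has \<open>g\<close> distinct ancestors at heights \<open>g\<close> to
  \<open>2 * g - 1\<close>; their sizes lie between \<open>g\<close> and \<open>H\<close>. Each
  vertex of the window is used by at most \<open>H\<close> tips, namely its descendants.\<close>

lemma card_tips: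
  "g * card {y \<in> V. tip V T (2 * g) H y} \<le> H * card (window V T g H)"
proof (cases "g = 0")
  case False
  let ?t = "{y \<in> V. tip V T (2 * g) H y}" and ?w = "window V T g H"
  have fw: "finite ?w" and ft: "finite ?t" using fin by (auto simp: window_def)
  let ?P = "?t \<times> {g..<2 * g}" and ?f = "\<lambda>(y, i). (upT i y, y)"
  have "inj_on ?f ?P"
  proof (rule inj_onI)
    fix p q assume "p \<in> ?P" "q \<in> ?P" "?f p = ?f q"
    then obtain y i j where pq: "p = (y, i)" "q = (y, j)" and a: "tip V T (2 * g) H y" "i \<in> {g..<2 * g}" "upT i y = upT j y"
      by auto
    have "i \<le> 2 * g - 1" using a(2) by auto
    then have "upT i y \<in> V" using a(1) up_in_le[of V T "2 * g - 1" y i] by (simp add: tip_def)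
    then show "p = q" using up_inj a(3) pq by blast
  qed
  moreover have "?f ` ?P \<subseteq> (SIGMA v:?w. D v)"
  proof (rule image_subsetI, clarify)
    fix y i assume y: "y \<in> V" "tip V T (2 * g) H y" and i: "i \<in> {g..<2 * g}"
    have "i \<le> 2 * g - 1" using i by auto
    then have v: "upT i y \<in> V" using y up_in_le[of V T "2 * g - 1" y i] by (simp add: tip_def)
    have "s (upT i y) \<le> s (upT (2 * g - 1) y)" using y i by (intro sz_up_mono) (auto simp: tip_def)
    then have "upT i y \<in> ?w" using sz_up[OF v] y i v by (auto simp: tip_def window_def)
    moreover have "y \<in> D (upT i y)" by (rule descI[OF y(1) refl])
    ultimately show "upT i y \<in> ?w \<and> y \<in> D (upT i y)" ..
  qed
  ultimately have "card ?P \<le> card (SIGMA v:?w. D v)"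
    using fw by (intro card_inj_on_le) auto
  also have "\<dots> = (\<Sum>v\<in>?w. s v)" using fw by (simp add: card_SigmaI)
  also have "\<dots> \<le> (\<Sum>v\<in>?w. H)" by (intro sum_mono) (simp add: window_def)
  finally show ?thesis by (simp add: card_cartesian_product mult.commute)
qed simp

section \<open>The subforest of large vertices and the existence of spines\<close>

definition trunk :: "nat \<Rightarrow> 'd site set" where
  "trunk K = {x \<in> V. K \<le> s x}"

definition leafs :: "nat \<Rightarrow> 'd site set" where
  "leafs K = {x \<in> trunk K. {c \<in> trunk K. T c = x} = {}}"

definition branchings :: "nat \<Rightarrow> 'd site set" where
  "branchings K = {x \<in> trunk K. 2 \<le> card {c \<in> trunk K. T c = x}}"

lemma finite_trunk [simp]: "finite (trunk K)" "finite (leafs K)" "finite (branchings K)"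
  using fin by (auto simp: trunk_def leafs_def branchings_def)

text \<open>All of the at most \<open>2d\<close> children have fewer than \<open>K\<close>
  descendants.\<close>

lemma leafs_window: "1 \<le> K \<Longrightarrow> leafs K \<subseteq> window V T K (deg TYPE('d) * K + 1)"
proof
  fix x assume K: "1 \<le> K" and x: "x \<in> leafs K"
  then have xV: "x \<in> V" "K \<le> s x" by (auto simp: leafs_def trunk_def)
  have small: "s c < K" if "c \<in> V" "T c = x" for c
  proof (rule ccontr)
    assume "\<not> s c < K"
    then have "c \<in> {c \<in> trunk K. T c = x}" using that by (simp add: trunk_def)
    then show False using x unfolding leafs_def by blast
  qed
  let ?ch = "{c \<in> V. T c = x}"
  have "s x \<le> Suc (card (\<Union>c\<in>?ch. D c))"
    unfolding desc_children[OF xV(1)] by (rule card_insert_le_m1) auto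
  also have "card (\<Union>c\<in>?ch. D c) \<le> (\<Sum>c\<in>?ch. s c)" using fin by (intro card_UN_le) auto
  also have "(\<Sum>c\<in>?ch. s c) \<le> (\<Sum>c\<in>?ch. K)" using small by (intro sum_mono) (simp add: less_imp_le)
  also have "\<dots> \<le> deg TYPE('d) * K" using card_children[of x] by simp
  finally show "x \<in> window V T K (deg TYPE('d) * K + 1)" using xV by (simp add: window_def)
qed

text \<open>In a forest there are at most as many branch points as leaves: the numbers of trunk
  children add up to at most the number of trunk vertices, and each such number \<open>n\<close> is
  at least \<open>1 + [2 \<le> n] - [n = 0]\<close>.\<close>

lemma card_branchings: "card (branchings K) \<le> card (leafs K)"
proof -
  let ?n = "\<lambda>x. card {c \<in> trunk K. T c = x}"
  have "(\<Sum>x\<in>trunk K. ?n x) = card (\<Union>x\<in>trunk K. {c \<in> trunk K. T c = x})"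
    by (intro card_UN_disjoint[symmetric]) auto
  also have "\<dots> \<le> card (trunk K)" by (intro card_mono) auto
  finally have 1: "(\<Sum>x\<in>trunk K. int (?n x)) \<le> int (card (trunk K))" by (simp only: of_nat_sum[symmetric] of_nat_le_iff)
  have "(\<Sum>x\<in>trunk K. 1 + (if x \<in> branchings K then 1 else 0) - (if x \<in> leafs K then 1 else 0)) \<le> (\<Sum>x\<in>trunk K. int (?n x))"
  proof (rule sum_mono)
    fix x assume x: "x \<in> trunk K"
    have "finite {c \<in> trunk K. T c = x}" by simp
    then have "card {c \<in> trunk K. T c = x} = 0 \<longleftrightarrow> {c \<in> trunk K. T c = x} = {}" by (rule card_0_eq)
    then have l: "x \<in> leafs K \<longleftrightarrow> ?n x = 0" using x by (simp add: leafs_def)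
    have b: "x \<in> branchings K \<longleftrightarrow> 2 \<le> ?n x" using x by (simp add: branchings_def)
    have arith: "1 + (if 2 \<le> n then 1 else 0) - (if n = 0 then 1 else 0) \<le> int n" for n :: nat by simp
    show "1 + (if x \<in> branchings K then 1 else 0) - (if x \<in> leafs K then 1 else 0) \<le> int (?n x)"
      unfolding l b by (rule arith)
  qed
  moreover have "(\<Sum>x\<in>trunk K. 1 + (if x \<in> branchings K then 1 else 0) - (if x \<in> leafs K then 1 else (0::int)))
     = int (card (trunk K)) + int (card (branchings K)) - int (card (leafs K))"
  proof -
    have "trunk K \<inter> branchings K = branchings K" "trunk K \<inter> leafs K = leafs K" by (auto simp: branchings_def leafs_def)
    then show ?thesis by (simp add: sum.distrib sum_subtractf sum.If_cases)
  qed
  ultimately show ?thesis using 1 by linarith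
qed

text \<open>If no leaf or branch point of the trunk lies fewer than \<open>G\<close> steps below
  \<open>x\<close>, each vertex on the way down has exactly one trunk child.\<close>

lemma trunk_chain:
  assumes x: "x \<in> trunk K" and nx: "x \<notin> (\<Union>i<G. upT i ` (leafs K \<union> branchings K))"
  shows "\<exists>c. c 0 = x \<and> (\<forall>i<G. c (Suc i) \<in> trunk K \<and> T (c (Suc i)) = c i
    \<and> (\<forall>z\<in>V. T z = c i \<longrightarrow> z \<noteq> c (Suc i) \<longrightarrow> s z < K))"
proof -
  define c where "c = rec_nat x (\<lambda>_ y. SOME z. z \<in> trunk K \<and> T z = y)"
  have c0: "c 0 = x" and cS: "\<And>i. c (Suc i) = (SOME z. z \<in> trunk K \<and> T z = c i)" by (auto simp: c_def)
  have main: "c i \<in> trunk K \<and> upT i (c i) = x" if "i \<le> G" for i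
    using that
  proof (induction i)
    case 0 then show ?case using x c0 by simp
  next
    case (Suc i)
    then have ci: "c i \<in> trunk K" "upT i (c i) = x" by auto
    then have "c i \<notin> leafs K" using nx Suc.prems by force
    then obtain z where "z \<in> trunk K \<and> T z = c i" using ci by (auto simp: leafs_def)
    then have "c (Suc i) \<in> trunk K \<and> T (c (Suc i)) = c i" unfolding cS by (rule someI[of "\<lambda>z. z \<in> trunk K \<and> T z = c i"])
    then show ?case using ci by (simp add: up_Suc' adv_def trunk_def)
  qed
  have step: "c (Suc i) \<in> trunk K \<and> T (c (Suc i)) = c i
    \<and> (\<forall>z\<in>V. T z = c i \<longrightarrow> z \<noteq> c (Suc i) \<longrightarrow> s z < K)" if i: "i < G" for i
  proof -
    have ci: "c i \<in> trunk K" "upT i (c i) = x" using main i by auto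
    then have nl: "c i \<notin> leafs K" "c i \<notin> branchings K" using nx i by force+
    then obtain z where "z \<in> trunk K \<and> T z = c i" using ci by (auto simp: leafs_def)
    then have 1: "c (Suc i) \<in> trunk K \<and> T (c (Suc i)) = c i" unfolding cS by (rule someI[of "\<lambda>z. z \<in> trunk K \<and> T z = c i"])
    have "s z < K" if z: "z \<in> V" "T z = c i" "z \<noteq> c (Suc i)" for z
    proof (rule ccontr)
      assume "\<not> s z < K"
      then have "{z, c (Suc i)} \<subseteq> {y \<in> trunk K. T y = c i}" using z 1 by (auto simp: trunk_def)
      then have "card {z, c (Suc i)} \<le> card {y \<in> trunk K. T y = c i}" by (intro card_mono) auto
      then show False using z nl ci by (simp add: branchings_def)
    qed
    then show ?thesis using 1 by blast
  qed
  then show ?thesis using c0 by blast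
qed

text \<open>Either \<open>x\<close> is close above a leaf or branch point of the trunk, which the
  window bounds, or the side branches of its chain hold at least \<open>C * G\<close> vertices. A
  vertex lies on the side branches of at most \<open>G\<close> such chains, so the latter case
  occurs at most \<open>card V\<close> divided by \<open>C\<close> times.\<close>

lemma card_no_spine:
  assumes K: "1 \<le> K" and C: "1 \<le> C" "1 \<le> G"
  shows "C * card {x \<in> trunk K. \<nexists>c. spine V T K G (C * G) x c}
    \<le> C * (2 * G * card (window V T K (deg TYPE('d) * K + 1))) + card V"
proof -
  let ?X = "{x \<in> trunk K. \<nexists>c. spine V T K G (C * G) x c}" and ?B = "\<Union>i<G. upT i ` (leafs K \<union> branchings K)"
  let ?w = "window V T K (deg TYPE('d) * K + 1)"
  have "card ?B \<le> (\<Sum>i<G. card (upT i ` (leafs K \<union> branchings K)))" by (intro card_UN_le) auto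
  also have "\<dots> \<le> (\<Sum>i<G. 2 * card ?w)"
  proof (rule sum_mono)
    fix i
    have "card (upT i ` (leafs K \<union> branchings K)) \<le> card (leafs K) + card (branchings K)"
      using card_image_le[of "leafs K \<union> branchings K" "upT i"] card_Un_le[of "leafs K" "branchings K"] by simp
    moreover have "card (leafs K) \<le> card ?w" using leafs_window[OF K] fin by (intro card_mono) (auto simp: window_def)
    ultimately show "card (upT i ` (leafs K \<union> branchings K)) \<le> 2 * card ?w" using card_branchings[of K] by simp
  qed
  finally have B: "card ?B \<le> 2 * G * card ?w" by simp
  define ch where "ch x c \<longleftrightarrow> c 0 = x \<and> (\<forall>i<G. c (Suc i) \<in> trunk K \<and> T (c (Suc i)) = c i
    \<and> (\<forall>z\<in>V. T z = c i \<longrightarrow> z \<noteq> c (Suc i) \<longrightarrow> s z < K))" for x c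
  define cc where "cc x = (SOME c. ch x c)" for x
  have cc: "ch x (cc x)" if "x \<in> ?X - ?B" for x
  proof -
    have "\<exists>c. ch x c" using trunk_chain[of x K G] that unfolding ch_def by blast
    then show ?thesis unfolding cc_def by (rule someI_ex)
  qed
  let ?S = "\<lambda>x. D x - D (cc x G)"
  have ch_sp: "spine V T K G (card (?S x)) x (cc x)" if x: "x \<in> ?X - ?B" for x
  proof -
    have "K \<le> s (cc x G)" using cc[OF x] x C unfolding ch_def by (cases G) (auto simp: trunk_def)
    then show ?thesis using cc[OF x] unfolding ch_def spine_def by (auto simp: trunk_def)
  qed
  have big: "C * G \<le> card (?S x)" if x: "x \<in> ?X - ?B" for x
  proof (rule ccontr)
    assume "\<not> C * G \<le> card (?S x)"
    then have "spine V T K G (C * G) x (cc x)" using ch_sp[OF x] unfolding spine_def by auto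
    then show False using x by blast
  qed
  have fX: "finite (?X - ?B)" by simp
  \<comment> \<open>A hanging vertex \<open>z\<close> knows its distance from the chain through
    \<open>depth\<close>; only the number of further steps to \<open>x\<close>, less than
    \<open>G\<close>, is left open.\<close>
  have key: "\<exists>i<G. upT (i + depth K z) z = x" if x: "x \<in> ?X - ?B" and z: "z \<in> ?S x" for x z
  proof -
    note sp = ch_sp[OF x]
    have xV: "x \<in> V" using x by (auto simp: trunk_def)
    have "\<exists>i<G. z \<in> D (cc x i) - D (cc x (Suc i))"
    proof (rule ccontr)
      assume a: "\<not> ?thesis"
      have "z \<in> D (cc x i)" if "i \<le> G" for i
        using that
      proof (induction i)
        case 0 then show ?case using z sp by (simp add: spine_def)
      qed (use a in auto)
      then show False using z by blast
    qed
    then obtain i where i: "i < G" and zi: "z \<in> D (cc x i) - D (cc x (Suc i))" by blast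
    then obtain l where l: "upT l z = cc x i" by (auto simp: desc_def)
    have "depth K z = l"
      by (rule depth_eqI) (use l spine_in[OF sp xV, of i] i spine_foot[OF sp xV i zi l] in auto)
    then show ?thesis using spine_in(2)[OF sp xV, of i] i l by (auto simp: up_add)
  qed
  have "C * G * card (?X - ?B) \<le> (\<Sum>x\<in>?X - ?B. card (?S x))"
    using big sum_bounded_below[of "?X - ?B" "C * G" "\<lambda>x. card (?S x)"] by (simp add: mult.commute)
  also have "\<dots> = card (SIGMA x:?X - ?B. ?S x)" using fX by (simp add: card_SigmaI)
  also have "\<dots> \<le> card ((\<lambda>(z, i). (upT (i + depth K z) z, z)) ` (V \<times> {..<G}))"
  proof (rule card_mono)
    show "(SIGMA x:?X - ?B. ?S x) \<subseteq> (\<lambda>(z, i). (upT (i + depth K z) z, z)) ` (V \<times> {..<G})"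
    proof
      fix p assume "p \<in> (SIGMA x:?X - ?B. ?S x)"
      then obtain x z where p: "p = (x, z)" and x: "x \<in> ?X - ?B" and z: "z \<in> ?S x" by blast
      obtain i where "i < G" "upT (i + depth K z) z = x" using key[OF x z] by blast
      moreover have "z \<in> V" using z desc_sub[of V T x] by auto
      ultimately show "p \<in> (\<lambda>(z, i). (upT (i + depth K z) z, z)) ` (V \<times> {..<G})"
        unfolding p by (intro image_eqI[of _ _ "(z, i)"]) auto
    qed
  qed (use fin in auto)
  also have "\<dots> \<le> card (V \<times> {..<G})" using fin by (intro card_image_le) auto
  finally have "C * G * card (?X - ?B) \<le> card V * G" by (simp add: card_cartesian_product)
  then have 2: "C * card (?X - ?B) \<le> card V" using C by (simp add: mult.commute mult.left_commute)
  have "card ?X \<le> card (?B \<union> (?X - ?B))" by (intro card_mono) auto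
  also have "\<dots> \<le> card ?B + card (?X - ?B)" by (rule card_Un_le)
  finally have "C * card ?X \<le> C * (card ?B + card (?X - ?B))" by (intro mult_le_mono2)
  also have "\<dots> = C * card ?B + C * card (?X - ?B)" by (rule add_mult_distrib2)
  also have "\<dots> \<le> C * (2 * G * card ?w) + card V" using B 2 by (intro add_mono mult_le_mono2)
  finally show ?thesis .
qed

end

subsection \<open>Two rootings of the same subtree\<close>

text \<open>The branch of \<open>T\<close> below \<open>x\<close> and that of \<open>T'\<close> below \<open>y\<close> are the same undirected tree.\<close>

locale wpair = A: wtree V T + B: wtree V T'
  for V :: "'d::finite site set" and T T' +
  fixes x y :: "'d site" and l :: nat
  assumes xV: "x \<in> V" and yV: "y \<in> V" and same_W: "desc V T x = desc V T' y"
    and same_E: "(\<lambda>z. {z, T z}) ` (desc V T x - {x}) = (\<lambda>z. {z, T' z}) ` (desc V T' y - {y})"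
    and l: "up V T l y = x"
begin

abbreviation "W \<equiv> desc V T x"
abbreviation "p i \<equiv> up V T i y"

definition P where "P = p ` {..l}"

lemma p_V: "i \<le> l \<Longrightarrow> p i \<in> V"
  using up_in_le[of V T l y i] l xV by simp

lemma p_W: "i \<le> l \<Longrightarrow> p i \<in> W"
  using p_V l up_add[of V T "l - i" i y] by (intro descI[of _ _ _ "l - i"]) auto

lemma p_inj: "i \<le> l \<Longrightarrow> j \<le> l \<Longrightarrow> p i = p j \<Longrightarrow> i = j"
  using A.up_inj p_V by blast

lemma p_T: "i < l \<Longrightarrow> T (p i) = p (Suc i)"
  using p_V[of i] by (simp add: up_Suc adv_def)

lemma p_ne_x: "i < l \<Longrightarrow> p i \<noteq> x"
  using p_inj[of i l] l by auto

lemma W_V: "W \<subseteq> V"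
  by (rule desc_sub)

lemma W_T: "z \<in> W \<Longrightarrow> z \<noteq> x \<Longrightarrow> T z \<in> W"
proof -
  assume z: "z \<in> W" "z \<noteq> x"
  then obtain k where k: "up V T k z = x" "z \<in> V" by (auto simp: desc_def)
  then obtain k' where k': "k = Suc k'" using z by (cases k) auto
  have u: "up V T k' (T z) = x" using k k' by (simp add: up_Suc' adv_def)
  moreover have "T z \<in> V" using u xV up_in_le[of V T k' "T z" 0] by simp
  ultimately show "T z \<in> W" by (intro descI)
qed

lemma E_cases:
  assumes "z \<in> W" "z \<noteq> x"
  obtains "T' z = T z" "z \<noteq> y" | "T' (T z) = z" "T z \<noteq> y" "T z \<in> W"
proof -
  have "{z, T z} \<in> (\<lambda>z. {z, T' z}) ` (desc V T' y - {y})" using assms same_E by blast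
  then obtain u where u: "u \<in> W - {y}" "{z, T z} = {u, T' u}" using same_W by auto
  then consider "u = z" "T' u = T z" | "u = T z" "T' u = z" by (auto simp: doubleton_eq_iff)
  then show ?thesis using that u by cases auto
qed

text \<open>Induction from \<open>y\<close>: its edge to \<open>p 1\<close> also occurs in the other
  rooting, where \<open>y\<close> is the top, so it is traversed backwards. At each next vertex the
  parent in \<open>T'\<close> is already the previous one, so the following edge must be reversed as
  well.\<close>

lemma rev_path: "i < l \<Longrightarrow> T' (p (Suc i)) = p i"
proof (induction i)
  case 0
  have "p 0 \<noteq> x" using p_ne_x 0 by blast
  then show ?case using E_cases[OF p_W[of 0]] 0 p_T[of 0] by auto
next
  case (Suc i)
  have "p (Suc i) \<noteq> x" using p_ne_x Suc by blast
  then have "T' (p (Suc i)) = T (p (Suc i)) \<or> T' (T (p (Suc i))) = p (Suc i)"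
    using E_cases[OF p_W[of "Suc i"]] Suc.prems by (meson less_imp_le)
  moreover have "p i \<noteq> p (Suc (Suc i))" using p_inj[of i "Suc (Suc i)"] Suc.prems by auto
  ultimately show ?case using Suc p_T[of "Suc i"] by auto
qed

lemma x_P: "x \<in> P"
  unfolding P_def using l by blast

text \<open>Suppose the edge from \<open>z\<close> were reversed, so \<open>T'\<close> maps
  \<open>T z\<close> to \<open>z\<close>. If \<open>T z\<close> is on the path, its
  \<open>T'\<close>-parent is on the path too; otherwise \<open>T'\<close> and \<open>T\<close>
  agree at \<open>T z\<close> by induction and \<open>T\<close> would have a 2-cycle. Both are
  impossible.\<close>

lemma off_path:
  assumes "z \<in> W" "z \<notin> P" shows "T' z = T z"
proof -
  obtain k where "up V T k z = x" using assms by (auto simp: desc_def)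
  then have "up V T k z \<in> P" using x_P by simp
  then show ?thesis using assms
  proof (induction k arbitrary: z)
    case (Suc k)
    have zV: "z \<in> V" using Suc.prems W_V by blast
    have "z \<noteq> x" using Suc.prems x_P by blast
    with \<open>z \<in> W\<close> show ?case
    proof (cases rule: E_cases)
      case 2
      have False
      proof (cases "T z \<in> P")
        case True
        then obtain i where i: "i \<le> l" "T z = p i" unfolding P_def by auto
        then obtain i' where "i = Suc i'" using 2 by (cases i) auto
        then have "T' (T z) = p i'" "i' \<le> l" using rev_path i by auto
        then show False using 2(1) Suc.prems unfolding P_def by auto
      next
        case False
        have "up V T k (T z) \<in> P" using Suc.prems zV by (simp add: up_Suc' adv_def)
        then have "T' (T z) = T (T z)" using Suc.IH 2 False by blast
        then have "up V T 2 z = z" using 2 zV W_V by (auto simp: numeral_2_eq_2 up_Suc adv_def)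
        then show False using A.up_no_cycle[of 2 z] zV by simp
      qed
      then show ?thesis ..
    qed auto
  qed simp
qed

lemma up_to_P:
  assumes "up V T k z = u" "u \<in> W" "z \<in> W" "\<And>i. i < k \<Longrightarrow> up V T i z \<notin> P"
  shows "up V T' k z = u"
  using assms
proof (induction k arbitrary: z)
  case (Suc k)
  have z: "z \<in> V" "z \<notin> P" using Suc.prems W_V Suc.prems(4)[of 0] by auto
  then have "z \<noteq> x" using x_P by blast
  then have "T z \<in> W" using W_T Suc.prems by blast
  moreover have "up V T k (T z) = u" using Suc.prems z by (simp add: up_Suc' adv_def)
  moreover have "up V T i (T z) \<notin> P" if "i < k" for i
    using Suc.prems(4)[of "Suc i"] that z by (simp add: up_Suc' adv_def)
  ultimately have "up V T' k (T z) = u" using Suc.IH Suc.prems(2) by blast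
  then show ?case using off_path[of z] z Suc.prems by (simp add: up_Suc' adv_def)
qed simp

lemma beyond_x: "n \<ge> 1 \<Longrightarrow> up V T n x \<notin> W"
proof
  assume n: "n \<ge> 1" "up V T n x \<in> W"
  then obtain k where "up V T k (up V T n x) = x" by (auto simp: desc_def)
  then have "up V T (k + n) x = x" by (simp add: up_add)
  then show False using A.up_no_cycle[of "k + n" x] xV n by simp
qed

lemma rev_up: "i \<le> l \<Longrightarrow> up V T' i x = p (l - i)"
proof (induction i)
  case (Suc i)
  then have "up V T' i x = p (l - i)" "p (l - i) \<in> V" using p_V by auto
  moreover have "l - i = Suc (l - Suc i)" using Suc by simp
  ultimately show ?case using rev_path[of "l - Suc i"] Suc by (simp add: up_Suc adv_def)
qed (use l in simp)

lemma wpair_sym: "wpair V T' T y x l"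
  using A.wtree_axioms B.wtree_axioms xV yV same_W same_E rev_up[of l]
  by (simp add: wpair_def wpair_axioms_def)

lemma P_sym: "wpair.P V T' x l = P"
proof -
  have "(\<lambda>i. up V T' i x) ` {..l} = p ` {..l}"
  proof (intro equalityI image_subsetI)
    fix i assume "i \<in> {..l}" then show "up V T' i x \<in> p ` {..l}" using rev_up by auto
  next
    fix i assume "i \<in> {..l}"
    then have "p i = up V T' (l - i) x" using rev_up[of "l - i"] by simp
    then show "p i \<in> (\<lambda>i. up V T' i x) ` {..l}" by simp
  qed
  then show ?thesis unfolding P_def wpair.P_def[OF wpair_sym] .
qed

text \<open>A path to \<open>u\<close> off \<open>P\<close> avoids \<open>P\<close>: once on
  \<open>P\<close> it would follow it to \<open>x\<close> and then leave the branch. Up to the first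
  hit of \<open>P\<close> both rootings agree.\<close>

lemma desc_off_sub:
  assumes u: "u \<in> W" "u \<notin> P" shows "desc V T u \<subseteq> desc V T' u"
proof
  fix z assume z: "z \<in> desc V T u"
  then obtain k where k: "up V T k z = u" "z \<in> V" by (auto simp: desc_def)
  have zW: "z \<in> W" using desc_trans z u(1) by metis
  have "up V T i z \<notin> P" if "i < k" for i
  proof
    assume "up V T i z \<in> P"
    then obtain j where j: "j \<le> l" "up V T i z = p j" unfolding P_def by auto
    have e: "u = up V T (k - i + j) y"
      using k j that up_add[of V T "k - i" i z] up_add[of V T "k - i" j y] by simp
    show False
    proof (cases "k - i + j \<le> l")
      case True then show False using e u unfolding P_def by auto
    next
      case False
      then have "u = up V T (k - i + j - l) x" using e l up_add[of V T "k - i + j - l" l y] by simp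
      then show False using beyond_x[of "k - i + j - l"] False u by simp
    qed
  qed
  then have "up V T' k z = u" using up_to_P k u zW by blast
  then show "z \<in> desc V T' u" by (rule descI[OF k(2)])
qed

lemma desc_p_idx:
  assumes "z \<in> W" "i \<le> l" "up V T k z = p i" "\<And>n. n < k \<Longrightarrow> up V T n z \<notin> P" "m \<le> l"
  shows "z \<in> desc V T (p m) \<longleftrightarrow> i \<le> m"
proof
  assume "i \<le> m"
  then have "up V T (m - i + k) z = p m"
    using assms(3) up_add[of V T "m - i" k z] up_add[of V T "m - i" i y] by simp
  then show "z \<in> desc V T (p m)" using assms(1) W_V by (intro descI) auto
next
  assume "z \<in> desc V T (p m)"
  then obtain n where n: "up V T n z = p m" by (auto simp: desc_def)
  then have "up V T n z \<in> P" using assms(5) unfolding P_def by auto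
  then have "k \<le> n" using assms(4) by (meson not_less)
  then have e: "up V T (n - k + i) y = p m"
    using n assms(3) up_add[of V T "n - k" k z] up_add[of V T "n - k" i y] by simp
  show "i \<le> m"
  proof (cases "n - k + i \<le> l")
    case True
    then have "n - k + i = m" using p_inj[of "n - k + i" m] e assms(5) by simp
    then show ?thesis by simp
  next
    case False
    then have "up V T (n - k + i - l) x = p m" using e l up_add[of V T "n - k + i - l" l y] by simp
    moreover have "1 \<le> n - k + i - l" using False by linarith
    ultimately show ?thesis using beyond_x p_W[OF assms(5)] by metis
  qed
qed

end

context wpair
begin

interpretation R: wpair V T' T y x l
  by (rule wpair_sym)

lemma desc_off: "u \<in> W \<Longrightarrow> u \<notin> P \<Longrightarrow> desc V T u = desc V T' u"
  using desc_off_sub[of u] R.desc_off_sub[of u] same_W P_sym by blast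

lemma foot_idx:
  assumes zW: "z \<in> W"
  obtains k i where "i \<le> l" "up V T k z = p i" "\<And>n. n < k \<Longrightarrow> up V T n z \<notin> P"
    "up V T' k z = p i" "\<And>n. n < k \<Longrightarrow> up V T' n z \<notin> P"
proof -
  obtain k where "up V T k z = x" using assms by (auto simp: desc_def)
  then have ex: "\<exists>k. up V T k z \<in> P" using x_P by metis
  define k where "k = (LEAST k. up V T k z \<in> P)"
  have k: "up V T k z \<in> P" "\<And>i. i < k \<Longrightarrow> up V T i z \<notin> P"
    using LeastI_ex[OF ex] not_less_Least unfolding k_def by auto
  then obtain i where i: "i \<le> l" "up V T k z = p i" unfolding P_def by auto
  have inW: "up V T n z \<in> W" if "n \<le> k" for n
  proof -
    have "up V T (l - i + k) z = x" using i l up_add[of V T "l - i" k z] up_add[of V T "l - i" i y] by simp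
    then have "up V T (l - i + k - n) (up V T n z) = x" using up_add[of V T "l - i + k - n" n z] that by simp
    moreover have "up V T n z \<in> V" using up_in_le[of V T k z n] that i p_V by simp
    ultimately show ?thesis by (intro descI)
  qed
  have same: "up V T' n z = up V T n z" if "n \<le> k" for n
    using up_to_P[of n z "up V T n z"] inW[OF that] zW k(2) that by simp
  show ?thesis
  proof (rule that[of i k])
    show "up V T' k z = p i" using same[of k] i by simp
    show "\<And>n. n < k \<Longrightarrow> up V T' n z \<notin> P" using same k(2) by simp
  qed (use i k in auto)
qed

text \<open>Cutting the edge between \<open>p m\<close> and \<open>p (Suc m)\<close> splits the
  branch in two; each rooting sees one half as the descendants of its endpoint.\<close>

lemma desc_p:
  assumes "m < l" shows "desc V T (p m) = W - desc V T' (p (Suc m))"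
proof -
  have "z \<in> desc V T (p m) \<longleftrightarrow> z \<notin> desc V T' (p (Suc m))" if z: "z \<in> W" for z
  proof -
    obtain k i where ki: "i \<le> l" "up V T k z = p i" "\<And>n. n < k \<Longrightarrow> up V T n z \<notin> P"
      "up V T' k z = p i" "\<And>n. n < k \<Longrightarrow> up V T' n z \<notin> P" by (rule foot_idx[OF z]) blast
    have 1: "z \<in> desc V T (p m) \<longleftrightarrow> i \<le> m" using desc_p_idx[OF z ki(1-3)] assms by simp
    have "z \<in> desc V T' (up V T' (l - Suc m) x) \<longleftrightarrow> l - i \<le> l - Suc m"
      using z same_W ki rev_up[of "l - i"] P_sym by (intro R.desc_p_idx[of z "l - i" k]) auto
    then have "z \<in> desc V T' (p (Suc m)) \<longleftrightarrow> l - i \<le> l - Suc m" using rev_up[of "l - Suc m"] assms by simp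
    then show ?thesis using 1 assms ki(1) by auto
  qed
  moreover have "desc V T (p m) \<subseteq> W" using desc_mono p_W assms by (metis less_imp_le)
  ultimately show ?thesis by auto
qed

lemma spine_sizes:
  assumes sp: "spine V T K G H x cx" and i: "i < G" and c: "c \<in> V" "T c = cx i" "K \<le> sz V T c"
  shows "cx (Suc i) = c"
proof (rule ccontr)
  assume "cx (Suc i) \<noteq> c"
  then have "sz V T c < K" using sp i c(1,2) unfolding spine_def by blast
  then show False using c(3) by simp
qed

text \<open>If \<open>x\<close> is in the part of the branch cut off near \<open>y\<close> by the spine, then one of the two
  spines passes a long side branch.\<close>

lemma spines_dichotomy:
  assumes spx: "spine V T K G H x cx" and spy: "spine V T' K G H y cy"
    and nbx: "\<not> long_bush V T G r cx" and nby: "\<not> long_bush V T' G r cy"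
    and far: "2 * r \<le> l" and G: "1 \<le> G"
  shows "tip V T G H y"
proof (cases "x \<in> desc V T' (cy G)")
  \<comment> \<open>The spine from \<open>y\<close> runs along the path towards \<open>x\<close>.
    What it leaves behind, at most \<open>H\<close> vertices, is exactly the set of descendants of
    \<open>p (G - 1)\<close> in \<open>T\<close>.\<close>
  case True
  have cyp: "cy i = p i \<and> i \<le> l" if "i \<le> G" for i
  proof -
    have "desc V T' (cy G) \<subseteq> desc V T' (cy i)" using B.spine_desc_mono[OF spy yV] that by blast
    then obtain k where k: "up V T' k x = cy i" using True by (auto simp: desc_def)
    then have "up V T' (i + k) x = y" using B.spine_in[OF spy yV that] up_add[of V T' i k x] by simp
    moreover have "up V T' l x = y" using rev_up[of l] by simp
    ultimately have "i + k = l" using B.up_inj[of "i + k" x l] yV by simp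
    then show ?thesis using rev_up[of k] k by auto
  qed
  have Gl: "G - 1 < l" using cyp[of G] G by linarith
  have "desc V T (p (G - 1)) = W - desc V T' (cy G)" using desc_p[OF Gl] cyp[of G] G by simp
  then have "sz V T (p (G - 1)) \<le> H" using spy same_W by (simp add: spine_def)
  moreover have "p (G - 1) \<in> V" using p_V Gl by simp
  ultimately show ?thesis unfolding tip_def by simp
next
  case False
  have "\<exists>a<G. x \<in> desc V T' (cy a) - desc V T' (cy (Suc a))"
  proof (rule ccontr)
    assume a: "\<not> ?thesis"
    have "x \<in> desc V T' (cy i)" if "i \<le> G" for i
      using that
    proof (induction i)
      case 0 then show ?case using spy same_W desc_self[OF xV, of T] by (simp add: spine_def)
    qed (use a in auto)
    then show False using False by blast
  qed
  then obtain a where a: "a < G" "x \<in> desc V T' (cy a) - desc V T' (cy (Suc a))" by blast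
  then obtain k where k: "up V T' k x = cy a" by (auto simp: desc_def)
  then have "up V T' (a + k) x = y" using B.spine_in[OF spy yV, of a] a up_add[of V T' a k x] by simp
  moreover have "up V T' l x = y" using rev_up[of l] by simp
  ultimately have akl: "a + k = l" using B.up_inj[of "a + k" x l] yV by simp
  have cya: "cy a = p a" using rev_up[of k] k akl by auto
  \<comment> \<open>The point \<open>x\<close> hangs off the spine of \<open>y\<close> at depth
    \<open>k\<close>. Since \<open>a + k = l\<close> is at least \<open>2 * r\<close>, the case
    \<open>a \<le> k\<close> would give \<open>r \<le> k\<close> and a long bush there.\<close>
  have "\<not> (a \<le> k \<and> r \<le> k)" using nby a k unfolding long_bush_def by blast
  then have ka: "k < a" "r \<le> a" using far akl by auto
  define u where "u = cy (Suc a)"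
  have u: "u \<in> V" "T' u = p a" "K \<le> sz V T' u"
    using B.spine_in[OF spy yV, of "Suc a"] a spy cya unfolding u_def spine_def by auto
  have uW: "u \<in> W"
  proof -
    have "up V T' (Suc a) u = y" using B.spine_in[OF spy yV, of "Suc a"] a unfolding u_def by simp
    then show ?thesis using same_W u(1) descI by metis
  qed
  have uP: "u \<notin> P"
  proof
    assume "u \<in> P"
    then obtain m where m: "m \<le> l" "u = p m" unfolding P_def by auto
    show False
    proof (cases m)
      case 0
      then have "T' u \<notin> desc V T' u" using m yV by (intro B.T_not_desc) auto
      moreover have "p a \<in> desc V T' y" using p_W[of a] akl same_W by simp
      ultimately show False using u m 0 by simp
    next
      case (Suc m')
      then have "p m' = p a" using rev_path[of m'] m u by simp
      then have "m' = a" using p_inj[of m' a] m Suc akl by simp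
      then have "x \<in> desc V T' u"
        using m Suc rev_up[of "l - Suc a"] xV by (intro descI[of _ _ _ "l - Suc a"]) auto
      then show False using a unfolding u_def by simp
    qed
  qed
  have Tu: "T u = p a" using off_path[OF uW uP] u by simp
  have Du: "desc V T u = desc V T' u" by (rule desc_off[OF uW uP])
  \<comment> \<open>The remainder of the spine from \<open>y\<close> beyond \<open>u\<close> is
    still large in \<open>T\<close> and lies below every \<open>p m\<close> with
    \<open>a \<le> m\<close>. So the spine from \<open>x\<close> is forced to follow the path to
    \<open>p a\<close> and then to turn into \<open>u\<close>.\<close>
  have big: "K \<le> sz V T (p m)" if "a \<le> m" "m \<le> l" for m
  proof -
    have "u \<in> desc V T (p a)" using desc_step[OF u(1), of T] Tu by simp
    moreover have "p a \<in> desc V T (p m)"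
      using that p_V[of a] up_add[of V T "m - a" a y] by (intro descI[of _ _ _ "m - a"]) auto
    ultimately have "u \<in> desc V T (p m)" by (rule desc_trans)
    then have "sz V T u \<le> sz V T (p m)" by (rule A.sz_mono)
    then show ?thesis using u(3) Du by simp
  qed
  have cxp: "cx i = p (l - i)" if "i \<le> k" for i
    using that
  proof (induction i)
    case 0 then show ?case using spx l by (simp add: spine_def)
  next
    case (Suc i)
    have e: "l - i = Suc (l - Suc i)" using Suc akl by simp
    show ?case
    proof (rule spine_sizes[OF spx])
      show "i < G" using Suc ka a by simp
      show "p (l - Suc i) \<in> V" using p_V by simp
      show "T (p (l - Suc i)) = cx i" using p_T[of "l - Suc i"] Suc e akl by simp
      show "K \<le> sz V T (p (l - Suc i))" using Suc akl by (intro big) auto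
    qed
  qed
  have lk: "l - k = a" using akl by simp
  have cxu: "cx (Suc k) = u"
    by (rule spine_sizes[OF spx]) (use ka a u(1,3) Tu cxp[of k] lk Du in auto)
  \<comment> \<open>Now the roles are exchanged: \<open>y\<close> hangs off the spine of
    \<open>x\<close> after \<open>k\<close> steps, at depth \<open>a\<close>, which is larger than
    \<open>k\<close> and at least \<open>r\<close>.\<close>
  have "y \<in> desc V T (cx k) - desc V T (cx (Suc k))"
  proof
    show "y \<in> desc V T (cx k)" using cxp[of k] lk yV by (intro descI[of _ _ _ a]) auto
    show "y \<notin> desc V T (cx (Suc k))"
    proof
      assume "y \<in> desc V T (cx (Suc k))"
      then obtain n where n: "p n = u" unfolding cxu by (auto simp: desc_def)
      show False
      proof (cases "n \<le> l")
        case True then show False using n uP unfolding P_def by auto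
      next
        case False
        then have "up V T (n - l) x = u" using n l up_add[of V T "n - l" l y] by simp
        moreover have "1 \<le> n - l" using False by linarith
        ultimately show False using beyond_x uW by metis
      qed
    qed
  qed
  moreover have "up V T a y = cx k" using cxp[of k] lk by simp
  moreover have "k < G" using ka a by simp
  ultimately have "long_bush V T G r cx" unfolding long_bush_def using ka by (meson less_imp_le)
  then show ?thesis using nbx by simp
qed

end

subsection \<open>Moving the root of a branch\<close>

lemma wtree_TR: "wtree V T \<Longrightarrow> T \<in> extensional V \<Longrightarrow> T \<in> TR V"
  unfolding Rec_def wtree_def by (auto simp: PiE_def treeb_def)

lemma TR_wtree: "finite V \<Longrightarrow> T \<in> TR V \<Longrightarrow> wtree V T"
  unfolding Rec_def wtree_def by (auto simp: PiE_def Pi_def treeb_def)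

definition branch_edges :: "'a set \<Rightarrow> ('a \<Rightarrow> 'a) \<Rightarrow> 'a \<Rightarrow> 'a set set" where
  "branch_edges V T x = (\<lambda>z. {z, T z}) ` (desc V T x - {x})"

context wtree
begin

lemma beyond_desc: "x \<in> V \<Longrightarrow> n \<ge> 1 \<Longrightarrow> upT n x \<notin> D x"
proof
  assume x: "x \<in> V" and n: "n \<ge> 1" "upT n x \<in> D x"
  then obtain k where "upT k (upT n x) = x" by (auto simp: desc_def)
  then have "upT (k + n) x = x" by (simp add: up_add)
  then show False using up_no_cycle[of "k + n" x] x n by simp
qed

lemma desc_closed_back: "z \<in> V \<Longrightarrow> T z \<in> D x \<Longrightarrow> z \<in> D x"
  using desc_trans desc_step by metis

lemma desc_T: "z \<in> D x \<Longrightarrow> z \<noteq> x \<Longrightarrow> x \<in> V \<Longrightarrow> T z \<in> D x"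
proof -
  assume z: "z \<in> D x" "z \<noteq> x" and x: "x \<in> V"
  then obtain k where k: "upT k z = x" "z \<in> V" by (auto simp: desc_def)
  then obtain k' where k': "k = Suc k'" using z by (cases k) auto
  have u: "upT k' (T z) = x" using k k' by (simp add: up_Suc' adv_def)
  moreover have "T z \<in> V" using u x up_in_le[of V T k' "T z" 0] by simp
  ultimately show "T z \<in> D x" by (intro descI)
qed

text \<open>Reverse the path from \<open>y\<close> to \<open>x\<close> and let \<open>y\<close>
  leave the branch through \<open>w\<close>. Vertex set, undirected edges and everything outside
  stay the same, so this produces further members of the class of \<open>(T, x)\<close>.\<close>

lemma reroot:
  assumes xV: "x \<in> V" and y: "y \<in> D x" and w: "w \<in> nb y" "w \<notin> D x" and ext: "T \<in> extensional V"
  shows "\<exists>T'\<in>TR V. T' y = w \<and> restrict T' (V - D x) = restrict T (V - D x) \<and> desc V T' y = D x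
    \<and> branch_edges V T' y = branch_edges V T x"
proof -
  obtain l where l: "upT l y = x" "y \<in> V" using y by (auto simp: desc_def)
  let ?p = "\<lambda>i. upT i y"
  have pV: "?p i \<in> V" if "i \<le> l" for i using up_in_le[of V T l y i] l xV that by simp
  have pD: "?p i \<in> D x" if "i \<le> l" for i
    using pV[OF that] l up_add[of V T "l - i" i y] that by (intro descI[of _ _ _ "l - i"]) auto
  have pinj: "i = j" if "?p i = ?p j" "i \<le> l" for i j using up_inj that pV by blast
  \<comment> \<open>The index is unique because a path to the root does not repeat vertices.\<close>
  define T' where "T' z = (if z = y then w else if \<exists>i<l. z = ?p (Suc i) then ?p (THE i. i < l \<and> z = ?p (Suc i)) else T z)" for z
  have T'y: "T' y = w" by (simp add: T'_def)
  have T'p: "T' (?p (Suc i)) = ?p i" if "i < l" for i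
  proof -
    have "?p (Suc i) \<noteq> y" using pinj[of "Suc i" 0] that by auto
    moreover have "(THE j. j < l \<and> ?p (Suc i) = ?p (Suc j)) = i"
      using that pinj[of "Suc i"] by (intro the_equality) auto
    ultimately show ?thesis using that unfolding T'_def by auto
  qed
  have T'off: "T' z = T z" if "\<And>i. i \<le> l \<Longrightarrow> z \<noteq> ?p i" for z
  proof -
    have "z \<noteq> y" using that[of 0] by simp
    moreover have "\<not> (\<exists>i<l. z = ?p (Suc i))" using that by (metis Suc_leI)
    ultimately show ?thesis unfolding T'_def by (simp only: if_False)
  qed
  have T'out: "T' z = T z" if "z \<notin> D x" for z using T'off[of z] that pD by metis
  have pcases: "z = y \<or> (\<exists>i<l. z = ?p (Suc i)) \<or> (\<forall>i\<le>l. z \<noteq> ?p i)" for z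
  proof -
    have "z = y \<or> (\<exists>i<l. z = ?p (Suc i))" if j: "j \<le> l" "z = ?p j" for j
    proof (cases j)
      case (Suc i)
      then have "i < l" "z = ?p (Suc i)" using j by auto
      then show ?thesis by blast
    qed (use j in simp)
    then show ?thesis by blast
  qed
  have T'W: "T' z \<in> D x" if "z \<in> D x" "z \<noteq> y" for z
    using pcases[of z]
  proof (elim disjE exE conjE)
    fix i assume "i < l" "z = ?p (Suc i)" then show ?thesis using T'p[of i] pD[of i] by simp
  next
    assume a: "\<forall>i\<le>l. z \<noteq> ?p i"
    then have "z \<noteq> x" using l by blast
    then show ?thesis using T'off[of z] a desc_T[OF that(1) _ xV] by auto
  qed (use that in auto)
  have wt: "wtree V T'"
  proof
    show "finite V" by (rule fin)
    show "T' z \<in> nb z" if z: "z \<in> V" for z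
      using pcases[of z]
    proof (elim disjE exE conjE)
      fix i assume i: "i < l" "z = ?p (Suc i)"
      then have "z = T (?p i)" using pV[of i] by (simp add: up_Suc adv_def)
      then have "z \<in> nb (?p i)" using nbT pV[of i] i by simp
      then show ?thesis using T'p[of i] i nb_sym by metis
    qed (use T'y w T'off nbT z in auto)
    show "\<exists>z\<in>F. T' z \<notin> F" if F: "F \<subseteq> V" "F \<noteq> {}" for F
    proof (rule ccontr)
      assume "\<not> (\<exists>z\<in>F. T' z \<notin> F)"
      then have cl: "\<And>z. z \<in> F \<Longrightarrow> T' z \<in> F" by blast
      show False
      proof (cases "F \<subseteq> D x")
        case True
        \<comment> \<open>A closed set within the branch misses \<open>y\<close>, whose new parent
          is outside, hence misses the whole reversed path, which leads to \<open>y\<close>. Off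
          this path \<open>T'\<close> equals \<open>T\<close>, so the set would be closed for
          \<open>T\<close>.\<close>
        then have "y \<notin> F" using cl[of y] T'y w by auto
        have np: "?p i \<notin> F" if "i \<le> l" for i
          using that
        proof (induction i)
          case 0 then show ?case using \<open>y \<notin> F\<close> by simp
        next
          case (Suc i) then show ?case using cl[of "?p (Suc i)"] T'p[of i] by auto
        qed
        then have "T z \<in> F" if "z \<in> F" for z using T'off[of z] cl[OF that] that by metis
        then show False using acyc[OF F] by blast
      next
        case False
        then have "F - D x \<noteq> {}" by blast
        then obtain z where z: "z \<in> F - D x" "T z \<notin> F - D x" using acyc[of "F - D x"] F by blast
        then have "T z \<in> F" using cl[of z] T'out[of z] by auto
        then have "T z \<in> D x" using z by blast
        then show False using desc_closed_back[of z x] z F by blast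
      qed
    qed
  qed
  interpret B: wtree V T' by (rule wt)
  have W: "desc V T' y = D x"
  proof
    show "D x \<subseteq> desc V T' y"
    proof (rule ccontr)
      assume "\<not> D x \<subseteq> desc V T' y"
      let ?F = "D x - desc V T' y"
      have "T' z \<in> ?F" if z: "z \<in> ?F" for z
      proof
        have "z \<noteq> y" using z desc_self[OF l(2), of T'] by auto
        then show "T' z \<in> D x" using T'W z by blast
        show "T' z \<notin> desc V T' y" using B.desc_closed_back[of z y] z desc_sub[of V T x] by blast
      qed
      moreover have "?F \<subseteq> V" "?F \<noteq> {}" using desc_sub[of V T x] \<open>\<not> D x \<subseteq> desc V T' y\<close> by auto
      ultimately show False using B.acyc by blast
    qed
    show "desc V T' y \<subseteq> D x"
    proof
      fix z assume "z \<in> desc V T' y"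
      then obtain k where k: "up V T' k z = y" "z \<in> V" by (auto simp: desc_def)
      show "z \<in> D x"
      proof (rule ccontr)
        assume z: "z \<notin> D x"
        have "up V T' i z \<notin> D x" for i
        proof (induction i)
          case (Suc i)
          then show ?case using T'out[OF Suc] desc_closed_back[of "up V T' i z" x] by (auto simp: up_Suc adv_def)
        qed (use z in simp)
        then show False using k y by metis
      qed
    qed
  qed
  have E: "branch_edges V T' y = branch_edges V T x"
    unfolding branch_edges_def W
  proof (intro equalityI image_subsetI)
    fix z assume z: "z \<in> D x - {y}"
    show "{z, T' z} \<in> (\<lambda>z. {z, T z}) ` (D x - {x})"
      using pcases[of z]
    proof (elim disjE exE conjE)
      fix i assume i: "i < l" "z = ?p (Suc i)"
      have "?p i \<noteq> x" using pinj[of i l] i l by auto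
      moreover have "T (?p i) = z" using i pV[of i] by (simp add: up_Suc adv_def)
      ultimately show ?thesis using T'p[of i] pD[of i] i by (intro image_eqI[of _ _ "?p i"]) auto
    next
      assume a: "\<forall>i\<le>l. z \<noteq> ?p i"
      then have "z \<noteq> x" using l by blast
      then show ?thesis using z T'off[of z] a by (intro image_eqI[of _ _ z]) auto
    qed (use z in auto)
  next
    fix z assume z: "z \<in> D x - {x}"
    show "{z, T z} \<in> (\<lambda>z. {z, T' z}) ` (D x - {y})"
    proof (cases "\<exists>i<l. z = ?p i")
      case True
      then obtain i where i: "i < l" "z = ?p i" by blast
      have "T z = ?p (Suc i)" using i pV[of i] by (simp add: up_Suc adv_def)
      moreover have "?p (Suc i) \<noteq> y" using pinj[of "Suc i" 0] i by auto
      ultimately show ?thesis using T'p[of i] pD[of "Suc i"] i by (intro image_eqI[of _ _ "?p (Suc i)"]) auto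
    next
      case False
      then have a: "\<And>i. i \<le> l \<Longrightarrow> z \<noteq> ?p i" using z l by (metis DiffE insertI1 le_neq_implies_less)
      then have "z \<noteq> y" using a[of 0] by simp
      then show ?thesis using z T'off[of z] a by (intro image_eqI[of _ _ z]) auto
    qed
  qed
  have "T' \<in> extensional V"
    unfolding extensional_def
  proof (intro CollectI allI impI)
    fix z assume z: "z \<notin> V"
    then have "z \<notin> D x" using desc_sub[of V T x] by blast
    then show "T' z = undefined" using T'out ext z by (simp add: extensional_def)
  qed
  then have "T' \<in> TR V" by (rule wtree_TR[OF wt])
  moreover have "restrict T' (V - D x) = restrict T (V - D x)" using T'out by (auto simp: fun_eq_iff)
  ultimately show ?thesis using T'y W E by blast
qed

end

subsection \<open>Spheres in the supremum norm\<close>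

definition supd :: "'d::finite site \<Rightarrow> 'd site \<Rightarrow> int" where
  "supd x z = Max (range (\<lambda>i. \<bar>z i - x i\<bar>))"

lemma supd_le_iff: "supd x z \<le> r \<longleftrightarrow> (\<forall>i. \<bar>z i - x i\<bar> \<le> r)"
  unfolding supd_def by (subst Max_le_iff) auto

lemma supd_less_iff: "supd x z < r \<longleftrightarrow> (\<forall>i. \<bar>z i - x i\<bar> < r)"
  unfolding supd_def by (subst Max_less_iff) auto

lemma supd_attained: "\<exists>i. \<bar>z i - x i\<bar> = supd x z"
proof -
  have "Max (range (\<lambda>i. \<bar>z i - x i\<bar>)) \<in> range (\<lambda>i. \<bar>z i - x i\<bar>)" by (intro Max_in) auto
  then obtain i where "Max (range (\<lambda>i. \<bar>z i - x i\<bar>)) = \<bar>z i - x i\<bar>" by blast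
  then show ?thesis unfolding supd_def by metis
qed

lemma supd_ge: "\<bar>z i - x i\<bar> \<le> supd x z"
  using supd_le_iff[of x z "supd x z"] by simp

lemma supd_eqI: "(\<And>i. \<bar>z i - x i\<bar> \<le> r) \<Longrightarrow> \<bar>z j - x j\<bar> = r \<Longrightarrow> supd x z = r"
  using supd_le_iff supd_ge by (metis antisym)

lemma supd_adj:
  assumes "z' \<in> nb z" shows "\<bar>supd x z' - supd x z\<bar> \<le> 1"
proof -
  obtain i s where s: "s \<in> {1, -1 :: int}" "z' = z(i := z i + s)" using assms unfolding mem_nb adj_iff by blast
  have 1: "\<bar>z' j - z j\<bar> \<le> 1" for j using s by auto
  have "\<bar>z' j - x j\<bar> \<le> supd x z + 1" for j using 1[of j] supd_ge[of z j x] by linarith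
  moreover have "\<bar>z j - x j\<bar> \<le> supd x z' + 1" for j using 1[of j] supd_ge[of z' j x] by linarith
  ultimately have "supd x z' \<le> supd x z + 1" "supd x z \<le> supd x z' + 1" by (auto simp: supd_le_iff)
  then show ?thesis by linarith
qed

text \<open>An extreme coordinate \<open>i\<close> keeps the point on the sphere while coordinate
  \<open>j\<close> moves freely within its range.\<close>

lemma line_invariant:
  assumes Q: "\<forall>z w. supd x z = r \<longrightarrow> supd x w = r \<longrightarrow> w \<in> nb z \<longrightarrow> Q z \<longrightarrow> Q w"
    and z: "supd x z = r" and i: "\<bar>z i - x i\<bar> = r" "i \<noteq> j" and t: "\<bar>t - x j\<bar> \<le> r"
  shows "Q z \<longleftrightarrow> Q (z(j := t))"
proof -
  have sp: "supd x (z(j := u)) = r" if "\<bar>u - x j\<bar> \<le> r" for u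
  proof (rule supd_eqI[of _ _ _ i])
    fix k show "\<bar>(z(j := u)) k - x k\<bar> \<le> r" using that supd_ge[of z k x] z by auto
  qed (use i in auto)
  have step: "Q (z(j := u)) \<longleftrightarrow> Q (z(j := u + 1))" if "\<bar>u - x j\<bar> \<le> r" "\<bar>u + 1 - x j\<bar> \<le> r" for u
  proof -
    have "adj (z(j := u)) (z(j := u + 1))" unfolding adj_iff by (intro exI[of _ j] bexI[of _ 1]) auto
    then show ?thesis using Q sp[OF that(1)] sp[OF that(2)] mem_nb adj_sym by metis
  qed
  have inc: "Q (z(j := u)) \<longleftrightarrow> Q (z(j := u + int n))" if "\<bar>u - x j\<bar> \<le> r" "\<bar>u + int n - x j\<bar> \<le> r" for u n
    using that
  proof (induction n)
    case (Suc n)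
    have b: "\<bar>u + int n - x j\<bar> \<le> r" using Suc.prems by auto
    moreover have e: "u + int (Suc n) = u + int n + 1" by simp
    ultimately have "Q (z(j := u + int n)) \<longleftrightarrow> Q (z(j := u + int (Suc n)))" using step[of "u + int n"] Suc.prems(2) unfolding e by blast
    then show ?case using Suc.IH[OF Suc.prems(1) b] by blast
  qed simp
  have zj: "\<bar>z j - x j\<bar> \<le> r" using supd_ge[of z j x] z by simp
  show ?thesis
  proof (cases "z j \<le> t")
    case True then show ?thesis using inc[of "z j" "nat (t - z j)"] zj t by simp
  next
    case False then show ?thesis using inc[of t "nat (z j - t)"] zj t by simp
  qed
qed

text \<open>Spheres are connected in dimension at least two: any point can be moved to a corner, one
  coordinate after the other, keeping one coordinate extreme.\<close>

lemma sphere_connected: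
  fixes x :: "'d::finite site"
  assumes d: "CARD('d) \<ge> 2" and Q: "\<forall>z w. supd x z = r \<longrightarrow> supd x w = r \<longrightarrow> w \<in> nb z \<longrightarrow> Q z \<longrightarrow> Q w"
    and ab: "supd x a = r" "supd x b = r" "Q a"
  shows "Q b"
proof -
  have corner: "Q z \<longleftrightarrow> Q (\<lambda>i. x i + r)" if z: "supd x z = r" for z
  proof -
    obtain i where i: "\<bar>z i - x i\<bar> = r" using supd_attained[of z x] z by auto
    then have r0: "r \<ge> 0" by simp
    have part: "Q z \<longleftrightarrow> Q (\<lambda>j. if j \<in> A then x j + r else z j)" if "finite A" "i \<notin> A" for A
      using that
    proof (induction A rule: finite_induct)
      case (insert k A)
      let ?z = "\<lambda>j. if j \<in> A then x j + r else z j"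
      have "supd x ?z = r"
      proof (rule supd_eqI[of _ _ _ i])
        fix k show "\<bar>?z k - x k\<bar> \<le> r" using r0 supd_ge[of z k x] z by auto
      qed (use i insert in auto)
      moreover have "\<bar>?z i - x i\<bar> = r" using i insert by auto
      moreover have "i \<noteq> k" "\<bar>x k + r - x k\<bar> \<le> r" using insert r0 by auto
      ultimately have "Q ?z \<longleftrightarrow> Q (?z(k := x k + r))" by (rule line_invariant[OF Q])
      moreover have "?z(k := x k + r) = (\<lambda>j. if j \<in> insert k A then x j + r else z j)" by auto
      ultimately show ?case using insert by simp
    qed simp
    \<comment> \<open>All coordinates except the extreme one \<open>i\<close> are now at the corner
      value. In dimension at least two one of them is extreme as well, so \<open>i\<close> may be
      moved last.\<close>
    let ?z = "\<lambda>j. if j \<in> UNIV - {i} then x j + r else z j"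
    have "\<exists>k. k \<noteq> i"
    proof (rule ccontr)
      assume "\<not> (\<exists>k. k \<noteq> i)"
      then have "(UNIV :: 'd set) = {i}" by auto
      then have "CARD('d) = card {i}" by metis
      then show False using d by simp
    qed
    then obtain k where k: "k \<noteq> i" ..
    have sz: "supd x ?z = r"
    proof (rule supd_eqI[of _ _ _ i])
      fix k show "\<bar>?z k - x k\<bar> \<le> r" using r0 supd_ge[of z k x] z by auto
    qed (use i in auto)
    moreover have "\<bar>?z k - x k\<bar> = r" using k r0 by simp
    ultimately have "Q ?z \<longleftrightarrow> Q (?z(i := x i + r))" by (rule line_invariant[OF Q]) (use k r0 in auto)
    moreover have "?z(i := x i + r) = (\<lambda>i. x i + r)" by auto
    moreover have "Q z \<longleftrightarrow> Q ?z" by (rule part) auto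
    ultimately show ?thesis by simp
  qed
  show ?thesis using corner[OF ab(1)] corner[OF ab(2)] ab(3) by simp
qed

lemma sphere_exit:
  fixes x :: "'d::finite site"
  assumes "CARD('d) \<ge> 2" "supd x a = r" "supd x b = r" "a \<in> W" "b \<notin> W"
  shows "\<exists>y w. y \<in> W \<and> w \<notin> W \<and> w \<in> nb y \<and> supd x y = r"
  using sphere_connected[of x r "\<lambda>z. z \<in> W" a b] assms by blast

subsection \<open>Classes of rooted branches\<close>

text \<open>A tile of side \<open>4 * b\<close> of a fixed tiling rather than a ball around
  \<open>x\<close>, so that belonging to the same cube is an equivalence relation and can be part of
  \<open>key\<close>.\<close>

definition cube :: "nat \<Rightarrow> 'd::finite site \<Rightarrow> 'd site set" where
  "cube b x = {y. \<forall>i. y i div int (4 * b) = x i div int (4 * b)}"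

text \<open>Far enough from the faces of the cube for all spheres of radius below \<open>b\<close>
  around \<open>x\<close> to stay inside it.\<close>

definition middle :: "nat \<Rightarrow> 'd::finite site \<Rightarrow> bool" where
  "middle b x \<longleftrightarrow> (\<forall>i. int b \<le> x i mod int (4 * b) \<and> x i mod int (4 * b) < int (3 * b))"

definition pairs :: "'d::finite site set \<Rightarrow> nat \<Rightarrow> (('d site \<Rightarrow> 'd site) \<times> 'd site) set" where
  "pairs V K = {(T, x). T \<in> TR V \<and> x \<in> V \<and> K \<le> sz V T x}"

text \<open>What does not change when the branch below \<open>x\<close> is rerooted within the cube of \<open>x\<close>.\<close>

definition key where
  "key V b = (\<lambda>(T, x). (desc V T x, restrict T (V - desc V T x), branch_edges V T x, \<lambda>i. x i div int (4 * b)))"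

definition nice where
  "nice V b K G H r T x \<longleftrightarrow> (\<exists>c. spine V T K G H x c \<and> \<not> long_bush V T G r c)
     \<and> \<not> (\<exists>y\<in>V. y \<in> cube b x \<and> tip V T G H y)"

lemma card_box: "card {f :: 'd::finite site. \<forall>i. f i \<in> A i} = (\<Prod>i\<in>UNIV. card (A i))"
proof -
  have "{f :: 'd site. \<forall>i. f i \<in> A i} = PiE UNIV A" by auto
  then show ?thesis by (simp add: card_PiE)
qed

lemma finite_box: "(\<And>i. finite (A i)) \<Longrightarrow> finite {f :: 'd::finite site. \<forall>i. f i \<in> A i}"
proof -
  assume "\<And>i. finite (A i)"
  then have "finite (PiE UNIV A)" by (intro finite_PiE) auto
  moreover have "{f :: 'd site. \<forall>i. f i \<in> A i} = PiE UNIV A" by auto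
  ultimately show ?thesis by simp
qed

lemma cube_box:
  assumes "b \<ge> 1"
  shows "cube b x = {y. \<forall>i. y i \<in> {int (4 * b) * (x i div int (4 * b))..<int (4 * b) * (x i div int (4 * b)) + int (4 * b)}}"
proof -
  have "(u div int (4 * b) = q) \<longleftrightarrow> u \<in> {int (4 * b) * q..<int (4 * b) * q + int (4 * b)}" for u q :: int
  proof
    assume q: "u div int (4 * b) = q"
    have "u = int (4 * b) * q + u mod int (4 * b)" using q by (metis mult_div_mod_eq)
    moreover have "0 \<le> u mod int (4 * b)" "u mod int (4 * b) < int (4 * b)" using assms by simp_all
    ultimately show "u \<in> {int (4 * b) * q..<int (4 * b) * q + int (4 * b)}" by auto
  next
    assume u: "u \<in> {int (4 * b) * q..<int (4 * b) * q + int (4 * b)}"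
    show "u div int (4 * b) = q"
      by (rule int_div_pos_eq[of _ _ _ "u - int (4 * b) * q"]) (use u in auto)
  qed
  then show ?thesis unfolding cube_def by simp
qed

lemma card_cube: "b \<ge> 1 \<Longrightarrow> card (cube b (x :: 'd::finite site)) = (4 * b) ^ CARD('d)" "b \<ge> 1 \<Longrightarrow> finite (cube b x)"
proof -
  assume "b \<ge> 1"
  note c = cube_box[OF this]
  show "card (cube b x) = (4 * b) ^ CARD('d)" unfolding c card_box by (simp add: nat_mult_distrib)
  show "finite (cube b x)" unfolding c by (rule finite_box) simp
qed

lemma cube_sym: "y \<in> cube b x \<longleftrightarrow> x \<in> cube b y"
  unfolding cube_def by auto

lemma middle_ball:
  assumes m: "middle b x" and z: "supd x z < int b"
  shows "z \<in> cube b x"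
  unfolding cube_def
proof (intro CollectI allI)
  fix i
  define m where "m = x i mod int (4 * b)"
  have m: "int b \<le> m" "m < int (3 * b)" using m unfolding middle_def m_def by auto
  have zi: "\<bar>z i - x i\<bar> < int b" using z unfolding supd_less_iff by blast
  have "x i = int (4 * b) * (x i div int (4 * b)) + m" unfolding m_def by (metis mult_div_mod_eq)
  then have "z i = int (4 * b) * (x i div int (4 * b)) + (m + (z i - x i))" by simp
  then show "z i div int (4 * b) = x i div int (4 * b)"
    by (rule int_div_pos_eq) (use m zi in auto)
qed

lemma supd_self: "supd x x = 0"
  by (rule supd_eqI[of _ _ _ undefined]) auto

lemma supd_cross:
  fixes f :: "nat \<Rightarrow> 'd::finite site"
  assumes "\<And>i. m \<le> i \<Longrightarrow> i < n \<Longrightarrow> f (Suc i) \<in> nb (f i)" "m \<le> n"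
    and "supd x (f m) \<le> r \<and> r \<le> supd x (f n) \<or> supd x (f n) \<le> r \<and> r \<le> supd x (f m)"
  shows "\<exists>i. m \<le> i \<and> i \<le> n \<and> supd x (f i) = r"
proof -
  have st: "\<bar>supd x (f (Suc i)) - supd x (f i)\<bar> \<le> 1" if "m \<le> i \<and> i < n" for i
    using assms(1) that by (intro supd_adj) auto
  show ?thesis
    using assms(3)
  proof
    assume "supd x (f m) \<le> r \<and> r \<le> supd x (f n)"
    then show ?thesis
      using nat_intermed_int_val[of m n "\<lambda>i. supd x (f i)" r] assms(2) st by auto
  next
    assume a: "supd x (f n) \<le> r \<and> r \<le> supd x (f m)"
    have "\<exists>i. m \<le> i \<and> i \<le> n \<and> - supd x (f i) = - r"
    proof (rule nat_intermed_int_val)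
      show "\<forall>i. m \<le> i \<and> i < n \<longrightarrow> \<bar>- supd x (f (Suc i)) - - supd x (f i)\<bar> \<le> 1"
      proof (intro allI impI)
        fix i assume "m \<le> i \<and> i < n"
        then show "\<bar>- supd x (f (Suc i)) - - supd x (f i)\<bar> \<le> 1" using st[of i] by linarith
      qed
    qed (use a assms(2) in auto)
    then show ?thesis by auto
  qed
qed

lemma (in wtree) up_nb: "upT i z \<in> V \<Longrightarrow> upT (Suc i) z \<in> nb (upT i z)"
  using nbT by (simp add: up_Suc adv_def)

text \<open>The branch is larger than the cube, so the path from some descendant outside the cube to
  \<open>x\<close> crosses the sphere within the branch. The path from \<open>x\<close> to the root
  leaves \<open>V\<close>, hence the cube, and crosses the sphere outside the branch.\<close>

lemma (in wtree) sphere_hits: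
  assumes xV: "x \<in> V" and Q: "cube b x \<subseteq> V" and m: "middle b x" and b: "1 \<le> b"
    and big: "card (cube b x) < s x" and r: "1 \<le> r" "r < int b"
  shows "\<exists>u\<in>D x. supd x u = r" "\<exists>u. u \<notin> D x \<and> supd x u = r"
proof -
  have far: "int b \<le> supd x z" if "z \<notin> cube b x" for z
    using middle_ball[OF m, of z] that by force
  have "\<not> D x \<subseteq> cube b x"
  proof
    assume "D x \<subseteq> cube b x"
    then have "s x \<le> card (cube b x)" using card_cube(2)[OF b] by (intro card_mono)
    then show False using big by simp
  qed
  then obtain z where z: "z \<in> D x" "z \<notin> cube b x" by blast
  then obtain k where k: "upT k z = x" "z \<in> V" by (auto simp: desc_def)
  have inD: "upT i z \<in> D x" if "i \<le> k" for i
    using up_in_le[of V T k z i] k xV that up_add[of V T "k - i" i z] by (intro descI[of _ _ _ "k - i"]) auto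
  have "\<exists>i. 0 \<le> i \<and> i \<le> k \<and> supd x (upT i z) = r"
  proof (rule supd_cross)
    show "upT (Suc i) z \<in> nb (upT i z)" if "i < k" for i
      using up_nb inD[of i] desc_sub that by (metis less_imp_le subsetD)
    show "supd x (upT 0 z) \<le> r \<and> r \<le> supd x (upT k z) \<or> supd x (upT k z) \<le> r \<and> r \<le> supd x (upT 0 z)"
      using far[OF z(2)] k supd_self[of x] r by simp
  qed simp
  then show "\<exists>u\<in>D x. supd x u = r" using inD by blast
  define n where "n = (LEAST n. upT n x \<notin> V)"
  have nV: "upT n x \<notin> V" unfolding n_def using LeastI_ex[OF up_leaves[of x]] .
  have nl: "upT i x \<in> V" if "i < n" for i using not_less_Least[of i "\<lambda>n. upT n x \<notin> V"] that unfolding n_def by blast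
  have n1: "1 \<le> n" using nV xV by (cases n) auto
  \<comment> \<open>The path is taken from the parent of \<open>x\<close> on, because
    \<open>x\<close> itself belongs to its branch; the parent is at distance at most 1 from
    \<open>x\<close>.\<close>
  have "\<exists>i. 1 \<le> i \<and> i \<le> n \<and> supd x (upT i x) = r"
  proof (rule supd_cross)
    show "upT (Suc i) x \<in> nb (upT i x)" if "i < n" for i using up_nb nl[OF that] by blast
    have "upT n x \<notin> cube b x" using nV Q by blast
    then have "r \<le> supd x (upT n x)" using far r by force
    moreover have "upT (Suc 0) x \<in> nb x" using up_nb[of 0 x] xV by simp
    then have "\<bar>supd x (upT (Suc 0) x) - supd x x\<bar> \<le> 1" by (rule supd_adj)
    then have "supd x (upT 1 x) \<le> r" using supd_self[of x] r by simp
    ultimately show "supd x (upT 1 x) \<le> r \<and> r \<le> supd x (upT n x) \<or> supd x (upT n x) \<le> r \<and> r \<le> supd x (upT 1 x)"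
      by blast
  qed (use n1 in auto)
  then show "\<exists>u. u \<notin> D x \<and> supd x u = r" using beyond_desc[OF xV] by blast
qed

lemma finite_pairs: "finite V \<Longrightarrow> finite (pairs V K)"
  by (rule finite_subset[of _ "TR V \<times> V"]) (auto simp: pairs_def)

text \<open>Every radius \<open>r\<close> with \<open>1 \<le> r\<close> and \<open>r < b\<close>
  provides an exit edge on its sphere, and rerooting there gives a member at distance exactly
  \<open>r\<close> from \<open>x\<close>; different radii give different members.\<close>

lemma class_size:
  fixes V :: "'d::finite site set"
  assumes d: "CARD('d) \<ge> 2" and fV: "finite V" and p: "(T, x) \<in> pairs V K"
    and Q: "cube b x \<subseteq> V" and m: "middle b x" and b: "1 \<le> b" and K: "(4 * b) ^ CARD('d) < K"
  shows "b - 1 \<le> card {q \<in> pairs V K. key V b q = key V b (T, x)}"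
proof -
  have T: "T \<in> TR V" and xV: "x \<in> V" and sK: "K \<le> sz V T x" using p by (auto simp: pairs_def)
  interpret wtree V T by (rule TR_wtree[OF fV T])
  let ?C = "{q \<in> pairs V K. key V b q = key V b (T, x)}"
  have "\<exists>q\<in>?C. supd x (snd q) = r" if r: "1 \<le> r" "r < int b" for r
  proof -
    have big: "card (cube b x) < s x" using sK K unfolding card_cube(1)[OF b] by linarith
    obtain u v where uv: "u \<in> D x" "supd x u = r" "v \<notin> D x" "supd x v = r"
      using sphere_hits[OF xV Q m b big r] by blast
    obtain y w where y: "y \<in> D x" "w \<notin> D x" "w \<in> nb y" "supd x y = r"
      using sphere_exit[OF d uv(2,4,1,3)] by blast
    have ext: "T \<in> extensional V" using T by (simp add: Rec_def PiE_def)
    obtain T' where T': "T' \<in> TR V" "T' y = w" "restrict T' (V - D x) = restrict T (V - D x)" "desc V T' y = D x"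
      "branch_edges V T' y = branch_edges V T x"
      using reroot[OF xV y(1,3,2) ext] by blast
    have "y \<in> cube b x" using middle_ball[OF m] y r by simp
    then have "(\<lambda>i. y i div int (4 * b)) = (\<lambda>i. x i div int (4 * b))" unfolding cube_def by auto
    then have "key V b (T', y) = key V b (T, x)" unfolding key_def using T' by simp
    moreover have "(T', y) \<in> pairs V K" using T' y sK desc_sub[of V T x] by (auto simp: pairs_def)
    ultimately show ?thesis using y(4) by (intro bexI[of _ "(T', y)"]) auto
  qed
  then have "{1..<int b} \<subseteq> (\<lambda>q. supd x (snd q)) ` ?C" by (fastforce simp: image_iff)
  moreover have fC: "finite ?C" using finite_pairs[OF fV] by simp
  ultimately have "card {1..<int b} \<le> card ((\<lambda>q. supd x (snd q)) ` ?C)" by (intro card_mono) auto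
  also have "\<dots> \<le> card ?C" by (rule card_image_le[OF fC])
  finally show ?thesis by simp
qed

lemma wpair_of_key:
  assumes fV: "finite V" and p: "(T, x) \<in> pairs V K" "(T', y) \<in> pairs V K" and e: "key V b (T, x) = key V b (T', y)"
  shows "\<exists>l. wpair V T T' x y l"
proof -
  have T: "T \<in> TR V" "T' \<in> TR V" "x \<in> V" "y \<in> V" using p by (auto simp: pairs_def)
  have k: "desc V T x = desc V T' y" "branch_edges V T x = branch_edges V T' y" using e by (auto simp: key_def)
  then have "y \<in> desc V T x" using desc_self T by metis
  then obtain l where "up V T l y = x" by (auto simp: desc_def)
  then have "wpair V T T' x y l"
    using TR_wtree[OF fV] T k unfolding wpair_def wpair_axioms_def branch_edges_def by auto
  then show ?thesis ..
qed

text \<open>With equal top vertex the path between the roots is trivial, so the branch has the same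
  orientation in both trees; the key fixes the rest.\<close>

lemma key_inj:
  assumes fV: "finite V" and p: "(T, x) \<in> pairs V K" "(T', x) \<in> pairs V K" and e: "key V b (T, x) = key V b (T', x)"
    and eq: "T x = T' x"
  shows "T = T'"
proof
  fix z
  obtain l where "wpair V T T' x x l" using wpair_of_key[OF fV p e] ..
  then interpret wpair V T T' x x l .
  have ex: "T \<in> extensional V" "T' \<in> extensional V" using p by (auto simp: pairs_def Rec_def PiE_def)
  have "l = 0" using A.up_no_cycle l xV by blast
  then have P: "P = {x}" unfolding P_def by auto
  have r: "restrict T (V - W) = restrict T' (V - W)" using e same_W by (auto simp: key_def)
  consider "z \<notin> V" | "z \<in> V - W" | "z = x" | "z \<in> W" "z \<noteq> x" by blast
  then show "T z = T' z"
  proof cases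
    case 1 then show ?thesis using ex by (simp add: extensional_def)
  next
    case 2 then show ?thesis using r by (metis restrict_apply')
  next
    case 4 then show ?thesis using off_path P by simp
  qed (use eq in simp)
qed

lemma (in wtree) supd_up: "upT k z \<in> V \<Longrightarrow> supd z (upT k z) \<le> int k"
proof (induction k)
  case (Suc k)
  then have v: "upT k z \<in> V" using up_in_le[of V T "Suc k" z k] by simp
  then have "\<bar>supd z (upT (Suc k) z) - supd z (upT k z)\<bar> \<le> 1" using up_nb supd_adj by blast
  then show ?case using Suc.IH[OF v] by simp
qed (simp add: supd_self)

text \<open>At distance at least \<open>2 * r\<close> the path joining the roots has length at least
  \<open>2 * r\<close>, and \<open>spines_dichotomy\<close> produces a tip in the common cube, which
  niceness excludes.\<close>

lemma nice_close:
  assumes fV: "finite V" and p: "(T, x) \<in> pairs V K" "(T', y) \<in> pairs V K" and e: "key V b (T, x) = key V b (T', y)"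
    and n: "nice V b K G H r T x" "nice V b K G H r T' y" and G: "1 \<le> G"
  shows "supd y x < int (2 * r)"
proof (rule ccontr)
  assume a: "\<not> supd y x < int (2 * r)"
  obtain l where "wpair V T T' x y l" using wpair_of_key[OF fV p e] ..
  then interpret wpair V T T' x y l .
  have "supd y x \<le> int l" using A.supd_up[of l y] l xV by simp
  then have "2 * r \<le> l" using a by simp
  moreover obtain cx cy where "spine V T K G H x cx" "\<not> long_bush V T G r cx" "spine V T' K G H y cy" "\<not> long_bush V T' G r cy"
    using n unfolding nice_def by blast
  ultimately have "tip V T G H y" using spines_dichotomy G by blast
  moreover have "(\<lambda>i. y i div int (4 * b)) = (\<lambda>i. x i div int (4 * b))" using e by (simp add: key_def)
  then have "y \<in> cube b x" unfolding cube_def by (auto dest: fun_cong)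
  ultimately show False using n(1) yV unfolding nice_def by blast
qed

text \<open>A member is determined by its root and the exit edge there. The roots lie in a box of
  side at most \<open>4 * r\<close>, and there are \<open>2d\<close> possible exit edges.\<close>

lemma class_nice:
  fixes V :: "'d::finite site set"
  assumes fV: "finite V" and r: "1 \<le> r" and G: "1 \<le> G"
  shows "card {q \<in> pairs V K. key V b q = \<kappa> \<and> nice V b K G H r (fst q) (snd q)} \<le> (4 * r) ^ CARD('d) * deg TYPE('d)"
proof (cases "{q \<in> pairs V K. key V b q = \<kappa> \<and> nice V b K G H r (fst q) (snd q)} = {}")
  case False
  let ?C = "{q \<in> pairs V K. key V b q = \<kappa> \<and> nice V b K G H r (fst q) (snd q)}"
  obtain T0 x0 where q0: "(T0, x0) \<in> ?C" using False by auto
  let ?box = "{z. supd x0 z < int (2 * r)}"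
  have "?box \<subseteq> {z. \<forall>i. z i \<in> {x0 i - int (2 * r)..<x0 i + int (2 * r)}}"
  proof
    fix z assume "z \<in> ?box"
    then have "\<bar>z i - x0 i\<bar> < int (2 * r)" for i unfolding supd_less_iff by blast
    then have "z i \<in> {x0 i - int (2 * r)..<x0 i + int (2 * r)}" for i by (smt (verit) atLeastLessThan_iff)
    then show "z \<in> {z. \<forall>i. z i \<in> {x0 i - int (2 * r)..<x0 i + int (2 * r)}}" by blast
  qed
  moreover have fb: "finite {z :: 'd site. \<forall>i. z i \<in> {x0 i - int (2 * r)..<x0 i + int (2 * r)}}"
    by (rule finite_box) simp
  ultimately have "card ?box \<le> card {z :: 'd site. \<forall>i. z i \<in> {x0 i - int (2 * r)..<x0 i + int (2 * r)}}"
    by (intro card_mono)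
  also have "\<dots> = (4 * r) ^ CARD('d)" unfolding card_box by (simp add: nat_mult_distrib)
  finally have cb: "card ?box \<le> (4 * r) ^ CARD('d)" .
  have fbox: "finite ?box" using \<open>?box \<subseteq> _\<close> fb by (rule finite_subset)
  have "card ?C \<le> card (SIGMA z:?box. nb z)"
  proof (rule card_inj_on_le[where f = "\<lambda>q. (snd q, fst q (snd q))"])
    show "inj_on (\<lambda>q. (snd q, fst q (snd q))) ?C"
    proof (rule inj_onI)
      fix q q' assume q: "q \<in> ?C" "q' \<in> ?C" "(snd q, fst q (snd q)) = (snd q', fst q' (snd q'))"
      obtain T x T' where e: "q = (T, x)" "q' = (T', x)" "T x = T' x" using q(3) by (cases q; cases q') auto
      have "T = T'" using q(1,2) e(3) unfolding e(1,2) by (intro key_inj[OF fV, of T x K T' b]) auto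
      then show "q = q'" using e by simp
    qed
    show "(\<lambda>q. (snd q, fst q (snd q))) ` ?C \<subseteq> (SIGMA z:?box. nb z)"
    proof (rule image_subsetI)
      fix q assume q: "q \<in> ?C"
      obtain T x where e: "q = (T, x)" by (cases q)
      have "supd x0 x < int (2 * r)"
        using q q0 unfolding e by (intro nice_close[OF fV _ _ _ _ _ G, of T x K T0 x0 b H r]) auto
      moreover have "T x \<in> nb x" using q unfolding e by (auto simp: pairs_def Rec_def PiE_def Pi_def)
      ultimately show "(snd q, fst q (snd q)) \<in> (SIGMA z:?box. nb z)" unfolding e by simp
    qed
    show "finite (SIGMA z:?box. nb z)" using fbox by simp
  qed
  also have "\<dots> = card ?box * deg TYPE('d)" using fbox by (simp add: card_SigmaI card_nb)
  finally show ?thesis using cb by (meson mult_le_mono1 order_trans)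
next
  case True
  show ?thesis unfolding True by simp
qed

text \<open>A class of pairs with the same key has at least \<open>b - 1\<close> members if it contains a middle vertex, one for each
  sphere that the branch crosses, but its nice members are within distance \<open>2 * r\<close> of each other.\<close>

lemma card_nice_middle:
  fixes V :: "'d::finite site set"
  assumes d: "CARD('d) \<ge> 2" and fV: "finite V" and b: "1 \<le> b" and r: "1 \<le> r" and G: "1 \<le> G"
    and K: "(4 * b) ^ CARD('d) < K"
  shows "(b - 1) * card {q \<in> pairs V K. middle b (snd q) \<and> cube b (snd q) \<subseteq> V \<and> nice V b K G H r (fst q) (snd q)}
    \<le> (4 * r) ^ CARD('d) * deg TYPE('d) * card (pairs V K)"
proof -
  let ?N = "{q \<in> pairs V K. middle b (snd q) \<and> cube b (snd q) \<subseteq> V \<and> nice V b K G H r (fst q) (snd q)}"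
  let ?M = "(4 * r) ^ CARD('d) * deg TYPE('d)"
  have fN: "finite ?N" using finite_pairs[OF fV] by simp
  have "card ?N \<le> card (\<Union>\<kappa>\<in>key V b ` ?N. {q \<in> pairs V K. key V b q = \<kappa> \<and> nice V b K G H r (fst q) (snd q)})"
    using finite_pairs[OF fV] fN by (intro card_mono) auto
  also have "\<dots> \<le> (\<Sum>\<kappa>\<in>key V b ` ?N. card {q \<in> pairs V K. key V b q = \<kappa> \<and> nice V b K G H r (fst q) (snd q)})"
    using fN by (intro card_UN_le) auto
  also have "\<dots> \<le> (\<Sum>\<kappa>\<in>key V b ` ?N. ?M)" by (intro sum_mono class_nice[OF fV r G])
  finally have 1: "card ?N \<le> card (key V b ` ?N) * ?M" by simp
  have "(\<Sum>\<kappa>\<in>key V b ` ?N. b - 1) \<le> (\<Sum>\<kappa>\<in>key V b ` ?N. card {q \<in> pairs V K. key V b q = \<kappa>})"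
  proof (rule sum_mono)
    fix \<kappa> assume "\<kappa> \<in> key V b ` ?N"
    then obtain T x where q: "(T, x) \<in> ?N" "\<kappa> = key V b (T, x)" by auto
    show "b - 1 \<le> card {q \<in> pairs V K. key V b q = \<kappa>}"
      unfolding q(2) using q(1) by (intro class_size[OF d fV _ _ _ b K]) auto
  qed
  also have "\<dots> = card (\<Union>\<kappa>\<in>key V b ` ?N. {q \<in> pairs V K. key V b q = \<kappa>})"
    using finite_pairs[OF fV] fN by (intro card_UN_disjoint[symmetric]) auto
  also have "\<dots> \<le> card (pairs V K)" using finite_pairs[OF fV] by (intro card_mono) auto
  finally have 2: "card (key V b ` ?N) * (b - 1) \<le> card (pairs V K)" by simp
  have "(b - 1) * card ?N \<le> (b - 1) * (card (key V b ` ?N) * ?M)" using 1 by (rule mult_le_mono2)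
  also have "\<dots> = ?M * (card (key V b ` ?N) * (b - 1))" by (simp only: mult.commute mult.left_commute)
  also have "\<dots> \<le> ?M * card (pairs V K)" using 2 by (rule mult_le_mono2)
  finally show ?thesis .
qed

text \<open>Three causes: no spine, a long bush, or a tip in the cube. The last is counted from the
  tip, whose cube has \<open>(4 * b)\<close> to the power \<open>d\<close> sites. Here
  \<open>G = 2 * g\<close> and \<open>r = 2 * a\<close> are the forms needed for the counts of tips
  and long bushes, and \<open>H = C * G\<close> is the weight allowed by
  \<open>card_no_spine\<close>.\<close>

lemma (in wtree) card_not_nice:
  assumes b: "1 \<le> b" and C: "1 \<le> C" and g: "1 \<le> g" and a: "1 \<le> a" and K: "C * (2 * g) < K"
  shows "C * card {x \<in> V. K \<le> s x \<and> \<not> nice V b K (2 * g) (C * (2 * g)) (2 * a) T x}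
    \<le> card V + C * (4 * g * card (window V T K (deg TYPE('d) * K + 1)))
      + C * (2 * card (window V T a (C * (2 * g)))) + C * ((4 * b) ^ CARD('d) * (2 * C * card (window V T g (C * (2 * g)))))"
proof -
  let ?G = "2 * g" and ?H = "C * (2 * g)"
  let ?X = "{x \<in> V. K \<le> s x \<and> \<not> nice V b K ?G ?H (2 * a) T x}"
  let ?A = "{x \<in> trunk K. \<nexists>c. spine V T K ?G ?H x c}"
  let ?B = "{x \<in> V. \<exists>c. spine V T K ?G ?H x c \<and> long_bush V T ?G (2 * a) c}"
  let ?t = "{y \<in> V. tip V T ?G ?H y}"
  have ft: "finite ?t" using fin by simp
  have "?X \<subseteq> ?A \<union> ?B \<union> (\<Union>y\<in>?t. cube b y)"
  proof
    fix x assume x: "x \<in> ?X"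
    then have "x \<in> trunk K" by (simp add: trunk_def)
    moreover have "(\<nexists>c. spine V T K ?G ?H x c) \<or> (\<exists>c. spine V T K ?G ?H x c \<and> long_bush V T ?G (2 * a) c)
       \<or> (\<exists>y\<in>V. y \<in> cube b x \<and> tip V T ?G ?H y)"
      using x unfolding nice_def by blast
    ultimately show "x \<in> ?A \<union> ?B \<union> (\<Union>y\<in>?t. cube b y)" using x cube_sym[of _ b x] by blast
  qed
  moreover have "finite (\<Union>y\<in>?t. cube b y)" using card_cube(2)[OF b] by (intro finite_UN_I[OF ft])
  then have "finite (?A \<union> ?B \<union> (\<Union>y\<in>?t. cube b y))" using fin by simp
  ultimately have "card ?X \<le> card (?A \<union> ?B \<union> (\<Union>y\<in>?t. cube b y))" by (intro card_mono)
  also have "\<dots> \<le> card ?A + card ?B + card (\<Union>y\<in>?t. cube b y)"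
    by (meson card_Un_le add_le_mono1 order_trans)
  also have "card (\<Union>y\<in>?t. cube b y) \<le> (\<Sum>y\<in>?t. card (cube b y))" by (rule card_UN_le[OF ft])
  also have "\<dots> = (4 * b) ^ CARD('d) * card ?t" by (simp add: card_cube(1)[OF b])
  finally have 1: "card ?X \<le> card ?A + card ?B + (4 * b) ^ CARD('d) * card ?t" by simp
  have K1: "1 \<le> K" using K by simp
  have 2: "C * card ?A \<le> C * (2 * ?G * card (window V T K (deg TYPE('d) * K + 1))) + card V"
    using card_no_spine[OF K1 C, of ?G] g by simp
  have 3: "card ?B \<le> 2 * card (window V T a ?H)" by (rule card_long_bush[OF K a])
  have "g * card ?t \<le> ?H * card (window V T g ?H)" by (rule card_tips)
  then have "g * card ?t \<le> g * (2 * C * card (window V T g ?H))" by (simp only: mult_ac)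
  moreover have "0 < g" using g by simp
  ultimately have 4: "card ?t \<le> 2 * C * card (window V T g ?H)" using nat_mult_le_cancel1 by blast
  have "C * card ?X \<le> C * (card ?A + card ?B + (4 * b) ^ CARD('d) * card ?t)" using 1 by (rule mult_le_mono2)
  also have "\<dots> = C * card ?A + C * card ?B + C * ((4 * b) ^ CARD('d) * card ?t)" by (simp only: add_mult_distrib2)
  also have "\<dots> \<le> (C * (2 * ?G * card (window V T K (deg TYPE('d) * K + 1))) + card V) + C * (2 * card (window V T a ?H))
     + C * ((4 * b) ^ CARD('d) * (2 * C * card (window V T g ?H)))"
    using 2 3 4 by (intro add_mono mult_le_mono2) auto
  finally show ?thesis by (simp add: mult.assoc)
qed

subsection \<open>Translations\<close>

definition sh :: "'d::finite site \<Rightarrow> 'd site \<Rightarrow> 'd site" where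
  "sh x z = (\<lambda>i. z i + x i)"

definition neg :: "'d::finite site \<Rightarrow> 'd site" where
  "neg x = (\<lambda>i. - x i)"

abbreviation orig :: "'d::finite site" where
  "orig \<equiv> (\<lambda>_. 0)"

lemma sh_neg [simp]: "sh x (sh (neg x) z) = z" "sh (neg x) (sh x z) = z"
  by (auto simp: sh_def neg_def)

lemma sh_orig [simp]: "sh x orig = x" "sh (neg x) x = orig"
  by (auto simp: sh_def neg_def)

lemma nb_sh: "sh x w \<in> nb (sh x z) \<longleftrightarrow> w \<in> nb z"
  unfolding mem_nb adj_def norm1_def sh_def by simp

lemma nb_sh': "sh (neg x) w \<in> nb z \<longleftrightarrow> w \<in> nb (sh x z)"
  using nb_sh[of x "sh (neg x) w" z] by simp

definition tr_sh :: "'d::finite site \<Rightarrow> 'd site set \<Rightarrow> ('d site \<Rightarrow> 'd site) \<Rightarrow> 'd site \<Rightarrow> 'd site" where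
  "tr_sh x V T = (\<lambda>z. if sh x z \<in> V then sh (neg x) (T (sh x z)) else undefined)"

lemma up_sh: "up {z. sh x z \<in> V} (tr_sh x V T) k z = sh (neg x) (up V T k (sh x z))"
  by (induction k) (auto simp: up_Suc adv_def tr_sh_def)

lemma desc_sh: "desc {z. sh x z \<in> V} (tr_sh x V T) y = {z. sh x z \<in> desc V T (sh x y)}"
  unfolding desc_def up_sh by (auto; metis sh_neg)

lemma sz_sh: "sz {z. sh x z \<in> V} (tr_sh x V T) y = sz V T (sh x y)"
proof -
  have "desc V T (sh x y) = sh x ` {z. sh x z \<in> desc V T (sh x y)}"
    by (auto simp: image_iff; metis sh_neg)
  moreover have "inj_on (sh x) A" for A by (metis inj_onI sh_neg(2))
  ultimately show ?thesis unfolding desc_sh using card_image by metis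
qed

lemma tr_sh_TR:
  assumes fV: "finite V" and T: "T \<in> TR V"
  shows "tr_sh x V T \<in> TR {z. sh x z \<in> V}"
proof (rule wtree_TR)
  interpret wtree V T by (rule TR_wtree[OF fV T])
  let ?V = "{z. sh x z \<in> V}"
  show "wtree ?V (tr_sh x V T)"
  proof
    have "?V = sh (neg x) ` V" by (auto simp: image_iff; metis sh_neg)
    then show "finite ?V" using fV by simp
    show "tr_sh x V T z \<in> nb z" if "z \<in> ?V" for z using that nbT by (simp add: tr_sh_def nb_sh')
    show "\<exists>z\<in>F. tr_sh x V T z \<notin> F" if F: "F \<subseteq> ?V" "F \<noteq> {}" for F
    proof -
      obtain u where u: "u \<in> sh x ` F" "T u \<notin> sh x ` F" using acyc[of "sh x ` F"] F by auto
      then obtain z where z: "z \<in> F" "u = sh x z" by blast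
      have "tr_sh x V T z \<notin> F"
      proof
        assume "tr_sh x V T z \<in> F"
        then have "sh x (tr_sh x V T z) \<in> sh x ` F" by (rule imageI)
        then show False using u z F by (auto simp: tr_sh_def)
      qed
      then show ?thesis using z by blast
    qed
  qed
  show "tr_sh x V T \<in> extensional ?V" by (simp add: extensional_def tr_sh_def)
qed

lemma tr_sh_inv:
  assumes "T \<in> TR V" shows "tr_sh (neg x) {z. sh x z \<in> V} (tr_sh x V T) = T"
proof
  fix z
  have "neg (neg x) = x" by (simp add: neg_def)
  then show "tr_sh (neg x) {z. sh x z \<in> V} (tr_sh x V T) z = T z"
    using assms by (auto simp: tr_sh_def Rec_def PiE_def extensional_def)
qed

definition Qp :: "'d::finite site set \<Rightarrow> 'd site \<Rightarrow> nat \<Rightarrow> real" where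
  "Qp V x a = PT V {T. a \<le> sz V T x}"

lemma finite_sh: "finite V \<Longrightarrow> finite {z. sh x z \<in> V}"
proof -
  assume "finite V"
  moreover have "{z. sh x z \<in> V} = sh (neg x) ` V" by (auto simp: image_iff; metis sh_neg)
  ultimately show ?thesis by simp
qed

lemma Qp_sh:
  assumes fV: "finite V"
  shows "Qp V x a = Qp {z. sh x z \<in> V} orig a"
proof -
  let ?V = "{z. sh x z \<in> V}"
  have nn: "neg (neg x) = x" and VV: "{z. sh (neg x) z \<in> ?V} = V" by (auto simp: neg_def sh_def)
  have bij: "bij_betw (tr_sh x V) (TR V) (TR ?V)"
  proof (rule bij_betw_byWitness[where f' = "tr_sh (neg x) ?V"])
    show "\<forall>T\<in>TR V. tr_sh (neg x) ?V (tr_sh x V T) = T" using tr_sh_inv by blast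
    show "\<forall>T\<in>TR ?V. tr_sh x V (tr_sh (neg x) ?V T) = T" using tr_sh_inv[of _ ?V "neg x"] nn VV by simp
    show "tr_sh x V ` TR V \<subseteq> TR ?V" using tr_sh_TR[OF fV] by blast
    show "tr_sh (neg x) ?V ` TR ?V \<subseteq> TR V" using tr_sh_TR[OF finite_sh[OF fV], of _ x "neg x"] VV by auto
  qed
  then have c: "card (TR V) = card (TR ?V)" by (rule bij_betw_same_card)
  have "tr_sh x V ` (TR V \<inter> {T. a \<le> sz V T x}) = TR ?V \<inter> {T. a \<le> sz ?V T orig}"
  proof
    show "tr_sh x V ` (TR V \<inter> {T. a \<le> sz V T x}) \<subseteq> TR ?V \<inter> {T. a \<le> sz ?V T orig}"
      using tr_sh_TR[OF fV] sz_sh[of x V _ orig] by auto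
    show "TR ?V \<inter> {T. a \<le> sz ?V T orig} \<subseteq> tr_sh x V ` (TR V \<inter> {T. a \<le> sz V T x})"
    proof
      fix T' assume T': "T' \<in> TR ?V \<inter> {T. a \<le> sz ?V T orig}"
      then obtain T where "T \<in> TR V" "T' = tr_sh x V T" using bij unfolding bij_betw_def by blast
      then show "T' \<in> tr_sh x V ` (TR V \<inter> {T. a \<le> sz V T x})" using T' sz_sh[of x V T orig] by auto
    qed
  qed
  moreover have "inj_on (tr_sh x V) (TR V \<inter> {T. a \<le> sz V T x})" using bij unfolding bij_betw_def by (blast intro: inj_on_subset)
  ultimately have "card (TR V \<inter> {T. a \<le> sz V T x}) = card (TR ?V \<inter> {T. a \<le> sz ?V T orig})" using card_image by metis
  then show ?thesis unfolding Qp_def PT_def c by simp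
qed

lemma PT_nonneg: "0 \<le> PT V E"
  by (simp add: PT_def)

lemma PT_mono: "finite V \<Longrightarrow> (\<And>T. T \<in> TR V \<Longrightarrow> T \<in> E \<Longrightarrow> T \<in> E') \<Longrightarrow> PT V E \<le> PT V E'"
  unfolding PT_def by (intro divide_right_mono of_nat_mono card_mono) auto

lemma PT_cong: "(\<And>T. T \<in> TR V \<Longrightarrow> T \<in> E \<longleftrightarrow> T \<in> E') \<Longrightarrow> PT V E = PT V E'"
proof -
  assume "\<And>T. T \<in> TR V \<Longrightarrow> T \<in> E \<longleftrightarrow> T \<in> E'"
  then have "TR V \<inter> E = TR V \<inter> E'" by blast
  then show ?thesis by (simp add: PT_def)
qed

lemma PT_le_1: "finite V \<Longrightarrow> PT V E \<le> 1"
  unfolding PT_def using card_mono[of "TR V" "TR V \<inter> E"] card_TR_pos[of V] by (simp add: divide_le_eq)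

lemma PT_UN_le:
  assumes "finite V" "finite I" shows "PT V (\<Union>i\<in>I. E i) \<le> (\<Sum>i\<in>I. PT V (E i))"
proof -
  have "TR V \<inter> (\<Union>i\<in>I. E i) = (\<Union>i\<in>I. TR V \<inter> E i)" by auto
  then have "card (TR V \<inter> (\<Union>i\<in>I. E i)) \<le> (\<Sum>i\<in>I. card (TR V \<inter> E i))" using card_UN_le[OF assms(2), of "\<lambda>i. TR V \<inter> E i"] by simp
  then have "real (card (TR V \<inter> (\<Union>i\<in>I. E i))) \<le> (\<Sum>i\<in>I. real (card (TR V \<inter> E i)))" by (metis of_nat_mono of_nat_sum)
  then show ?thesis unfolding PT_def sum_divide_distrib[symmetric] by (intro divide_right_mono) auto
qed

lemma PT_UN_disjoint:
  assumes fV: "finite V" and "finite I" "disjoint_family_on E I"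
  shows "PT V (\<Union>i\<in>I. E i) = (\<Sum>i\<in>I. PT V (E i))"
proof -
  have "TR V \<inter> (\<Union>i\<in>I. E i) = (\<Union>i\<in>I. TR V \<inter> E i)" by auto
  moreover have "card (\<Union>i\<in>I. TR V \<inter> E i) = (\<Sum>i\<in>I. card (TR V \<inter> E i))"
    using assms by (intro card_UN_disjoint) (auto simp: disjoint_family_on_def)
  ultimately show ?thesis unfolding PT_def by (simp add: sum_divide_distrib)
qed

lemma PT_Compl: "finite V \<Longrightarrow> PT V (- E) = 1 - PT V E"
proof -
  assume fV: "finite V"
  have "card (TR V) = card (TR V \<inter> E) + card (TR V \<inter> - E)"
    using fV by (subst card_Un_disjoint[symmetric]) (auto intro: arg_cong[where f = card])
  then have "real (card (TR V \<inter> - E)) = real (card (TR V)) - real (card (TR V \<inter> E))" by simp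
  then show ?thesis unfolding PT_def using card_TR_pos[OF fV] by (simp add: diff_divide_distrib)
qed

subsection \<open>The number of descendants of a vertex\<close>

definition ball0 :: "nat \<Rightarrow> 'd::finite site set" where
  "ball0 a = {z. supd orig z \<le> int a}"

lemma finite_ball0: "finite (ball0 a :: 'd::finite site set)"
proof -
  have "(ball0 a :: 'd site set) = {z. \<forall>i. z i \<in> {- int a..int a}}" unfolding ball0_def supd_le_iff by (auto simp: abs_le_iff) (smt (verit))+
  also have "finite \<dots>" by (rule finite_box) simp
  finally show ?thesis .
qed

text \<open>A vertex \<open>k\<close> steps below the origin forces at least \<open>k + 1\<close>
  descendants, so a small branch lies in a bounded ball. Hence having fewer than \<open>a\<close>
  descendants is a finite union of core events.\<close>

definition small_sets :: "nat \<Rightarrow> 'd::finite site set set" where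
  "small_sets a = {W. W \<subseteq> ball0 a \<and> orig \<in> W \<and> card W < a}"

lemma supd_sym: "supd x y = supd y x"
  unfolding supd_def by (simp add: abs_minus_commute)

lemma (in wtree) desc_small:
  assumes "orig \<in> V" "s orig < a" shows "D orig \<in> small_sets a"
proof -
  have "D orig \<subseteq> ball0 a"
  proof
    fix z assume z: "z \<in> D orig"
    then obtain k where k: "upT k z = orig" "z \<in> V" by (auto simp: desc_def)
    have "k + 1 \<le> s orig" using sz_up[of k z] k assms by simp
    moreover have "supd z orig \<le> int k" using supd_up[of k z] k assms by simp
    ultimately show "z \<in> ball0 a" using assms supd_sym[of z orig] by (simp add: ball0_def)
  qed
  then show ?thesis using assms desc_self[of orig V T] by (simp add: small_sets_def)
qed

text \<open>Convergence for each fixed finite \<open>W\<close> allows mass to escape to infinity.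
  The limit of \<open>q\<close>, defined next, is the mass lost, and the aim is to show that it is
  zero.\<close>

locale core_limits =
  fixes p :: "'d::finite site set \<Rightarrow> real"
  assumes dim: "CARD('d) \<ge> 2"
    and lim: "\<And>W. finite W \<Longrightarrow> orig \<in> W \<Longrightarrow>
       ((\<lambda>V. PT V {T. desc V T orig = W}) \<longlongrightarrow> p W) (finite_subsets_at_top UNIV)"
begin

definition q :: "nat \<Rightarrow> real" where
  "q a = 1 - (\<Sum>W\<in>small_sets a. p W)"

lemma finite_small_sets: "finite (small_sets a :: 'd site set set)"
  by (rule finite_subset[of _ "Pow (ball0 a)"]) (auto simp: small_sets_def finite_ball0)

lemma Qp_eq:
  fixes V :: "'d site set"
  assumes fV: "finite V" and o: "orig \<in> V"
  shows "Qp V orig a = 1 - (\<Sum>W\<in>small_sets a. PT V {T. desc V T orig = W})"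
proof -
  have "PT V (\<Union>W\<in>small_sets a. {T. desc V T orig = W}) = PT V (- {T. a \<le> sz V T orig})"
  proof (rule PT_cong)
    fix T assume "T \<in> TR V"
    then interpret wtree V T by (rule TR_wtree[OF fV])
    have "(desc V T orig \<in> small_sets a) \<longleftrightarrow> \<not> a \<le> sz V T orig"
      using desc_small[OF o, of a] unfolding small_sets_def by (metis (no_types, lifting) mem_Collect_eq not_le)
    then show "(T \<in> (\<Union>W\<in>small_sets a. {T. desc V T orig = W})) \<longleftrightarrow> T \<in> - {T. a \<le> sz V T orig}" by auto
  qed
  also have "\<dots> = 1 - Qp V orig a" unfolding Qp_def by (rule PT_Compl[OF fV])
  finally show ?thesis using PT_UN_disjoint[OF fV finite_small_sets, of "\<lambda>W. {T. desc V T orig = W}" a]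
    by (simp add: disjoint_family_on_def Int_def)
qed

lemma Qp_lim: "((\<lambda>V :: 'd site set. Qp V orig a) \<longlongrightarrow> q a) (finite_subsets_at_top UNIV)"
proof -
  have "((\<lambda>V :: 'd site set. 1 - (\<Sum>W\<in>small_sets a. PT V {T. desc V T orig = W})) \<longlongrightarrow> q a) (finite_subsets_at_top UNIV)"
    unfolding q_def
  proof (intro tendsto_diff tendsto_const tendsto_sum lim)
    fix W :: "'d site set" assume "W \<in> small_sets a"
    then have W: "W \<subseteq> ball0 a" "orig \<in> W" by (auto simp: small_sets_def)
    show "finite W" by (rule finite_subset[OF W(1) finite_ball0])
    show "orig \<in> W" by (rule W(2))
  qed
  moreover have "\<forall>\<^sub>F V :: 'd site set in finite_subsets_at_top UNIV. 1 - (\<Sum>W\<in>small_sets a. PT V {T. desc V T orig = W}) = Qp V orig a"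
    unfolding eventually_finite_subsets_at_top
    by (intro exI[of _ "{orig}"]) (auto simp: Qp_eq)
  ultimately show ?thesis by (rule Lim_transform_eventually)
qed

lemma ev_finite: "\<forall>\<^sub>F V in finite_subsets_at_top UNIV. finite (V :: 'd site set)"
  unfolding eventually_finite_subsets_at_top by (intro exI[of _ "{}"]) auto

lemma q_antimono: "a \<le> a' \<Longrightarrow> q a' \<le> q a"
proof (rule tendsto_le[OF _ Qp_lim Qp_lim])
  assume "a \<le> a'"
  then have "Qp V orig a' \<le> Qp V orig a" if "finite V" for V :: "'d site set"
    unfolding Qp_def using that by (intro PT_mono) auto
  then show "\<forall>\<^sub>F V :: 'd site set in finite_subsets_at_top UNIV. Qp V orig a' \<le> Qp V orig a"
    by (rule eventually_mono[OF ev_finite])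
qed simp

lemma q_nonneg: "0 \<le> q a"
  by (rule tendsto_lowerbound[OF Qp_lim]) (auto simp: Qp_def PT_nonneg)

text \<open>Translating \<open>x\<close> to the origin turns convergence at the origin into a bound
  that is uniform over all sites at distance more than \<open>R\<close> from the complement of
  \<open>V\<close>.\<close>

lemma Qp_close:
  assumes "0 < e" "finite A"
  shows "\<exists>R. \<forall>(V :: 'd site set) x a. finite V \<longrightarrow> (\<forall>z. supd x z \<le> int R \<longrightarrow> z \<in> V) \<longrightarrow> a \<in> A \<longrightarrow> \<bar>Qp V x a - q a\<bar> \<le> e"
proof -
  have "\<forall>\<^sub>F V :: 'd site set in finite_subsets_at_top UNIV. \<forall>a\<in>A. \<bar>Qp V orig a - q a\<bar> < e"
    using tendstoD[OF Qp_lim assms(1)] assms(2) by (intro eventually_ball_finite) (auto simp: dist_real_def)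
  then obtain X :: "'d site set" where X: "finite X" "\<And>V. finite V \<Longrightarrow> X \<subseteq> V \<Longrightarrow> \<forall>a\<in>A. \<bar>Qp V orig a - q a\<bar> < e"
    unfolding eventually_finite_subsets_at_top by auto
  define R where "R = nat (Max (insert 0 (supd orig ` X)))"
  have R: "supd orig z \<le> int R" if "z \<in> X" for z
  proof -
    have "supd orig z \<le> Max (insert 0 (supd orig ` X))" using that X(1) by (intro Max_ge) auto
    then show ?thesis unfolding R_def by simp
  qed
  show ?thesis
  proof (intro exI[of _ R] allI impI)
    fix V :: "'d site set" and x a assume V: "finite V" "\<forall>z. supd x z \<le> int R \<longrightarrow> z \<in> V" "a \<in> A"
    have "X \<subseteq> {z. sh x z \<in> V}"
    proof
      fix z assume "z \<in> X"
      moreover have "supd x (sh x z) = supd orig z" by (simp add: supd_def sh_def)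
      ultimately show "z \<in> {z. sh x z \<in> V}" using V R by simp
    qed
    then show "\<bar>Qp V x a - q a\<bar> \<le> e" using X(2)[OF finite_sh[OF V(1)]] V(3) Qp_sh[OF V(1), of x a] by (simp add: less_imp_le)
  qed
qed

end

subsection \<open>Averages over boxes\<close>

definition boxV :: "nat \<Rightarrow> 'd::finite site set" where
  "boxV n = {z. \<forall>i. z i \<in> {0..<int n}}"

definition innerV :: "nat \<Rightarrow> nat \<Rightarrow> 'd::finite site set" where
  "innerV n R = {z. \<forall>i. z i \<in> {int R..<int n - int R}}"

lemma finite_boxV [simp]: "finite (boxV n)"
  unfolding boxV_def by (rule finite_box) simp

lemma finite_innerV [simp]: "finite (innerV n R)"
  unfolding innerV_def by (rule finite_box) simp

lemma card_boxV: "card (boxV n :: 'd::finite site set) = n ^ CARD('d)"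
  unfolding boxV_def card_box by simp

lemma card_innerV: "2 * R \<le> n \<Longrightarrow> card (innerV n R :: 'd::finite site set) = (n - 2 * R) ^ CARD('d)"
proof -
  assume "2 * R \<le> n"
  then have "nat (int n - int R - int R) = n - 2 * R" by linarith
  then show ?thesis unfolding innerV_def card_box by simp
qed

lemma innerV_sub: "innerV n R \<subseteq> boxV n"
proof
  fix z :: "'a site" assume z: "z \<in> innerV n R"
  have "z i \<in> {0..<int n}" for i
  proof -
    have "z i \<in> {int R..<int n - int R}" using z by (simp add: innerV_def)
    then show ?thesis by auto
  qed
  then show "z \<in> boxV n" by (simp add: boxV_def)
qed

lemma innerV_ball: "x \<in> innerV n R \<Longrightarrow> supd x z \<le> int R \<Longrightarrow> z \<in> boxV n"
proof -
  assume x: "x \<in> innerV n R" and z: "supd x z \<le> int R"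
  have "z i \<in> {0..<int n}" for i
  proof -
    have "\<bar>z i - x i\<bar> \<le> int R" "x i \<in> {int R..<int n - int R}" using x z by (auto simp: innerV_def supd_le_iff)
    then show ?thesis by auto
  qed
  then show ?thesis by (simp add: boxV_def)
qed

lemma cube_supd: "b \<ge> 1 \<Longrightarrow> z \<in> cube b x \<Longrightarrow> supd x z \<le> int (4 * b)"
proof -
  assume b: "b \<ge> 1" and z: "z \<in> cube b x"
  have "\<bar>z i - x i\<bar> \<le> int (4 * b)" for i
  proof -
    let ?I = "{int (4 * b) * (x i div int (4 * b))..<int (4 * b) * (x i div int (4 * b)) + int (4 * b)}"
    have "z i \<in> ?I" using z unfolding cube_box[OF b] by blast
    moreover have "x i \<in> ?I" using cube_box[OF b, of x] unfolding cube_def by blast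
    ultimately show ?thesis by (smt (verit) atLeastLessThan_iff)
  qed
  then show ?thesis by (simp add: supd_le_iff)
qed

lemma innerV_boundary:
  assumes "0 < eta" "2 * R \<le> n" "real CARD('d) * (2 * real R) \<le> eta * real n" "1 \<le> n"
  shows "real (card (boxV n - innerV n R :: 'd::finite site set)) \<le> eta * real n ^ CARD('d)"
proof -
  let ?d = "CARD('d)"
  have "real (card (boxV n - innerV n R :: 'd site set)) = real n ^ ?d - (real n - 2 * real R) ^ ?d"
    using assms(2)
    by (simp add: card_Diff_subset[OF finite_innerV innerV_sub] card_boxV card_innerV of_nat_diff power_mono)
  also have "\<dots> = real n ^ ?d * (1 - (1 + - (2 * real R / real n)) ^ ?d)"
  proof -
    have e: "real n - 2 * real R = real n * (1 + - (2 * real R / real n))" using assms(4) by (simp add: field_simps)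
    show ?thesis unfolding e power_mult_distrib by (simp add: algebra_simps)
  qed
  also have "\<dots> \<le> real n ^ ?d * (real ?d * (2 * real R / real n))"
  proof (rule mult_left_mono)
    have "-1 \<le> - (2 * real R / real n)" using assms(2,4) by (simp add: divide_le_eq)
    from Bernoulli_inequality[OF this, of ?d]
    show "1 - (1 + - (2 * real R / real n)) ^ ?d \<le> real ?d * (2 * real R / real n)" by simp
  qed simp
  also have "\<dots> \<le> real n ^ ?d * eta" using assms by (intro mult_left_mono) (auto simp: field_simps)
  finally show ?thesis by (simp add: mult.commute)
qed

text \<open>Per coordinate, half of the residues modulo \<open>4 * b\<close> are middle, and since
  \<open>4 * q0 \<le> N\<close> at least half of the tiles remain after removing \<open>q0\<close>
  at each end. This gives a quarter per coordinate.\<close>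

lemma card_middle_inner:
  assumes b: "1 \<le> b" and N: "4 * q0 \<le> N" and n: "n = 4 * b * N" and R: "R = 4 * b * q0"
  shows "real n ^ CARD('d) / 4 ^ CARD('d) \<le> real (card {x :: 'd::finite site. x \<in> innerV n R \<and> middle b x})"
proof -
  let ?f = "\<lambda>(k, m). int (4 * b) * k + m"
  let ?P = "{int q0..<int N - int q0} \<times> {int b..<int (3 * b)}"
  \<comment> \<open>The admissible values of a single coordinate, written as tile index and
    residue.\<close>
  define Z where "Z = ?f ` ?P"
  have dm: "(int (4 * b) * k + m) div int (4 * b) = k" "(int (4 * b) * k + m) mod int (4 * b) = m" if "m \<in> {int b..<int (3 * b)}" for k m
  proof -
    have m: "0 \<le> m" "m < int (4 * b)" using that by auto
    show "(int (4 * b) * k + m) div int (4 * b) = k" by (rule int_div_pos_eq[of _ _ _ m]) (use m in auto)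
    show "(int (4 * b) * k + m) mod int (4 * b) = m" by (rule int_mod_pos_eq[of _ _ k]) (use m in auto)
  qed
  have "inj_on ?f ?P"
  proof (rule inj_onI)
    fix u v assume uv: "u \<in> ?P" "v \<in> ?P" "?f u = ?f v"
    obtain k m k' m' where e: "u = (k, m)" "v = (k', m')" by (cases u; cases v)
    have "m \<in> {int b..<int (3 * b)}" "m' \<in> {int b..<int (3 * b)}" "int (4 * b) * k + m = int (4 * b) * k' + m'" using uv e by auto
    then have "k = k'" "m = m'" using dm[of m k] dm[of m' k'] by metis+
    then show "u = v" using e by simp
  qed
  then have "card Z = card ?P" unfolding Z_def by (rule card_image)
  also have "\<dots> = (N - 2 * q0) * (2 * b)" 
  proof -
    have "nat (int N - int q0 - int q0) = N - 2 * q0" "nat (int (3 * b) - int b) = 2 * b" by linarith+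
    then show ?thesis by (simp only: card_cartesian_product card_atLeastLessThan_int)
  qed
  finally have cZ: "card Z = (N - 2 * q0) * (2 * b)" .
  have fZ: "finite Z" unfolding Z_def by simp
  have Z: "t \<in> {int R..<int n - int R} \<and> int b \<le> t mod int (4 * b) \<and> t mod int (4 * b) < int (3 * b)" if tZ: "t \<in> Z" for t
  proof -
    obtain u where "u \<in> ?P" "t = ?f u" using tZ unfolding Z_def by blast
    then obtain k m where t: "t = int (4 * b) * k + m" "int q0 \<le> k" "k < int N - int q0" "m \<in> {int b..<int (3 * b)}"
      by (cases u) auto
    have 1: "int (4 * b) * int q0 \<le> int (4 * b) * k" using t by (intro mult_left_mono) auto
    have 2: "int (4 * b) * (k + 1) \<le> int (4 * b) * (int N - int q0)" using t by (intro mult_left_mono) auto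
    have m: "0 \<le> m" "m < int (4 * b)" using t(4) by auto
    have 3: "int R = int (4 * b) * int q0" "int n - int R = int (4 * b) * (int N - int q0)"
      unfolding n R by (simp_all add: right_diff_distrib)
    have "int (4 * b) * (k + 1) = int (4 * b) * k + int (4 * b)" by (rule distrib_left[of _ k 1, simplified mult_1_right])
    then have "int R \<le> t" "t < int n - int R" using 1 2 m 3 unfolding t(1) by linarith+
    then show ?thesis using dm(2)[OF t(4), of k] t(1,4) by auto
  qed
  have "b * N \<le> (N - 2 * q0) * (2 * b)"
  proof -
    have "N \<le> (N - 2 * q0) * 2" using N by linarith
    then have "b * N \<le> b * ((N - 2 * q0) * 2)" by (rule mult_le_mono2)
    then show ?thesis by (simp add: mult.commute mult.left_commute)
  qed
  then have "(b * N) ^ CARD('d) \<le> card {x :: 'd site. \<forall>i. x i \<in> Z}"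
    unfolding card_box by (simp add: cZ power_mono)
  also have "\<dots> \<le> card {x :: 'd site. x \<in> innerV n R \<and> middle b x}"
    using Z by (intro card_mono) (auto simp: innerV_def middle_def intro: finite_subset[OF _ finite_innerV[of n R]])
  finally have "real ((b * N) ^ CARD('d)) \<le> real (card {x :: 'd site. x \<in> innerV n R \<and> middle b x})" by (simp only: of_nat_le_iff)
  moreover have "real ((b * N) ^ CARD('d)) = real n ^ CARD('d) / 4 ^ CARD('d)"
    unfolding n by (simp add: power_mult_distrib)
  ultimately show ?thesis by simp
qed

lemma sum_card_swap:
  fixes A :: "'c set" and B :: "'d set"
  assumes "finite A" "finite B"
  shows "(\<Sum>T\<in>A. card {x \<in> B. P T x}) = (\<Sum>x\<in>B. card {T \<in> A. P T x})"
proof -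
  have c: "card {y \<in> S. Q y} = (\<Sum>y\<in>S. if Q y then 1 else 0)" if "finite S" for S :: "'c set" and Q
    using that by (simp add: sum.If_cases Int_def)
  have c': "card {y \<in> S. Q y} = (\<Sum>y\<in>S. if Q y then 1 else 0)" if "finite S" for S :: "'d set" and Q
    using that by (simp add: sum.If_cases Int_def)
  show ?thesis unfolding c[OF assms(1)] c'[OF assms(2)] by (rule sum.swap)
qed

definition EW :: "'d::finite site set \<Rightarrow> nat \<Rightarrow> nat \<Rightarrow> real" where
  "EW V a h = (\<Sum>T\<in>TR V. real (card (window V T a h))) / real (card (TR V))"

lemma EW_eq:
  assumes "finite V"
  shows "EW V a h = (\<Sum>x\<in>V. PT V {T. a \<le> sz V T x \<and> sz V T x \<le> h})"
proof -
  have "(\<Sum>T\<in>TR V. card (window V T a h)) = (\<Sum>x\<in>V. card {T \<in> TR V. a \<le> sz V T x \<and> sz V T x \<le> h})"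
    unfolding window_def using assms by (intro sum_card_swap) auto
  then have "(\<Sum>T\<in>TR V. real (card (window V T a h))) = (\<Sum>x\<in>V. real (card {T \<in> TR V. a \<le> sz V T x \<and> sz V T x \<le> h}))"
    by (simp only: of_nat_sum[symmetric])
  then show ?thesis unfolding EW_def PT_def by (simp add: sum_divide_distrib Int_def)
qed

lemma PT_window:
  assumes fV: "finite V" and ah: "a \<le> h + 1"
  shows "PT V {T. a \<le> sz V T x \<and> sz V T x \<le> h} = Qp V x a - Qp V x (h + 1)"
proof -
  have "TR V \<inter> {T. a \<le> sz V T x} = (TR V \<inter> {T. a \<le> sz V T x \<and> sz V T x \<le> h}) \<union> (TR V \<inter> {T. h + 1 \<le> sz V T x})"
    using ah by auto
  then have "card (TR V \<inter> {T. a \<le> sz V T x}) = card (TR V \<inter> {T. a \<le> sz V T x \<and> sz V T x \<le> h}) + card (TR V \<inter> {T. h + 1 \<le> sz V T x})"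
    using fV by (simp only:) (subst card_Un_disjoint, auto)
  then show ?thesis unfolding Qp_def PT_def by (simp add: add_divide_distrib)
qed

context core_limits
begin

text \<open>At an inner site the probability of the window is \<open>q a - q (h + 1)\<close> up to
  \<open>2 * e\<close>, and \<open>q (h + 1)\<close> is at least \<open>ql\<close>; a boundary site
  contributes at most 1.\<close>

lemma EW_bound:
  assumes R: "\<And>(V :: 'd site set) x a. finite V \<Longrightarrow> (\<forall>z. supd x z \<le> int R \<longrightarrow> z \<in> V) \<Longrightarrow> a \<in> A \<Longrightarrow> \<bar>Qp V x a - q a\<bar> \<le> e"
    and A: "a \<in> A" "h + 1 \<in> A" and ah: "a \<le> h + 1" and ql: "\<And>a. ql \<le> q a" and e: "0 \<le> e"
    and bd: "real (card (boxV n - innerV n R :: 'd site set)) \<le> eta * real n ^ CARD('d)"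
  shows "EW (boxV n :: 'd site set) a h \<le> (eta + (q a - ql) + 2 * e) * real n ^ CARD('d)"
proof -
  let ?V = "boxV n :: 'd site set" and ?I = "innerV n R :: 'd site set"
  let ?P = "\<lambda>x. PT ?V {T. a \<le> sz ?V T x \<and> sz ?V T x \<le> h}"
  have "EW ?V a h = (\<Sum>x\<in>?V - ?I. ?P x) + (\<Sum>x\<in>?I. ?P x)"
    unfolding EW_eq[OF finite_boxV] by (rule sum.subset_diff[OF innerV_sub finite_boxV])
  also have "(\<Sum>x\<in>?V - ?I. ?P x) \<le> (\<Sum>x\<in>?V - ?I. 1)" by (intro sum_mono PT_le_1 finite_boxV)
  also have "(\<Sum>x\<in>?I. ?P x) \<le> (\<Sum>x\<in>?I. q a - ql + 2 * e)"
  proof (rule sum_mono)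
    fix x assume x: "x \<in> ?I"
    have "\<bar>Qp ?V x a - q a\<bar> \<le> e" "\<bar>Qp ?V x (h + 1) - q (h + 1)\<bar> \<le> e"
      using R[of ?V x a] R[of ?V x "h + 1"] A innerV_ball[OF x] by auto
    then show "?P x \<le> q a - ql + 2 * e" unfolding PT_window[OF finite_boxV ah] using ql[of "h + 1"] by linarith
  qed
  finally have 1: "EW ?V a h \<le> real (card (?V - ?I)) + real (card ?I) * (q a - ql + 2 * e)" by simp
  have "card ?I \<le> card ?V" by (intro card_mono innerV_sub finite_boxV)
  then have "real (card ?I) \<le> real n ^ CARD('d)" unfolding card_boxV by (metis of_nat_mono of_nat_power)
  moreover have "0 \<le> q a - ql + 2 * e" using ql[of a] e by simp
  ultimately have "real (card ?I) * (q a - ql + 2 * e) \<le> real n ^ CARD('d) * (q a - ql + 2 * e)" by (rule mult_right_mono)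
  then show ?thesis using 1 bd by (simp add: algebra_simps)
qed

text \<open>Both sides concern the number of pairs of a tree and a middle inner site with at least
  \<open>K\<close> descendants, per tree and site of the box. The terms on the right bound, in this
  order, the nice pairs, overweight side branches, leaves and branch points of the trunk, long
  bushes, and cubes containing a tip.\<close>

lemma box_inequality:
  fixes b C g a K N q0 :: nat
  defines "n \<equiv> 4 * b * N" and "R \<equiv> 4 * b * q0"
  assumes R: "\<And>(V :: 'd site set) x a. finite V \<Longrightarrow> (\<forall>z. supd x z \<le> int R \<longrightarrow> z \<in> V) \<Longrightarrow> a \<in> A \<Longrightarrow> \<bar>Qp V x a - q a\<bar> \<le> e"
    and A: "{a, g, K, C * (2 * g) + 1, deg TYPE('d) * K + 2} \<subseteq> A"
    and ql: "\<And>a. ql \<le> q a" and e: "0 \<le> e"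
    and b: "2 \<le> b" and C: "1 \<le> C" and g: "1 \<le> g" and a: "1 \<le> a" "a \<le> g" and K: "C * (2 * g) < K" "(4 * b) ^ CARD('d) < K"
    and N: "4 * q0 \<le> N" "1 \<le> q0"
    and bd: "real (card (boxV n - innerV n R :: 'd site set)) \<le> eta * real n ^ CARD('d)"
  shows "(ql - e) / 4 ^ CARD('d) \<le> real ((8 * a) ^ CARD('d) * deg TYPE('d)) / real (b - 1) + 1 / real C
     + 4 * real g * (eta + (q K - ql) + 2 * e) + 2 * (eta + (q a - ql) + 2 * e)
     + real ((4 * b) ^ CARD('d) * (2 * C)) * (eta + (q g - ql) + 2 * e)"
proof -
  let ?V = "boxV n :: 'd site set" and ?H = "C * (2 * g)" and ?G = "2 * g"
  let ?t = "real (card (TR ?V))"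
  have tp: "?t > 0" using card_TR_pos[OF finite_boxV] by simp
  have b1: "1 \<le> b" using b by simp
  have n0: "real n ^ CARD('d) > 0" unfolding n_def using b N by simp
  let ?mid = "{x :: 'd site. x \<in> innerV n R \<and> middle b x}"
  have midV: "?mid \<subseteq> ?V" using innerV_sub[of n R] by blast
  then have fmid: "finite ?mid" by (rule finite_subset) simp
  have cubeV: "cube b x \<subseteq> ?V" if "x \<in> ?mid" for x
  proof
    fix z assume "z \<in> cube b x"
    then have "supd x z \<le> int (4 * b)" by (rule cube_supd[OF b1])
    also have "\<dots> \<le> int R" unfolding R_def using N b by simp
    finally show "z \<in> ?V" using innerV_ball that by blast
  qed
  let ?nice = "\<lambda>T x. nice ?V b K ?G ?H (2 * a) T x"
  let ?N = "{pq \<in> pairs ?V K. middle b (snd pq) \<and> cube b (snd pq) \<subseteq> ?V \<and> ?nice (fst pq) (snd pq)}"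
  have split: "card {x \<in> ?mid. K \<le> sz ?V T x} \<le> card {x \<in> ?mid. K \<le> sz ?V T x \<and> ?nice T x} + card {x \<in> ?V. K \<le> sz ?V T x \<and> \<not> ?nice T x}" for T
  proof -
    have "card {x \<in> ?mid. K \<le> sz ?V T x} \<le> card ({x \<in> ?mid. K \<le> sz ?V T x \<and> ?nice T x} \<union> {x \<in> ?V. K \<le> sz ?V T x \<and> \<not> ?nice T x})"
      using midV fmid by (intro card_mono) auto
    then show ?thesis using card_Un_le order_trans by blast
  qed
  have "(\<Sum>T\<in>TR ?V. card {x \<in> ?mid. K \<le> sz ?V T x \<and> ?nice T x}) = card (SIGMA T:TR ?V. {x \<in> ?mid. K \<le> sz ?V T x \<and> ?nice T x})"
    using fmid by (simp add: card_SigmaI)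
  also have "\<dots> \<le> card ?N" 
  proof (rule card_mono)
    show "finite ?N" by (rule finite_subset[OF _ finite_pairs[OF finite_boxV]]) auto
    show "(SIGMA T:TR ?V. {x \<in> ?mid. K \<le> sz ?V T x \<and> ?nice T x}) \<subseteq> ?N"
    proof
      fix u assume u: "u \<in> (SIGMA T:TR ?V. {x \<in> ?mid. K \<le> sz ?V T x \<and> ?nice T x})"
      then have m: "snd u \<in> ?mid" by auto
      then have "snd u \<in> ?V" "cube b (snd u) \<subseteq> ?V" using midV cubeV[OF m] by blast+
      then show "u \<in> ?N" using u by (auto simp: pairs_def)
    qed
  qed
  finally have cN: "(\<Sum>T\<in>TR ?V. card {x \<in> ?mid. K \<le> sz ?V T x \<and> ?nice T x}) \<le> card ?N" .
  have "(b - 1) * card ?N \<le> (4 * (2 * a)) ^ CARD('d) * deg TYPE('d) * card (pairs ?V K)"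
    by (rule card_nice_middle[OF dim finite_boxV b1 _ _ K(2)]) (use a g in auto)
  also have "card (pairs ?V K) \<le> card (TR ?V \<times> ?V)" by (intro card_mono) (auto simp: pairs_def)
  also have "\<dots> = card (TR ?V) * n ^ CARD('d)" by (simp add: card_cartesian_product card_boxV)
  finally have "(b - 1) * card ?N \<le> (8 * a) ^ CARD('d) * deg TYPE('d) * (card (TR ?V) * n ^ CARD('d))" by simp
  then have "real ((b - 1) * card ?N) \<le> real ((8 * a) ^ CARD('d) * deg TYPE('d) * (card (TR ?V) * n ^ CARD('d)))" by (simp only: of_nat_le_iff)
  then have N2: "real (card ?N) \<le> real ((8 * a) ^ CARD('d) * deg TYPE('d)) / real (b - 1) * (?t * real n ^ CARD('d))"
    using b by (simp add: field_simps)
  have notn: "real (card {x \<in> ?V. K \<le> sz ?V T x \<and> \<not> ?nice T x}) \<le> 1 / real C * real n ^ CARD('d)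
      + 4 * real g * real (card (window ?V T K (deg TYPE('d) * K + 1))) + 2 * real (card (window ?V T a ?H))
      + real ((4 * b) ^ CARD('d) * (2 * C)) * real (card (window ?V T g ?H))" if T: "T \<in> TR ?V" for T
  proof -
    interpret wtree ?V T by (rule TR_wtree[OF finite_boxV T])
    have "real (C * card {x \<in> ?V. K \<le> sz ?V T x \<and> \<not> ?nice T x}) \<le> real (card ?V + C * (4 * g * card (window ?V T K (deg TYPE('d) * K + 1)))
      + C * (2 * card (window ?V T a ?H)) + C * ((4 * b) ^ CARD('d) * (2 * C * card (window ?V T g ?H))))"
      using card_not_nice[OF b1 C g a(1) K(1)] by (simp only: of_nat_le_iff)
    moreover have "real C > 0" using C by simp
    ultimately show ?thesis unfolding card_boxV by (simp add: field_simps)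
  qed
  have low: "?t * (real n ^ CARD('d) / 4 ^ CARD('d) * (ql - e)) \<le> (\<Sum>T\<in>TR ?V. real (card {x \<in> ?mid. K \<le> sz ?V T x}))" if qe: "0 \<le> ql - e"
  proof -
    have "(\<Sum>T\<in>TR ?V. card {x \<in> ?mid. K \<le> sz ?V T x}) = (\<Sum>x\<in>?mid. card {T \<in> TR ?V. K \<le> sz ?V T x})"
      by (rule sum_card_swap) (use fmid in auto)
    then have "(\<Sum>T\<in>TR ?V. real (card {x \<in> ?mid. K \<le> sz ?V T x})) = (\<Sum>x\<in>?mid. real (card {T \<in> TR ?V. K \<le> sz ?V T x}))"
      by (simp only: of_nat_sum[symmetric])
    also have "\<dots> = (\<Sum>x\<in>?mid. ?t * Qp ?V x K)"
    proof (rule sum.cong[OF refl])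
      fix x
      have ne: "?t \<noteq> 0" using tp by linarith
      have "TR ?V \<inter> {T. K \<le> sz ?V T x} = {T \<in> TR ?V. K \<le> sz ?V T x}" by blast
      then show "real (card {T \<in> TR ?V. K \<le> sz ?V T x}) = ?t * Qp ?V x K"
        unfolding Qp_def PT_def by (simp only: times_divide_eq_right nonzero_mult_div_cancel_left[OF ne])
    qed
    also have "\<dots> \<ge> (\<Sum>x\<in>?mid. ?t * (ql - e))"
    proof (intro sum_mono mult_left_mono)
      fix x assume x: "x \<in> ?mid"
      have "\<bar>Qp ?V x K - q K\<bar> \<le> e" using R[of ?V x K] A innerV_ball x by auto
      then show "ql - e \<le> Qp ?V x K" using ql[of K] by linarith
    qed simp
    finally have "real (card ?mid) * (?t * (ql - e)) \<le> (\<Sum>T\<in>TR ?V. real (card {x \<in> ?mid. K \<le> sz ?V T x}))" by simp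
    moreover have "real n ^ CARD('d) / 4 ^ CARD('d) * (?t * (ql - e)) \<le> real (card ?mid) * (?t * (ql - e))"
      using qe by (intro mult_right_mono card_middle_inner[OF b1 N(1)]) (auto simp: n_def R_def)
    ultimately show ?thesis by (simp add: mult.commute mult.left_commute)
  qed
  have E1: "EW ?V K (deg TYPE('d) * K + 1) \<le> (eta + (q K - ql) + 2 * e) * real n ^ CARD('d)"
  proof (rule EW_bound[OF R _ _ _ ql e bd])
    have "1 * K \<le> deg TYPE('d) * K" using dim by (intro mult_le_mono1) simp
    then show "K \<le> deg TYPE('d) * K + 1 + 1" by linarith
    show "deg TYPE('d) * K + 1 + 1 \<in> A" using A by (simp add: numeral_2_eq_2)
  qed (use A in auto)
  have E2: "EW ?V a ?H \<le> (eta + (q a - ql) + 2 * e) * real n ^ CARD('d)"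
  proof (rule EW_bound[OF R _ _ _ ql e bd])
    have "a \<le> 1 * (2 * g)" using a by simp
    also have "\<dots> \<le> ?H" using C by (rule mult_le_mono1)
    finally show "a \<le> ?H + 1" by (rule trans_le_add1)
  qed (use A in auto)
  have E3: "EW ?V g ?H \<le> (eta + (q g - ql) + 2 * e) * real n ^ CARD('d)"
  proof (rule EW_bound[OF R _ _ _ ql e bd])
    have "g \<le> 1 * (2 * g)" by simp
    also have "\<dots> \<le> ?H" using C by (rule mult_le_mono1)
    finally show "g \<le> ?H + 1" by (rule trans_le_add1)
  qed (use A in auto)
  have W: "(\<Sum>T\<in>TR ?V. real (card (window ?V T u v))) = ?t * EW ?V u v" for u v
    unfolding EW_def using tp by simp
  let ?nd = "real n ^ CARD('d)"
  let ?rhs = "real ((8 * a) ^ CARD('d) * deg TYPE('d)) / real (b - 1) + 1 / real C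
     + 4 * real g * (eta + (q K - ql) + 2 * e) + 2 * (eta + (q a - ql) + 2 * e)
     + real ((4 * b) ^ CARD('d) * (2 * C)) * (eta + (q g - ql) + 2 * e)"
  have "(\<Sum>T\<in>TR ?V. real (card {x \<in> ?mid. K \<le> sz ?V T x}))
     \<le> (\<Sum>T\<in>TR ?V. real (card {x \<in> ?mid. K \<le> sz ?V T x \<and> ?nice T x}) + real (card {x \<in> ?V. K \<le> sz ?V T x \<and> \<not> ?nice T x}))"
  proof (rule sum_mono)
    fix T
    show "real (card {x \<in> ?mid. K \<le> sz ?V T x}) \<le> real (card {x \<in> ?mid. K \<le> sz ?V T x \<and> ?nice T x})
       + real (card {x \<in> ?V. K \<le> sz ?V T x \<and> \<not> ?nice T x})"
      using split[of T] by (simp only: of_nat_add[symmetric] of_nat_le_iff)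
  qed
  also have "\<dots> = real (\<Sum>T\<in>TR ?V. card {x \<in> ?mid. K \<le> sz ?V T x \<and> ?nice T x}) + (\<Sum>T\<in>TR ?V. real (card {x \<in> ?V. K \<le> sz ?V T x \<and> \<not> ?nice T x}))"
    by (simp add: sum.distrib)
  also have "\<dots> \<le> real (card ?N) + (\<Sum>T\<in>TR ?V. 1 / real C * ?nd
      + 4 * real g * real (card (window ?V T K (deg TYPE('d) * K + 1))) + 2 * real (card (window ?V T a ?H))
      + real ((4 * b) ^ CARD('d) * (2 * C)) * real (card (window ?V T g ?H)))"
    using cN notn by (intro add_mono sum_mono) (simp_all only: of_nat_le_iff)
  also have "\<dots> = real (card ?N) + (?t * (1 / real C * ?nd) + 4 * real g * (?t * EW ?V K (deg TYPE('d) * K + 1))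
      + 2 * (?t * EW ?V a ?H) + real ((4 * b) ^ CARD('d) * (2 * C)) * (?t * EW ?V g ?H))"
    unfolding W[symmetric] by (simp only: sum.distrib sum_distrib_left[symmetric] sum_constant mult.left_commute)
  also have "\<dots> \<le> real ((8 * a) ^ CARD('d) * deg TYPE('d)) / real (b - 1) * (?t * ?nd)
      + (?t * (1 / real C * ?nd) + 4 * real g * (?t * ((eta + (q K - ql) + 2 * e) * ?nd))
      + 2 * (?t * ((eta + (q a - ql) + 2 * e) * ?nd)) + real ((4 * b) ^ CARD('d) * (2 * C)) * (?t * ((eta + (q g - ql) + 2 * e) * ?nd)))"
    using N2 E1 E2 E3 tp by (intro add_mono mult_left_mono) auto
  also have "\<dots> = ?t * ?nd * ?rhs"
  proof -
    have "M * (t * m) + (t * (c * m) + u * (t * (x * m)) + v * (t * (y * m)) + w * (t * (z * m)))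
      = t * m * (M + c + u * x + v * y + w * z)" for M t m c u v w x y z :: real
      by (simp add: algebra_simps)
    then show ?thesis .
  qed
  finally have up: "(\<Sum>T\<in>TR ?V. real (card {x \<in> ?mid. K \<le> sz ?V T x})) \<le> ?t * ?nd * ?rhs" .
  show ?thesis
  proof (cases "0 \<le> ql - e")
    case True
    have "?t * ?nd * ((ql - e) / 4 ^ CARD('d)) \<le> ?t * ?nd * ?rhs"
      using order_trans[OF low[OF True] up] by simp
    then show ?thesis using tp n0 by (simp only: mult_le_cancel_left_pos mult_pos_pos)
  next
    case False
    have "0 \<le> (\<Sum>T\<in>TR ?V. real (card {x \<in> ?mid. K \<le> sz ?V T x}))" by (intro sum_nonneg) simp
    then have "0 \<le> ?t * ?nd * ?rhs" using up by linarith
    moreover have "0 < ?t * ?nd" using tp n0 by (rule mult_pos_pos)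
    moreover have "0 \<le> u * v \<Longrightarrow> 0 < u \<Longrightarrow> 0 \<le> v" for u v :: real by (simp add: zero_le_mult_iff)
    ultimately have r0: "0 \<le> ?rhs" by blast
    have l0: "(ql - e) / 4 ^ CARD('d) \<le> 0" using False by (simp add: divide_le_0_iff)
    show ?thesis by (rule order_trans[OF l0 r0])
  qed
qed

end

subsection \<open>Descendants are finite in the limit\<close>

lemma finite_supd_ball: "finite {z :: 'd::finite site. supd x z \<le> r}"
proof (rule finite_subset)
  show "{z. supd x z \<le> r} \<subseteq> {z. \<forall>i. z i \<in> {x i - r..x i + r}}"
    unfolding supd_le_iff by (auto simp: abs_le_iff) (smt (verit))+
  show "finite {z :: 'd site. \<forall>i. z i \<in> {x i - r..x i + r}}" by (rule finite_box) simp
qed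

lemma (in wtree) desc_ball: "x \<in> V \<Longrightarrow> s x < a \<Longrightarrow> D x \<subseteq> {z. supd x z \<le> int a}"
proof
  fix z assume x: "x \<in> V" "s x < a" and z: "z \<in> D x"
  then obtain k where k: "upT k z = x" "z \<in> V" by (auto simp: desc_def)
  have "k + 1 \<le> s x" using sz_up[of k z] k x by simp
  moreover have "supd z x \<le> int k" using supd_up[of k z] k x by simp
  ultimately show "z \<in> {z. supd x z \<le> int a}" using x supd_sym[of z x] by simp
qed

context core_limits
begin

text \<open>If \<open>ql\<close> were positive, all terms on the right of
  \<open>box_inequality\<close> could be made small against the left. Since \<open>q\<close>
  converges to \<open>ql\<close>, any prescribed constant times \<open>q m - ql\<close> is small for
  large \<open>m\<close>; so each scale is chosen after the constants multiplying its
  window.\<close>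

lemma q_tendsto_0: "q \<longlonglongrightarrow> 0"
proof -
  have dec: "decseq q" using q_antimono by (auto simp: decseq_def)
  obtain ql where ql: "q \<longlonglongrightarrow> ql" "\<And>a. ql \<le> q a"
    using decseq_convergent[OF dec, of 0] q_nonneg by blast
  have small: "\<exists>m\<ge>k. c * (q m - ql) \<le> t" if "t > 0" for k :: nat and c t :: real
  proof -
    have "(\<lambda>m. c * (q m - ql)) \<longlonglongrightarrow> c * (ql - ql)" by (intro tendsto_intros ql)
    then have "\<forall>\<^sub>F m in sequentially. c * (q m - ql) < t" using that by (intro order_tendstoD) auto
    then obtain m0 where "\<And>m. m \<ge> m0 \<Longrightarrow> c * (q m - ql) < t" unfolding eventually_sequentially by blast
    then show ?thesis by (intro exI[of _ "max k m0"]) (simp add: less_imp_le)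
  qed
  have ql0: "ql \<le> 0"
  proof (rule ccontr)
    assume "\<not> ql \<le> 0"
    then have pos: "ql > 0" by simp
    \<comment> \<open>Six terms will be at most \<open>t\<close>, as will the contribution of
      \<open>e\<close> on the left, whereas \<open>ql\<close> accounts for \<open>20 * t\<close>;
      the factor 20 is generous.\<close>
    define t where "t = ql / (20 * 4 ^ CARD('d))"
    have t: "t > 0" unfolding t_def using pos by simp
    obtain a where a: "1 \<le> a" "2 * (q a - ql) \<le> t" using small[OF t, of 1 2] by blast
    define M where "M = real ((8 * a) ^ CARD('d) * deg TYPE('d))"
    obtain b0 :: nat where b0: "M / t \<le> real b0" using real_arch_simple by blast
    define b where "b = b0 + 2"
    have b: "2 \<le> b" unfolding b_def by simp
    have Mb: "M / real (b - 1) \<le> t"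
    proof -
      have "M \<le> t * real b0" using b0 t by (simp add: divide_le_eq mult.commute)
      also have "\<dots> \<le> t * real (b - 1)" using t by (intro mult_left_mono) (auto simp: b_def)
      finally show ?thesis using b by (simp add: divide_le_eq)
    qed
    obtain C0 :: nat where C0: "1 / t \<le> real C0" using real_arch_simple by blast
    define C where "C = C0 + 1"
    have C: "1 \<le> C" unfolding C_def by simp
    have Ct: "1 / real C \<le> t"
    proof -
      have "1 / t \<le> real C" using C0 unfolding C_def by simp
      then have "1 \<le> t * real C" using t by (simp add: divide_le_eq mult.commute)
      then show ?thesis using C by (simp add: divide_le_eq)
    qed
    define Z where "Z = real ((4 * b) ^ CARD('d) * (2 * C))"
    obtain g where g: "max 1 a \<le> g" "Z * (q g - ql) \<le> t" using small[OF t, of "max 1 a" Z] by blast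
    obtain K where K: "C * (2 * g) + (4 * b) ^ CARD('d) + 1 \<le> K" "4 * real g * (q K - ql) \<le> t"
      using small[OF t, of "C * (2 * g) + (4 * b) ^ CARD('d) + 1" "4 * real g"] by blast
    \<comment> \<open>The total coefficient of the windows. With boundary density \<open>e\<close>
      each window carries an additional \<open>3 * e\<close>, so these errors add up to
      \<open>3 * S * e = t\<close>.\<close>
    define S where "S = 4 * real g + 2 + Z"
    have S: "S \<ge> 2" unfolding S_def Z_def by simp
    define e where "e = t / (3 * S)"
    have e: "e > 0" unfolding e_def using t S by simp
    let ?A = "{a, g, K, C * (2 * g) + 1, deg TYPE('d) * K + 2}"
    obtain R0 where R0: "\<And>(V :: 'd site set) x u. finite V \<Longrightarrow> (\<forall>z. supd x z \<le> int R0 \<longrightarrow> z \<in> V) \<Longrightarrow> u \<in> ?A \<Longrightarrow> \<bar>Qp V x u - q u\<bar> \<le> e"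
    proof -
      have "finite ?A" by simp
      obtain R' where R': "\<forall>(V :: 'd site set) x u. finite V \<longrightarrow> (\<forall>z. supd x z \<le> int R' \<longrightarrow> z \<in> V) \<longrightarrow> u \<in> ?A \<longrightarrow> \<bar>Qp V x u - q u\<bar> \<le> e"
        using Qp_close[OF e \<open>finite ?A\<close>] by (elim exE)
      show ?thesis by (rule that[of R']) (use R' in blast)
    qed
    \<comment> \<open>At least one layer of tiles is removed, so that the cube of an inner site
      stays in the box, and \<open>R\<close> becomes a multiple of \<open>4 * b\<close>.\<close>
    define q0 where "q0 = R0 + 1"
    define R where "R = 4 * b * q0"
    obtain N0 :: nat where N0: "real CARD('d) * (2 * real R) / e \<le> real N0" using real_arch_simple by blast
    define N where "N = N0 + 4 * q0"
    define n where "n = 4 * b * N"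
    have bd: "real (card (boxV n - innerV n R :: 'd site set)) \<le> e * real n ^ CARD('d)"
    proof (rule innerV_boundary[OF e])
      show "2 * R \<le> n"
      proof -
        have "2 * q0 \<le> N" unfolding N_def by simp
        then have "4 * b * (2 * q0) \<le> 4 * b * N" by (rule mult_le_mono2)
        then show ?thesis unfolding R_def n_def by simp
      qed
      have "N \<le> n" unfolding n_def using b by simp
      then have "real N0 \<le> real n" unfolding N_def by simp
      then have "real CARD('d) * (2 * real R) / e \<le> real n" using N0 by linarith
      then show "real CARD('d) * (2 * real R) \<le> e * real n" using e by (simp add: divide_le_eq mult.commute)
      show "1 \<le> n" unfolding n_def N_def q0_def using b by simp
    qed
    have "R0 \<le> R"
    proof -
      have "1 * q0 \<le> (4 * b) * q0" using b by (intro mult_le_mono1) simp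
      then show ?thesis unfolding R_def q0_def by simp
    qed
    then have R: "\<bar>Qp V x u - q u\<bar> \<le> e" if "finite V" "\<forall>z. supd x z \<le> int R \<longrightarrow> z \<in> V" "u \<in> ?A" for V :: "'d site set" and x u
      using R0[OF that(1) _ that(3), of x] that(2) by (meson of_nat_mono order_trans)
    have "(ql - e) / 4 ^ CARD('d) \<le> M / real (b - 1) + 1 / real C
     + 4 * real g * (e + (q K - ql) + 2 * e) + 2 * (e + (q a - ql) + 2 * e) + Z * (e + (q g - ql) + 2 * e)"
      unfolding M_def Z_def
    proof (rule box_inequality[where A = ?A and ?q0.0 = q0 and N = N and b = b, folded n_def R_def])
      show "C * (2 * g) < K" "(4 * b) ^ CARD('d) < K" using K(1) by linarith+
      show "4 * q0 \<le> N" "1 \<le> q0" by (simp_all add: N_def q0_def)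
      show "a \<le> g" "1 \<le> g" using g(1) by auto
      show "0 \<le> e" using e by simp
      show "\<And>(V :: 'd site set) x u. finite V \<Longrightarrow> \<forall>z. supd x z \<le> int R \<longrightarrow> z \<in> V \<Longrightarrow> u \<in> ?A \<Longrightarrow> \<bar>Qp V x u - q u\<bar> \<le> e"
        by (rule R)
      show "\<And>u. ql \<le> q u" by (rule ql(2))
      show "2 \<le> b" "1 \<le> C" "1 \<le> a" by (fact b C a(1))+
      show "real (card (boxV n - innerV n R :: 'd site set)) \<le> e * real n ^ CARD('d)" by (rule bd)
    qed simp
    also have "\<dots> = M / real (b - 1) + 1 / real C + 4 * real g * (q K - ql) + 2 * (q a - ql) + Z * (q g - ql) + 3 * S * e"
      unfolding S_def by (simp add: algebra_simps)
    also have "3 * S * e = t" unfolding e_def using S by simp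
    finally have sum: "(ql - e) / 4 ^ CARD('d) \<le> M / real (b - 1) + 1 / real C + 4 * real g * (q K - ql) + 2 * (q a - ql) + Z * (q g - ql) + t" .
    have "(ql - e) / 4 ^ CARD('d) \<le> t + t + t + t + t + t"
      by (rule order_trans[OF sum]) (intro add_mono Mb Ct K(2) a(2) g(2) order_refl)
    moreover have "ql / 4 ^ CARD('d) = 20 * t" unfolding t_def by simp
    moreover have "e / 4 ^ CARD('d) \<le> t"
    proof -
      have "e / 4 ^ CARD('d) \<le> e / 1" using e by (intro divide_left_mono) auto
      also have "e \<le> t / 1" unfolding e_def using t S by (intro divide_left_mono) auto
      finally show ?thesis by simp
    qed
    ultimately show False using t by (simp add: diff_divide_distrib)
  qed
  have "0 \<le> ql" by (rule LIMSEQ_le_const[OF ql(1)]) (use q_nonneg in auto)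
  then show ?thesis using ql(1) ql0 by simp
qed

lemma one_ended_site:
  fixes x :: "'d site"
  assumes e: "0 < e"
  shows "\<exists>F V0. finite F \<and> finite V0 \<and> (\<forall>V. finite V \<longrightarrow> V0 \<subseteq> V \<longrightarrow> PT V {T. \<not> desc V T x \<subseteq> F} \<le> e)"
proof -
  have e2: "0 < e / 2" using e by simp
  have "\<forall>\<^sub>F a in sequentially. q a < e / 2" using q_tendsto_0 e2 by (rule order_tendstoD)
  then obtain a where a: "q a < e / 2" unfolding eventually_sequentially by blast
  obtain R where R: "\<And>(V :: 'd site set) x u. finite V \<Longrightarrow> (\<forall>z. supd x z \<le> int R \<longrightarrow> z \<in> V) \<Longrightarrow> u \<in> {a} \<Longrightarrow> \<bar>Qp V x u - q u\<bar> \<le> e / 2"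
    using Qp_close[OF e2, of "{a}"] by auto
  show ?thesis
  proof (intro exI conjI allI impI)
    show "finite {z. supd x z \<le> int a}" "finite {z. supd x z \<le> int R}" by (rule finite_supd_ball)+
    fix V assume V: "finite V" "{z. supd x z \<le> int R} \<subseteq> V"
    have xV: "x \<in> V" using V(2) supd_self[of x] by auto
    have "PT V {T. \<not> desc V T x \<subseteq> {z. supd x z \<le> int a}} \<le> Qp V x a"
      unfolding Qp_def
    proof (rule PT_mono[OF V(1)])
      fix T assume T: "T \<in> TR V" "T \<in> {T. \<not> desc V T x \<subseteq> {z. supd x z \<le> int a}}"
      interpret wtree V T by (rule TR_wtree[OF V(1) T(1)])
      show "T \<in> {T. a \<le> sz V T x}" using desc_ball[OF xV, of a] T(2) by (auto simp: not_le[symmetric])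
    qed
    also have "\<dots> \<le> e"
    proof -
      have "\<forall>z. supd x z \<le> int R \<longrightarrow> z \<in> V" using V(2) by blast
      then have "\<bar>Qp V x a - q a\<bar> \<le> e / 2" using R[OF V(1)] by blast
      then show ?thesis using a by linarith
    qed
    finally show "PT V {T. \<not> desc V T x \<subseteq> {z. supd x z \<le> int a}} \<le> e" .
  qed
qed

lemma one_ended:
  fixes B :: "'d site set"
  assumes B: "finite B" and e: "0 < e"
  shows "\<exists>F V0. finite F \<and> finite V0 \<and> (\<forall>V. finite V \<longrightarrow> V0 \<subseteq> V \<longrightarrow> PT V {T. \<not> blocked_core V treeb B T \<subseteq> F} \<le> e)"
proof -
  \<comment> \<open>The added 1 covers empty \<open>B\<close>.\<close>
  define e' where "e' = e / (real (card B) + 1)"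
  have e': "0 < e'" unfolding e'_def using e by simp
  obtain F V0 where FV: "\<And>x :: 'd site. finite (F x)" "\<And>x. finite (V0 x)"
    "\<And>x V. finite V \<Longrightarrow> V0 x \<subseteq> V \<Longrightarrow> PT V {T. \<not> desc V T x \<subseteq> F x} \<le> e'"
    using one_ended_site[OF e'] by metis
  show ?thesis
  proof (intro exI conjI allI impI)
    show "finite (\<Union>x\<in>B. F x)" "finite (B \<union> (\<Union>x\<in>B. V0 x))" using B FV by auto
    fix V assume V: "finite V" "B \<union> (\<Union>x\<in>B. V0 x) \<subseteq> V"
    have "PT V {T. \<not> blocked_core V treeb B T \<subseteq> (\<Union>x\<in>B. F x)} \<le> PT V (\<Union>x\<in>B. {T. \<not> desc V T x \<subseteq> F x})"
    proof (rule PT_mono[OF V(1)])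
      fix T assume T: "T \<in> TR V" "T \<in> {T. \<not> blocked_core V treeb B T \<subseteq> (\<Union>x\<in>B. F x)}"
      interpret wtree V T by (rule TR_wtree[OF V(1) T(1)])
      have "B \<subseteq> V" using V by blast
      then show "T \<in> (\<Union>x\<in>B. {T. \<not> desc V T x \<subseteq> F x})" using T(2) core_eq_desc by fastforce
    qed
    also have "\<dots> \<le> (\<Sum>x\<in>B. PT V {T. \<not> desc V T x \<subseteq> F x})" by (rule PT_UN_le[OF V(1) B])
    also have "\<dots> \<le> (\<Sum>x\<in>B. e')" using V by (intro sum_mono FV) auto
    also have "\<dots> \<le> e" unfolding e'_def using e by (simp add: field_simps)
    finally show "PT V {T. \<not> blocked_core V treeb B T \<subseteq> (\<Union>x\<in>B. F x)} \<le> e" .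
  qed
qed

end

subsection \<open>Asymptotic independence\<close>

text \<open>The conditional probability of an event \<open>E\<close> on \<open>B\<close>, given that
  the core of \<open>B\<close> is \<open>W\<close>. It does not involve the surrounding volume; for
  an empty inner system it is 0 by convention.\<close>

definition core_frac :: "('v \<Rightarrow> 'l set) \<Rightarrow> ('v \<Rightarrow> 'l \<Rightarrow> 'v set \<Rightarrow> bool) \<Rightarrow> 'v set \<Rightarrow> ('v \<Rightarrow> 'l) set \<Rightarrow> 'v set \<Rightarrow> real" where
  "core_frac L b B E W = card {u \<in> Rec W (inner_L L b W B) b. u \<in> E} / card (Rec W (inner_L L b W B) b)"

lemma core_frac_nonneg: "0 \<le> core_frac L b B E W"
  unfolding core_frac_def by simp

lemma inner_L_inner_L:
  assumes "mono_b b" "B \<subseteq> C" "W' \<subseteq> W"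
  shows "inner_L (inner_L L b W C) b W' B = inner_L L b W' B"
  using assms by (intro ext) (auto simp: inner_L_def dest: mono_bD)

lemma core_frac_inner_L:
  assumes "mono_b b" "B \<subseteq> C" "W' \<subseteq> W"
  shows "core_frac (inner_L L b W C) b B E W' = core_frac L b B E W'"
  unfolding core_frac_def inner_L_inner_L[OF assms] ..

lemma depends_on_restrict:
  assumes "depends_on E B" "B \<subseteq> W"
  shows "restrict s W \<in> E \<longleftrightarrow> s \<in> E"
  by (rule depends_onD[OF assms(1)]) (use assms(2) in auto)

lemma card_event_core:
  assumes mb: "mono_b b" and BW: "B \<subseteq> W" and WV: "W \<subseteq> V" and E: "depends_on E B"
    and fin: "finite (Rec W (inner_L L b W B) b)"
  shows "real (card {s \<in> Rec V L b. blocked_core V b B s = W \<and> s \<in> E})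
    = card {s \<in> Rec V L b. blocked_core V b B s = W} * core_frac L b B E W"
proof -
  let ?I = "Rec W (inner_L L b W B) b"
  have "card {s \<in> Rec V L b. blocked_core V b B s = W \<and> s \<in> E}
    = card (Rec (V - W) L (outer_b b W)) * card {u \<in> ?I. u \<in> E}"
    using Rec_core_card_event[OF mb BW WV, of L "\<lambda>_. True" "\<lambda>u. u \<in> E"] by (simp add: depends_on_restrict[OF E BW])
  moreover have "card {u \<in> ?I. u \<in> E} = 0" if "card ?I = 0" using that fin by simp
  ultimately show ?thesis
    unfolding core_frac_def Rec_core_card[OF mb BW WV] by (cases "card ?I = 0") simp_all
qed

lemma card_split_core:
  assumes fV: "finite V" and fin: "finite (Rec V L b)" and BV: "B \<subseteq> V"
  shows "card {s \<in> Rec V L b. P s} = (\<Sum>W\<in>{W. B \<subseteq> W \<and> W \<subseteq> V}. card {s \<in> Rec V L b. blocked_core V b B s = W \<and> P s})"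
proof -
  have "{s \<in> Rec V L b. P s} = (\<Union>W\<in>{W. B \<subseteq> W \<and> W \<subseteq> V}. {s \<in> Rec V L b. blocked_core V b B s = W \<and> P s})"
    using blocked_core_sub[of V b B] blocked_core_base[OF BV, of b] by auto
  moreover have "card \<dots> = (\<Sum>W\<in>{W. B \<subseteq> W \<and> W \<subseteq> V}. card {s \<in> Rec V L b. blocked_core V b B s = W \<and> P s})"
    by (rule card_UN_disjoint) (use fV fin in auto)
  ultimately show ?thesis by simp
qed

lemma card_event_core_sum:
  assumes fV: "finite V" and fL: "\<And>x. x \<in> V \<Longrightarrow> finite (L x)" and mb: "mono_b b" and BV: "B \<subseteq> V" and E: "depends_on E B"
  shows "real (card {s \<in> Rec V L b. s \<in> E})
    = (\<Sum>W\<in>{W. B \<subseteq> W \<and> W \<subseteq> V}. card {s \<in> Rec V L b. blocked_core V b B s = W} * core_frac L b B E W)"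
proof -
  have "real (card {s \<in> Rec V L b. s \<in> E})
    = (\<Sum>W\<in>{W. B \<subseteq> W \<and> W \<subseteq> V}. real (card {s \<in> Rec V L b. blocked_core V b B s = W \<and> s \<in> E}))"
    using card_split_core[OF fV finite_Rec[OF fV fL] BV, where P = "\<lambda>s. s \<in> E"] by simp
  also have "\<dots> = (\<Sum>W\<in>{W. B \<subseteq> W \<and> W \<subseteq> V}. card {s \<in> Rec V L b. blocked_core V b B s = W} * core_frac L b B E W)"
  proof (rule sum.cong[OF refl])
    fix W assume W: "W \<in> {W. B \<subseteq> W \<and> W \<subseteq> V}"
    have "finite (Rec W (inner_L L b W B) b)"
      by (rule finite_Rec) (use W fV fL in \<open>auto intro: finite_subset simp: inner_L_def\<close>)
    then show "real (card {s \<in> Rec V L b. blocked_core V b B s = W \<and> s \<in> E})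
      = card {s \<in> Rec V L b. blocked_core V b B s = W} * core_frac L b B E W"
      using W by (intro card_event_core mb E) auto
  qed
  finally show ?thesis .
qed

lemma PV_eq_SP:
  assumes fV: "finite V" and E: "depends_on E S" "S \<subseteq> V"
  shows "PV V E = card {s \<in> SP V. s \<in> E} / card (TR V)"
proof -
  have "card {\<xi> \<in> recurrent V. \<xi> \<in> E} = card {s \<in> SP V. s \<in> E}"
    by (rule card_recurrent_event[OF fV]) (simp add: depends_on_restrict[OF E])
  moreover have "recurrent V \<inter> E = {\<xi> \<in> recurrent V. \<xi> \<in> E}" by auto
  ultimately show ?thesis unfolding PV_def card_recurrent[OF fV] by simp
qed

text \<open>The volume enters only through the law of the core, and that law may be taken from the
  tree.\<close>

lemma PV_eq_core_sum:
  assumes fV: "finite V" and BV: "B \<subseteq> V" and E: "depends_on E B"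
  shows "PV V E = (\<Sum>W\<in>{W. B \<subseteq> W \<and> W \<subseteq> V}. PT V {T. blocked_core V treeb B T = W} * core_frac sandL sandb B E W)"
proof -
  have "real (card {s \<in> SP V. s \<in> E})
    = (\<Sum>W\<in>{W. B \<subseteq> W \<and> W \<subseteq> V}. card {T \<in> TR V. blocked_core V treeb B T = W} * core_frac sandL sandb B E W)"
    unfolding card_event_core_sum[OF fV finite_sandL mono_sandb BV E]
    by (intro sum.cong refl) (use card_core_SP_TR[OF fV] in simp)
  then have "PV V E = (\<Sum>W\<in>{W. B \<subseteq> W \<and> W \<subseteq> V}. card {T \<in> TR V. blocked_core V treeb B T = W} * core_frac sandL sandb B E W) / card (TR V)"
    unfolding PV_eq_SP[OF fV E BV] by simp
  also have "\<dots> = (\<Sum>W\<in>{W. B \<subseteq> W \<and> W \<subseteq> V}. PT V {T. blocked_core V treeb B T = W} * core_frac sandL sandb B E W)"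
  proof -
    have "TR V \<inter> {T. blocked_core V treeb B T = W} = {T \<in> TR V. blocked_core V treeb B T = W}" for W by auto
    then show ?thesis unfolding sum_divide_distrib PT_def by simp
  qed
  finally show ?thesis .
qed

text \<open>The complement of this set is the union of the paths to the root from the vertices outside \<open>C\<close>;
  given it, the tree inside is uniform.\<close>
definition enclosed :: "'a set \<Rightarrow> 'a set \<Rightarrow> ('a \<Rightarrow> 'a) \<Rightarrow> 'a set" where
  "enclosed V C T = {x \<in> V. desc V T x \<subseteq> C}"

lemma enclosed_sub: "enclosed V C T \<subseteq> V" "enclosed V C T \<subseteq> C"
  unfolding enclosed_def using desc_self[of _ V T] by auto

lemma enclosed_step:
  assumes "x \<in> V" "T x \<in> enclosed V C T" shows "x \<in> enclosed V C T"
proof -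
  have "desc V T x \<subseteq> desc V T (T x)" by (rule desc_mono[OF desc_step[OF assms(1)]])
  then show ?thesis using assms unfolding enclosed_def by blast
qed

lemma up_not_enclosed:
  assumes z: "z \<notin> enclosed V C T" "\<And>x. x \<notin> enclosed V C T \<Longrightarrow> T' x = T x"
  shows "up V T k z \<notin> enclosed V C T \<and> up V T' k z = up V T k z"
proof (induction k)
  case 0 show ?case using z by simp
next
  case (Suc k)
  have "adv V T (up V T k z) \<notin> enclosed V C T"
    using Suc enclosed_step[of "up V T k z" V T C] unfolding adv_def by auto
  moreover have "adv V T' (up V T k z) = adv V T (up V T k z)" unfolding adv_def using Suc z by simp
  ultimately show ?case using Suc unfolding up_Suc by simp
qed

lemma TR_PiE: "T \<in> TR V \<Longrightarrow> T \<in> PiE V nb"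
  unfolding Rec_def by simp

lemma TR_step: "T \<in> TR V \<Longrightarrow> x \<in> V \<Longrightarrow> T x \<in> nb x"
  by (rule PiE_mem[OF TR_PiE])

lemma TR_outside: "T \<in> TR V \<Longrightarrow> x \<notin> V \<Longrightarrow> T x = undefined"
  by (rule PiE_arb[OF TR_PiE])

lemma TR_acyc: "T \<in> TR V \<Longrightarrow> F \<subseteq> V \<Longrightarrow> F \<noteq> {} \<Longrightarrow> \<exists>x\<in>F. T x \<notin> F"
  using Rec_unblocked[of T V nb treeb F] by (simp add: treeb_def)

lemma TR_I:
  assumes "\<And>x. x \<in> V \<Longrightarrow> T x \<in> nb x" "\<And>x. x \<notin> V \<Longrightarrow> T x = undefined"
    and "\<And>F. F \<subseteq> V \<Longrightarrow> F \<noteq> {} \<Longrightarrow> \<exists>x\<in>F. T x \<notin> F"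
  shows "T \<in> TR V"
  using assms unfolding Rec_def by (simp add: treeb_def PiE_iff extensional_def)

lemma TR_restrict: "T \<in> TR V \<Longrightarrow> U \<subseteq> V \<Longrightarrow> restrict T U \<in> TR U"
proof (rule TR_I)
  fix F assume T: "T \<in> TR V" "U \<subseteq> V" and F: "F \<subseteq> U" "F \<noteq> {}"
  obtain x where "x \<in> F" "T x \<notin> F" using TR_acyc[OF T(1), of F] T F by blast
  then show "\<exists>x\<in>F. restrict T U x \<notin> F" using F by (intro bexI[of _ x]) auto
qed (auto simp: TR_step)

context
  fixes V C U :: "'d::finite site set" and T u T' :: "'d site \<Rightarrow> 'd site"
  assumes T: "T \<in> TR V" and U: "enclosed V C T = U" and u: "u \<in> TR U" and T': "T' = (\<lambda>x. if x \<in> U then u x else T x)"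
begin

text \<open>A set closed under \<open>T'\<close> and not inside \<open>U\<close> would have a part
  outside \<open>U\<close> closed under \<open>T\<close>, because a vertex with parent in
  \<open>U\<close> is itself in \<open>U\<close>.\<close>

lemma merge_TR: "T' \<in> TR V"
proof (rule TR_I)
  have UV: "U \<subseteq> V" using enclosed_sub[of V C T] unfolding U by auto
  show "T' x \<in> nb x" if "x \<in> V" for x using TR_step[OF T that] TR_step[OF u, of x] T' by simp
  show "T' x = undefined" if "x \<notin> V" for x
  proof -
    have "x \<notin> U" using UV that by blast
    then show ?thesis using TR_outside[OF T that] T' by simp
  qed
  fix F assume F: "F \<subseteq> V" "F \<noteq> {}"
  show "\<exists>x\<in>F. T' x \<notin> F"
  proof (cases "F \<subseteq> U")
    case True
    obtain x where "x \<in> F" "u x \<notin> F" using TR_acyc[OF u True F(2)] by blast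
    then show ?thesis using True T' by (intro bexI[of _ x]) auto
  next
    case False
    then have "F - U \<noteq> {}" by blast
    then obtain x where x: "x \<in> F - U" "T x \<notin> F - U" using TR_acyc[OF T, of "F - U"] F by blast
    have "T x \<notin> U" using enclosed_step[of x V T C] x F U by blast
    then show ?thesis using x T' by (intro bexI[of _ x]) auto
  qed
qed

lemma up_merge: "z \<notin> U \<Longrightarrow> up V T k z \<notin> U \<and> up V T' k z = up V T k z"
  using up_not_enclosed[of z V C T T' k] U T' by simp

text \<open>Paths starting outside \<open>U\<close> never enter it and are unchanged, and they alone
  decide which vertices have descendants outside \<open>C\<close>.\<close>

lemma enclosed_merge: "enclosed V C T' = U"
proof -
  have U1: "U \<subseteq> V" "U \<subseteq> C" using enclosed_sub[of V C T] unfolding U by auto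
  have "x \<in> enclosed V C T'" if x: "x \<in> U" for x
  proof -
    have "desc V T' x \<subseteq> C"
    proof
      fix z assume "z \<in> desc V T' x"
      then obtain k where "up V T' k z = x" unfolding desc_def by blast
      then have "z \<in> U" using up_merge[of z k] x by (cases "z \<in> U") auto
      then show "z \<in> C" using U1 by blast
    qed
    then show ?thesis using x U1 unfolding enclosed_def by blast
  qed
  moreover have "x \<in> U" if x: "x \<in> enclosed V C T'" for x
  proof (rule ccontr)
    assume nx: "x \<notin> U"
    have xV: "x \<in> V" using x enclosed_sub(1)[of V C T'] by auto
    have "x \<notin> enclosed V C T" using nx U by simp
    then obtain z where z: "z \<in> desc V T x" "z \<notin> C" using xV unfolding enclosed_def by blast
    then obtain k where k: "up V T k z = x" "z \<in> V" unfolding desc_def by blast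
    have "z \<notin> U" using z U1 by blast
    then have "z \<in> desc V T' x" using k up_merge[of z k] by (intro descI[of z V T' k]) auto
    then show False using x z unfolding enclosed_def by blast
  qed
  ultimately show ?thesis by blast
qed

text \<open>Vertices of \<open>U\<close> lie in \<open>C\<close> anyway, and the paths of all others
  are unchanged.\<close>

lemma core_merge:
  assumes fV: "finite V" and CV: "C \<subseteq> V"
  shows "blocked_core V treeb C T' = blocked_core V treeb C T"
proof -
  have U1: "U \<subseteq> C" using enclosed_sub[of V C T] unfolding U by auto
  have eq: "blocked_core V treeb C t = {z \<in> V. \<exists>k. up V t k z \<in> C}" if "t \<in> TR V" for t
    using wtree.core_eq_desc[OF TR_wtree[OF fV that] CV] by (auto simp: desc_def)
  have "(\<exists>k. up V T' k z \<in> C) \<longleftrightarrow> (\<exists>k. up V T k z \<in> C)" for z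
  proof (cases "z \<in> U")
    case True
    then have "up V T' 0 z \<in> C" "up V T 0 z \<in> C" using U1 by auto
    then show ?thesis by blast
  next
    case False
    then show ?thesis using up_merge by simp
  qed
  then show ?thesis unfolding eq[OF T] eq[OF merge_TR] by simp
qed

end

text \<open>All descendants of an enclosed vertex are enclosed, so no path to \<open>B\<close>
  leaves the enclosed set on its way.\<close>

lemma core_enclosed:
  assumes fV: "finite V" and T: "T \<in> TR V" and B: "B \<subseteq> enclosed V C T"
  shows "blocked_core V treeb B T = blocked_core (enclosed V C T) treeb B (restrict T (enclosed V C T))"
proof
  let ?U = "enclosed V C T"
  interpret wtree V T by (rule TR_wtree[OF fV T])
  have BV: "B \<subseteq> V" using B enclosed_sub(1)[of V C T] by blast
  have sub: "blocked_core V treeb B T \<subseteq> ?U"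
  proof -
    have "D x \<subseteq> ?U" if "x \<in> B" for x
    proof
      fix z assume z: "z \<in> D x"
      have "D z \<subseteq> D x" by (rule desc_mono[OF z])
      moreover have "D x \<subseteq> C" using B that unfolding enclosed_def by blast
      ultimately show "z \<in> ?U" using z desc_sub[of V T x] unfolding enclosed_def by blast
    qed
    then show ?thesis unfolding core_eq_desc[OF BV] by blast
  qed
  show "blocked_core V treeb B T \<subseteq> blocked_core ?U treeb B (restrict T ?U)"
  proof (rule blocked_core_greatest[OF sub])
    fix x assume x: "x \<in> blocked_core V treeb B T - B"
    then have "x \<in> ?U" using sub by blast
    then show "treeb x (restrict T ?U x) (blocked_core V treeb B T)"
      using blocked_core_blocked[OF mono_treeb, of x V B T] x by simp
  qed
  show "blocked_core ?U treeb B (restrict T ?U) \<subseteq> blocked_core V treeb B T"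
  proof (rule blocked_core_greatest)
    show "blocked_core ?U treeb B (restrict T ?U) \<subseteq> V" using blocked_core_sub[of ?U treeb B "restrict T ?U"] enclosed_sub(1)[of V C T] by blast
    fix x assume x: "x \<in> blocked_core ?U treeb B (restrict T ?U) - B"
    then have "x \<in> ?U" using blocked_core_sub[of ?U treeb B "restrict T ?U"] by blast
    then show "treeb x (T x) (blocked_core ?U treeb B (restrict T ?U))"
      using blocked_core_blocked[OF mono_treeb, of x ?U B "restrict T ?U"] x by simp
  qed
qed

text \<open>Closure under replacing the values on \<open>U\<close> makes \<open>A\<close> the
  product of its traces outside and inside \<open>U\<close>. So the restriction to \<open>U\<close>
  is uniform on \<open>M\<close>; the identity is stated without division.\<close>

lemma card_merge:
  assumes A: "\<And>T. T \<in> A \<Longrightarrow> T \<in> extensional V" and UV: "U \<subseteq> V" and M: "\<And>u. u \<in> M \<Longrightarrow> u \<in> extensional U"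
    and restr: "\<And>T. T \<in> A \<Longrightarrow> restrict T U \<in> M" and merge: "\<And>T u. T \<in> A \<Longrightarrow> u \<in> M \<Longrightarrow> (\<lambda>x. if x \<in> U then u x else T x) \<in> A"
  shows "card {T \<in> A. Q (restrict T U)} * card M = card A * card {u \<in> M. Q u}"
proof -
  let ?h = "\<lambda>T. (restrict T (V - U), restrict T U)"
  let ?K = "(\<lambda>T. restrict T (V - U)) ` A"
  have count: "card {T \<in> A. R (restrict T U)} = card ?K * card {u \<in> M. R u}" for R
  proof -
    have "bij_betw ?h {T \<in> A. R (restrict T U)} (?K \<times> {u \<in> M. R u})"
    proof (rule bij_betwI')
      fix T T' assume TT: "T \<in> {T \<in> A. R (restrict T U)}" "T' \<in> {T \<in> A. R (restrict T U)}"
      show "?h T = ?h T' \<longleftrightarrow> T = T'"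
      proof
        assume eq: "?h T = ?h T'"
        have "T x = T' x" for x
        proof (cases "x \<in> U")
          case True
          then show ?thesis using eq by (auto dest: fun_cong[of _ _ x])
        next
          case False
          show ?thesis
          proof (cases "x \<in> V")
            case True
            have "restrict T (V - U) x = restrict T' (V - U) x" using eq by simp
            then show ?thesis using True False by simp
          next
            case nV: False
            then show ?thesis using A[of T] A[of T'] TT by (simp add: extensional_def)
          qed
        qed
        then show "T = T'" by auto
      qed simp
    next
      fix T assume "T \<in> {T \<in> A. R (restrict T U)}"
      then show "?h T \<in> ?K \<times> {u \<in> M. R u}" using restr by simp
    next
      fix y assume "y \<in> ?K \<times> {u \<in> M. R u}"
      then obtain T u where y: "y = (restrict T (V - U), u)" "T \<in> A" "u \<in> M" "R u" by auto
      let ?T = "\<lambda>x. if x \<in> U then u x else T x"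
      have "restrict ?T (V - U) = restrict T (V - U)" by (auto simp: restrict_def)
      moreover have "restrict ?T U = u" using M[OF y(3)] by (auto simp: restrict_def extensional_def)
      ultimately show "\<exists>T\<in>{T \<in> A. R (restrict T U)}. y = ?h T"
        using merge[OF y(2,3)] y by (intro bexI[of _ ?T]) auto
    qed
    then have "card {T \<in> A. R (restrict T U)} = card (?K \<times> {u \<in> M. R u})" by (rule bij_betw_same_card)
    then show ?thesis by (simp add: card_cartesian_product)
  qed
  have "card A = card ?K * card M" using count[of "\<lambda>_. True"] by simp
  then show ?thesis unfolding count[of Q] by simp
qed

text \<open>Resampling inside \<open>U\<close> preserves the enclosed set and the core of
  \<open>C\<close>, so the tree inside is uniform on \<open>TR U\<close> given both.\<close>

lemma card_enclosed_core:
  fixes V :: "'d::finite site set"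
  assumes fV: "finite V" and CV: "C \<subseteq> V" and B: "B \<subseteq> U"
  shows "real (card {T \<in> TR V. blocked_core V treeb C T = W \<and> blocked_core V treeb B T = W' \<and> enclosed V C T = U})
    = card {T \<in> TR V. blocked_core V treeb C T = W \<and> enclosed V C T = U} * PT U {T. blocked_core U treeb B T = W'}"
proof -
  let ?A = "{T \<in> TR V. blocked_core V treeb C T = W \<and> enclosed V C T = U}"
  show ?thesis
  proof (cases "?A = {}")
    case True
    then have "{T \<in> TR V. blocked_core V treeb C T = W \<and> blocked_core V treeb B T = W' \<and> enclosed V C T = U} = {}" by blast
    then show ?thesis by (simp add: True del: Collect_empty_eq)
  next
    case False
    then obtain T0 where "enclosed V C T0 = U" by blast
    then have UV: "U \<subseteq> V" using enclosed_sub(1)[of V C T0] by simp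
    have fU: "finite U" by (rule finite_subset[OF UV fV])
    have "card {T \<in> ?A. blocked_core U treeb B (restrict T U) = W'} * card (TR U)
      = card ?A * card {u \<in> TR U. blocked_core U treeb B u = W'}"
    proof (rule card_merge[OF _ UV])
      show "T \<in> extensional V" if "T \<in> ?A" for T using that TR_outside[of T V] by (auto simp: extensional_def)
      show "T \<in> extensional U" if "T \<in> TR U" for T using that TR_outside[of T U] by (auto simp: extensional_def)
      show "restrict T U \<in> TR U" if "T \<in> ?A" for T by (rule TR_restrict[OF _ UV]) (use that in blast)
      fix T u assume T: "T \<in> ?A" and u: "u \<in> TR U"
      have T1: "T \<in> TR V" and iT: "enclosed V C T = U" using T by auto
      show "(\<lambda>x. if x \<in> U then u x else T x) \<in> ?A"
        using merge_TR[OF T1 iT u refl] enclosed_merge[OF T1 iT u refl] core_merge[OF T1 iT u refl fV CV] T by simp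
    qed
    moreover have "{T \<in> ?A. blocked_core U treeb B (restrict T U) = W'}
      = {T \<in> TR V. blocked_core V treeb C T = W \<and> blocked_core V treeb B T = W' \<and> enclosed V C T = U}"
    proof -
      have "blocked_core V treeb B T = blocked_core U treeb B (restrict T U)" if "T \<in> TR V" "enclosed V C T = U" for T
        using core_enclosed[OF fV that(1), of B C] B that(2) by simp
      then show ?thesis by auto
    qed
    moreover have "TR U \<inter> {T. blocked_core U treeb B T = W'} = {u \<in> TR U. blocked_core U treeb B u = W'}" by auto
    moreover have "real (card (TR U)) > 0" using card_TR_pos[OF fU] by simp
    ultimately show ?thesis unfolding PT_def
      by (simp add: field_simps del: of_nat_mult) (simp only: of_nat_mult[symmetric] mult.commute)
  qed
qed

text \<open>Given the set enclosed by \<open>C\<close> and the descendants of \<open>C\<close>, the vertices below \<open>B\<close> are distributed as in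
  the smaller volume \<open>enclosed V C T\<close>, so that \<open>E\<close> has its probability there.\<close>
lemma core_frac_lower:
  fixes V :: "'d::finite site set" and \<gamma> :: real
  assumes fV: "finite V" and CV: "C \<subseteq> V" and B: "B \<subseteq> V0" and CW: "C \<subseteq> W" "W \<subseteq> V" and E: "depends_on E B"
    and \<gamma>: "\<And>U. finite U \<Longrightarrow> V0 \<subseteq> U \<Longrightarrow> \<gamma> \<le> PV U E"
  shows "\<gamma> * card {T \<in> TR V. blocked_core V treeb C T = W \<and> V0 \<subseteq> enclosed V C T}
    \<le> (\<Sum>W'\<in>{W'. B \<subseteq> W' \<and> W' \<subseteq> W}. card {T \<in> TR V. blocked_core V treeb C T = W \<and> blocked_core V treeb B T = W'}
          * core_frac sandL sandb B E W')"
proof -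
  have fC: "finite C" and fW: "finite W" using fV CV CW by (auto intro: finite_subset)
  let ?f = "core_frac sandL sandb B E" and ?\<U> = "{U. V0 \<subseteq> U \<and> U \<subseteq> C}" and ?\<W> = "{W'. B \<subseteq> W' \<and> W' \<subseteq> W}"
  let ?k = "\<lambda>U. card {T \<in> TR V. blocked_core V treeb C T = W \<and> enclosed V C T = U}"
  let ?j = "\<lambda>W' U. card {T \<in> TR V. blocked_core V treeb C T = W \<and> blocked_core V treeb B T = W' \<and> enclosed V C T = U}"
  have fU: "finite ?\<U>" using fC by simp
  have j: "(\<Sum>U\<in>?\<U>. real (?j W' U)) \<le> real (card {T \<in> TR V. blocked_core V treeb C T = W \<and> blocked_core V treeb B T = W'})" for W'
  proof -
    have "(\<Sum>U\<in>?\<U>. ?j W' U) = card (\<Union>U\<in>?\<U>. {T \<in> TR V. blocked_core V treeb C T = W \<and> blocked_core V treeb B T = W' \<and> enclosed V C T = U})"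
      by (rule card_UN_disjoint[symmetric]) (use fU fV in auto)
    also have "\<dots> \<le> card {T \<in> TR V. blocked_core V treeb C T = W \<and> blocked_core V treeb B T = W'}"
      by (rule card_mono) (use fV in auto)
    finally show ?thesis unfolding of_nat_sum[symmetric] of_nat_le_iff .
  qed
  have "{T \<in> TR V. blocked_core V treeb C T = W \<and> V0 \<subseteq> enclosed V C T} = (\<Union>U\<in>?\<U>. {T \<in> TR V. blocked_core V treeb C T = W \<and> enclosed V C T = U})"
    using enclosed_sub(2)[of V C] by auto
  moreover have "card \<dots> = (\<Sum>U\<in>?\<U>. ?k U)" by (rule card_UN_disjoint) (use fU fV in auto)
  ultimately have "\<gamma> * card {T \<in> TR V. blocked_core V treeb C T = W \<and> V0 \<subseteq> enclosed V C T} = (\<Sum>U\<in>?\<U>. real (?k U) * \<gamma>)"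
    by (simp add: sum_distrib_left mult.commute)
  also have "\<dots> \<le> (\<Sum>U\<in>?\<U>. real (?k U) * (\<Sum>W'\<in>?\<W>. PT U {T. blocked_core U treeb B T = W'} * ?f W'))"
  proof (rule sum_mono, rule mult_left_mono)
    fix U assume U: "U \<in> ?\<U>"
    then have fU: "finite U" and BU: "B \<subseteq> U" and V0U: "V0 \<subseteq> U" using fC B by (auto intro: finite_subset)
    have "\<gamma> \<le> (\<Sum>W'\<in>{W'. B \<subseteq> W' \<and> W' \<subseteq> U}. PT U {T. blocked_core U treeb B T = W'} * ?f W')"
      using \<gamma>[OF fU V0U] unfolding PV_eq_core_sum[OF fU BU E] .
    \<comment> \<open>Since \<open>U \<subseteq> C\<close> and \<open>C \<subseteq> W\<close>,
      enlarging the range of \<open>W'\<close> only adds nonnegative terms.\<close>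
    also have "\<dots> \<le> (\<Sum>W'\<in>?\<W>. PT U {T. blocked_core U treeb B T = W'} * ?f W')"
      by (rule sum_mono2) (use fW U CW in \<open>auto intro: mult_nonneg_nonneg PT_nonneg core_frac_nonneg\<close>)
    finally show "\<gamma> \<le> (\<Sum>W'\<in>?\<W>. PT U {T. blocked_core U treeb B T = W'} * ?f W')" .
  qed simp
  also have "\<dots> = (\<Sum>W'\<in>?\<W>. (\<Sum>U\<in>?\<U>. real (?j W' U)) * ?f W')"
  proof -
    have kj: "real (?k U) * PT U {T. blocked_core U treeb B T = W'} = real (?j W' U)" if "U \<in> ?\<U>" for U W'
      using card_enclosed_core[OF fV CV, of B U W W'] B that by auto
    have "(\<Sum>U\<in>?\<U>. real (?k U) * (\<Sum>W'\<in>?\<W>. PT U {T. blocked_core U treeb B T = W'} * ?f W'))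
      = (\<Sum>U\<in>?\<U>. \<Sum>W'\<in>?\<W>. real (?j W' U) * ?f W')"
      unfolding sum_distrib_left mult.assoc[symmetric] by (intro sum.cong refl arg_cong2[where f = "(*)"] kj)
    also have "\<dots> = (\<Sum>W'\<in>?\<W>. \<Sum>U\<in>?\<U>. real (?j W' U) * ?f W')" by (rule sum.swap)
    finally show ?thesis by (simp add: sum_distrib_right)
  qed
  also have "\<dots> \<le> (\<Sum>W'\<in>?\<W>. card {T \<in> TR V. blocked_core V treeb C T = W \<and> blocked_core V treeb B T = W'} * ?f W')"
    by (intro sum_mono mult_right_mono j core_frac_nonneg)
  finally show ?thesis .
qed

text \<open>Given core \<open>W\<close> of \<open>C\<close>, the events \<open>A\<close> (outside)
  and \<open>E\<close> (inside) are independent in the sandpile, with \<open>a\<close> out of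
  \<open>c\<close> and \<open>e\<close> out of \<open>n\<close> configurations. The counts
  \<open>c\<close>, \<open>n\<close> and the splitting of \<open>e\<close> by the core of
  \<open>B\<close> agree with those of the tree, for which \<open>core_frac_lower\<close>
  applies.\<close>

lemma core_sandpile_lower:
  fixes V :: "'d::finite site set" and \<gamma> :: real
  assumes fV: "finite V" and CV: "C \<subseteq> V" and B: "B \<subseteq> V0" "B \<subseteq> C" and CW: "C \<subseteq> W" "W \<subseteq> V" and E: "depends_on E B"
    and A: "depends_on A S" "S \<subseteq> V" "S \<inter> W = {}"
    and \<gamma>: "\<And>U. finite U \<Longrightarrow> V0 \<subseteq> U \<Longrightarrow> \<gamma> \<le> PV U E" "0 \<le> \<gamma>" "\<gamma> \<le> 1"
  shows "\<gamma> * card {s \<in> SP V. blocked_core V sandb C s = W \<and> s \<in> A}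
      - card {T \<in> TR V. blocked_core V treeb C T = W \<and> \<not> V0 \<subseteq> enclosed V C T}
    \<le> card {s \<in> SP V. blocked_core V sandb C s = W \<and> s \<in> A \<and> s \<in> E}"
proof -
  let ?f = "core_frac sandL sandb B E" and ?\<W> = "{W'. B \<subseteq> W' \<and> W' \<subseteq> W}"
  let ?IS = "Rec W (inner_L sandL sandb W C) sandb" and ?IT = "Rec W (inner_L nb treeb W C) treeb"
  let ?O = "Rec (V - W) sandL (outer_b sandb W)" and ?OT = "Rec (V - W) nb (outer_b treeb W)"
  have fW: "finite W" and BW: "B \<subseteq> W" using fV CW B by (auto intro: finite_subset)
  have sc: "same_counts V sandL sandb nb treeb" by (rule same_counts_sand_tree)
  define n c a e where "n = real (card ?IS)" and "c = real (card ?O)"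
    and "a = real (card {t \<in> ?O. t \<in> A})" and "e = real (card {u \<in> ?IS. u \<in> E})"
  have SA: "S \<subseteq> V - W" using A by blast
  have cA: "real (card {s \<in> SP V. blocked_core V sandb C s = W \<and> s \<in> A}) = a * n"
    using Rec_core_card_event[OF mono_sandb CW, of sandL "\<lambda>t. t \<in> A" "\<lambda>_. True"]
    by (simp add: depends_on_restrict[OF A(1) SA] a_def n_def)
  have cAE: "real (card {s \<in> SP V. blocked_core V sandb C s = W \<and> s \<in> A \<and> s \<in> E}) = a * e"
    using Rec_core_card_event[OF mono_sandb CW, of sandL "\<lambda>t. t \<in> A" "\<lambda>u. u \<in> E"]
    by (simp add: depends_on_restrict[OF A(1) SA] depends_on_restrict[OF E BW] a_def e_def)
  have nT: "n = real (card ?IT)" unfolding n_def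
    using card_Rec_same_counts[OF fW same_counts_inner[OF sc CW(2) mono_sandb mono_treeb] mono_sandb mono_treeb, of C] by simp
  have oT: "c = real (card ?OT)" unfolding c_def
    using card_Rec_same_counts[OF _ same_counts_outer[OF sc CW(2)] mono_outer_b[OF mono_sandb] mono_outer_b[OF mono_treeb]] fV by simp
  have cT: "real (card {T \<in> TR V. blocked_core V treeb C T = W}) = c * n"
    unfolding Rec_core_card[OF mono_treeb CW] nT oT by simp
  have cTT: "real (card {T \<in> TR V. blocked_core V treeb C T = W \<and> blocked_core V treeb B T = W'})
    = c * card {u \<in> ?IS. blocked_core W sandb B u = W'}" if "W' \<in> ?\<W>" for W'
  proof -
    have "blocked_core V treeb B T = blocked_core W treeb B (restrict T W)" if "blocked_core V treeb C T = W" for T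
      using blocked_core_nested[OF that B(2)] blocked_core_cong[of W T "restrict T W" treeb B] by simp
    then have eq: "{T \<in> TR V. blocked_core V treeb C T = W \<and> blocked_core V treeb B T = W'}
      = {T \<in> TR V. blocked_core V treeb C T = W \<and> True \<and> blocked_core W treeb B (restrict T W) = W'}" by auto
    have "card {T \<in> TR V. blocked_core V treeb C T = W \<and> blocked_core V treeb B T = W'}
      = card ?OT * card {u \<in> ?IT. blocked_core W treeb B u = W'}"
      unfolding eq using Rec_core_card_event[OF mono_treeb CW, of nb "\<lambda>_. True" "\<lambda>u. blocked_core W treeb B u = W'"] by simp
    then show ?thesis unfolding oT using card_core_inner_SP_TR[OF fV, of B W' W C] that CW by simp
  qed
  have e: "e = (\<Sum>W'\<in>?\<W>. card {u \<in> ?IS. blocked_core W sandb B u = W'} * ?f W')"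
  proof -
    have "e = (\<Sum>W'\<in>?\<W>. card {u \<in> ?IS. blocked_core W sandb B u = W'} * core_frac (inner_L sandL sandb W C) sandb B E W')"
      unfolding e_def by (rule card_event_core_sum[OF fW _ mono_sandb BW E]) (simp add: inner_L_def)
    also have "\<dots> = (\<Sum>W'\<in>?\<W>. card {u \<in> ?IS. blocked_core W sandb B u = W'} * ?f W')"
      by (intro sum.cong refl arg_cong2[where f = "(*)"] core_frac_inner_L[OF mono_sandb B(2)]) simp
    finally show ?thesis .
  qed
  let ?good = "real (card {T \<in> TR V. blocked_core V treeb C T = W \<and> V0 \<subseteq> enclosed V C T})"
  let ?bad = "real (card {T \<in> TR V. blocked_core V treeb C T = W \<and> \<not> V0 \<subseteq> enclosed V C T})"
  have "\<gamma> * ?good \<le> (\<Sum>W'\<in>?\<W>. card {T \<in> TR V. blocked_core V treeb C T = W \<and> blocked_core V treeb B T = W'} * ?f W')"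
    by (rule core_frac_lower[OF fV CV B(1) CW E \<gamma>(1)])
  also have "\<dots> = c * e" unfolding e sum_distrib_left by (intro sum.cong refl) (simp add: cTT)
  finally have oe: "\<gamma> * ?good \<le> c * e" .
  have "c * n = ?good + ?bad"
  proof -
    have "{T \<in> TR V. blocked_core V treeb C T = W} = {T \<in> TR V. blocked_core V treeb C T = W \<and> V0 \<subseteq> enclosed V C T}
      \<union> {T \<in> TR V. blocked_core V treeb C T = W \<and> \<not> V0 \<subseteq> enclosed V C T}" by blast
    then have "card {T \<in> TR V. blocked_core V treeb C T = W} = card {T \<in> TR V. blocked_core V treeb C T = W \<and> V0 \<subseteq> enclosed V C T}
      + card {T \<in> TR V. blocked_core V treeb C T = W \<and> \<not> V0 \<subseteq> enclosed V C T}"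
      using fV by (simp add: card_Un_disjoint[symmetric] disjoint_iff)
    then show ?thesis unfolding cT[symmetric] by simp
  qed
  then have "\<gamma> * (c * n) = \<gamma> * ?good + \<gamma> * ?bad" by (simp add: distrib_left)
  moreover have "\<gamma> * ?bad \<le> 1 * ?bad" by (intro mult_right_mono \<gamma>(3)) simp
  ultimately have le: "c * (\<gamma> * n - e) \<le> ?bad" using oe by (simp add: algebra_simps)
  \<comment> \<open>Passing from all outer configurations to those in \<open>A\<close> lowers the
    left side if the bracket is nonnegative; otherwise the left side is at most 0.\<close>
  have "a * (\<gamma> * n - e) \<le> ?bad"
  proof (cases "0 \<le> \<gamma> * n - e")
    case True
    have "a \<le> c" unfolding a_def c_def using fV by (simp add: card_mono finite_Rec)
    then have "a * (\<gamma> * n - e) \<le> c * (\<gamma> * n - e)" using True by (rule mult_right_mono)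
    then show ?thesis using le by simp
  next
    case False
    have "a * (\<gamma> * n - e) \<le> 0" using False by (intro mult_nonneg_nonpos) (simp_all add: a_def)
    also have "0 \<le> ?bad" by simp
    finally show ?thesis .
  qed
  then show ?thesis unfolding cA cAE by (simp add: algebra_simps)
qed

text \<open>Sum over the cores \<open>W \<subseteq> F\<close> of \<open>C\<close>, which are
  disjoint from the support of \<open>A\<close>. One error comes from cores leaving
  \<open>F\<close>, the other from trees in which \<open>V0\<close> is not enclosed by
  \<open>C\<close>.\<close>

lemma mixing_lower:
  fixes V :: "'d::finite site set" and \<gamma> :: real
  assumes fV: "finite V" and B: "B \<subseteq> V0" "B \<subseteq> C" and V: "V0 \<subseteq> V" "C \<subseteq> V" and E: "depends_on E B"
    and A: "depends_on A S" "S \<subseteq> V" "S \<inter> F = {}"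
    and \<gamma>: "\<And>U. finite U \<Longrightarrow> V0 \<subseteq> U \<Longrightarrow> \<gamma> \<le> PV U E" "0 \<le> \<gamma>" "\<gamma> \<le> 1"
    and e: "PT V {T. \<not> blocked_core V treeb V0 T \<subseteq> C} \<le> \<epsilon>" "PT V {T. \<not> blocked_core V treeb C T \<subseteq> F} \<le> \<epsilon>"
  shows "\<gamma> * PV V A - 2 * \<epsilon> \<le> PV V (A \<inter> E)"
proof -
  let ?\<W> = "{W. C \<subseteq> W \<and> W \<subseteq> V \<inter> F}" and ?R = "real (card (TR V))"
  have R: "?R > 0" using card_TR_pos[OF fV] by simp
  have f\<W>: "finite ?\<W>" using fV by simp
  let ?a = "\<lambda>W. {s \<in> SP V. blocked_core V sandb C s = W \<and> s \<in> A}"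
  let ?ae = "\<lambda>W. {s \<in> SP V. blocked_core V sandb C s = W \<and> s \<in> A \<and> s \<in> E}"
  let ?bad = "\<lambda>W. {T \<in> TR V. blocked_core V treeb C T = W \<and> \<not> V0 \<subseteq> enclosed V C T}"
  have bad: "(\<Sum>W\<in>?\<W>. real (card (?bad W))) \<le> \<epsilon> * ?R"
  proof -
    have "(\<Sum>W\<in>?\<W>. card (?bad W)) = card (\<Union>W\<in>?\<W>. ?bad W)"
      by (rule card_UN_disjoint[symmetric]) (use f\<W> fV in auto)
    also have "\<dots> \<le> card (TR V \<inter> {T. \<not> blocked_core V treeb V0 T \<subseteq> C})"
    proof (rule card_mono)
      show "(\<Union>W\<in>?\<W>. ?bad W) \<subseteq> TR V \<inter> {T. \<not> blocked_core V treeb V0 T \<subseteq> C}"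
      proof
        fix T assume "T \<in> (\<Union>W\<in>?\<W>. ?bad W)"
        then have T: "T \<in> TR V" "\<not> V0 \<subseteq> enclosed V C T" by auto
        then obtain x where x: "x \<in> V0" "x \<notin> enclosed V C T" by blast
        have "desc V T x \<subseteq> blocked_core V treeb V0 T"
          using wtree.core_eq_desc[OF TR_wtree[OF fV T(1)] V(1)] x by blast
        moreover have "\<not> desc V T x \<subseteq> C" using x V unfolding enclosed_def by blast
        ultimately show "T \<in> TR V \<inter> {T. \<not> blocked_core V treeb V0 T \<subseteq> C}" using T by blast
      qed
    qed (use fV in simp)
    finally have "(\<Sum>W\<in>?\<W>. card (?bad W)) \<le> card (TR V \<inter> {T. \<not> blocked_core V treeb V0 T \<subseteq> C})" .
    then have "(\<Sum>W\<in>?\<W>. real (card (?bad W))) \<le> real (card (TR V \<inter> {T. \<not> blocked_core V treeb V0 T \<subseteq> C}))"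
      unfolding of_nat_sum[symmetric] of_nat_le_iff .
    also have "\<dots> \<le> \<epsilon> * ?R" using e(1) R unfolding PT_def by (simp add: divide_le_eq)
    finally show ?thesis .
  qed
  have outer: "real (card {s \<in> SP V. \<not> blocked_core V sandb C s \<subseteq> F}) \<le> \<epsilon> * ?R"
  proof -
    have "card {s \<in> SP V. \<not> blocked_core V sandb C s \<subseteq> F} = (\<Sum>W\<in>{W. C \<subseteq> W \<and> W \<subseteq> V}. card {s \<in> SP V. blocked_core V sandb C s = W \<and> \<not> blocked_core V sandb C s \<subseteq> F})"
      by (rule card_split_core) (use fV V in auto)
    also have "\<dots> = (\<Sum>W\<in>{W. C \<subseteq> W \<and> W \<subseteq> V}. card {T \<in> TR V. blocked_core V treeb C T = W \<and> \<not> blocked_core V treeb C T \<subseteq> F})"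
    proof (rule sum.cong[OF refl])
      fix W assume W: "W \<in> {W. C \<subseteq> W \<and> W \<subseteq> V}"
      show "card {s \<in> SP V. blocked_core V sandb C s = W \<and> \<not> blocked_core V sandb C s \<subseteq> F}
        = card {T \<in> TR V. blocked_core V treeb C T = W \<and> \<not> blocked_core V treeb C T \<subseteq> F}"
        using card_core_SP_TR[OF fV, of C W] W by (cases "W \<subseteq> F") (simp_all cong: conj_cong)
    qed
    also have "\<dots> = card {T \<in> TR V. \<not> blocked_core V treeb C T \<subseteq> F}"
      by (rule card_split_core[symmetric]) (use fV V in auto)
    also have "{T \<in> TR V. \<not> blocked_core V treeb C T \<subseteq> F} = TR V \<inter> {T. \<not> blocked_core V treeb C T \<subseteq> F}" by blast
    finally show ?thesis using e(2) R unfolding PT_def by (simp add: divide_le_eq)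
  qed
  have "real (card {s \<in> SP V. s \<in> A}) \<le> (\<Sum>W\<in>?\<W>. real (card (?a W))) + \<epsilon> * ?R"
  proof -
    have "{s \<in> SP V. s \<in> A} \<subseteq> (\<Union>W\<in>?\<W>. ?a W) \<union> {s \<in> SP V. \<not> blocked_core V sandb C s \<subseteq> F}"
      using blocked_core_sub[of V sandb C] blocked_core_base[OF V(2), of sandb] by auto
    then have "card {s \<in> SP V. s \<in> A} \<le> card ((\<Union>W\<in>?\<W>. ?a W) \<union> {s \<in> SP V. \<not> blocked_core V sandb C s \<subseteq> F})"
      by (rule card_mono[rotated]) (use fV f\<W> in auto)
    also have "\<dots> \<le> card (\<Union>W\<in>?\<W>. ?a W) + card {s \<in> SP V. \<not> blocked_core V sandb C s \<subseteq> F}" by (rule card_Un_le)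
    also have "card (\<Union>W\<in>?\<W>. ?a W) \<le> (\<Sum>W\<in>?\<W>. card (?a W))" by (rule card_UN_le[OF f\<W>])
    finally have "real (card {s \<in> SP V. s \<in> A}) \<le> real ((\<Sum>W\<in>?\<W>. card (?a W)) + card {s \<in> SP V. \<not> blocked_core V sandb C s \<subseteq> F})"
      unfolding of_nat_le_iff by simp
    then show ?thesis using outer by simp
  qed
  then have "\<gamma> * card {s \<in> SP V. s \<in> A} \<le> \<gamma> * ((\<Sum>W\<in>?\<W>. real (card (?a W))) + \<epsilon> * ?R)" by (rule mult_left_mono[OF _ \<gamma>(2)])
  also have "\<dots> = (\<Sum>W\<in>?\<W>. \<gamma> * card (?a W)) + \<gamma> * (\<epsilon> * ?R)" by (simp add: distrib_left sum_distrib_left)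
  also have "(\<Sum>W\<in>?\<W>. \<gamma> * card (?a W)) \<le> (\<Sum>W\<in>?\<W>. real (card (?ae W)) + card (?bad W))"
  proof (rule sum_mono)
    fix W assume W: "W \<in> ?\<W>"
    have "\<gamma> * card (?a W) - card (?bad W) \<le> card (?ae W)"
      by (rule core_sandpile_lower[OF fV V(2) B _ _ E A(1,2) _ \<gamma>]) (use W A(3) in auto)
    then show "\<gamma> * card (?a W) \<le> real (card (?ae W)) + card (?bad W)" by simp
  qed
  also have "\<dots> \<le> (\<Sum>W\<in>?\<W>. real (card (?ae W))) + \<epsilon> * ?R" using bad by (simp add: sum.distrib)
  also have "(\<Sum>W\<in>?\<W>. real (card (?ae W))) \<le> card {s \<in> SP V. s \<in> A \<inter> E}"
  proof -
    have "(\<Sum>W\<in>?\<W>. card (?ae W)) = card (\<Union>W\<in>?\<W>. ?ae W)"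
      by (rule card_UN_disjoint[symmetric]) (use f\<W> fV in auto)
    also have "\<dots> \<le> card {s \<in> SP V. s \<in> A \<inter> E}" by (rule card_mono) (use fV in auto)
    finally show ?thesis unfolding of_nat_sum[symmetric] of_nat_le_iff .
  qed
  also have "\<gamma> * (\<epsilon> * ?R) \<le> 1 * (\<epsilon> * ?R)"
  proof (rule mult_right_mono[OF \<gamma>(3)])
    have "0 \<le> \<epsilon>" using e(1) PT_nonneg[of V "{T. \<not> blocked_core V treeb V0 T \<subseteq> C}"] by linarith
    then show "0 \<le> \<epsilon> * ?R" by simp
  qed
  finally have fin: "\<gamma> * card {s \<in> SP V. s \<in> A} \<le> card {s \<in> SP V. s \<in> A \<inter> E} + 2 * \<epsilon> * ?R" by simp
  have BV: "B \<subseteq> V" using B V by blast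
  have AE: "depends_on (A \<inter> E) (S \<union> B)" using A(1) E unfolding depends_on_def by blast
  have "\<gamma> * PV V A - 2 * \<epsilon> = (\<gamma> * card {s \<in> SP V. s \<in> A} - 2 * \<epsilon> * ?R) / ?R"
    unfolding PV_eq_SP[OF fV A(1,2)] using R by (simp add: field_simps)
  also have "\<dots> \<le> card {s \<in> SP V. s \<in> A \<inter> E} / ?R" using fin R by (intro divide_right_mono) auto
  also have "\<dots> = PV V (A \<inter> E)" using PV_eq_SP[OF fV AE] A(2) BV by simp
  finally show ?thesis .
qed

lemma core_limits_weak_limit:
  fixes \<mu> :: "('d::finite) config measure"
  assumes "CARD('d) \<ge> 2" "prob_space \<mu>" "sets \<mu> = sets OmegaM" "weak_limit \<mu>"
  shows "core_limits (core_prob \<mu> {orig})"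
proof
  show "CARD('d) \<ge> 2" by (rule assms(1))
  fix W :: "'d site set" assume W: "finite W" "orig \<in> W"
  have "\<forall>\<^sub>F V in finite_subsets_at_top UNIV. PT V {T. blocked_core V treeb {orig} T = W} = PT V {T. desc V T orig = W}"
    unfolding eventually_finite_subsets_at_top
  proof (intro exI[of _ "{orig}"] conjI allI impI)
    fix V :: "'d site set" assume V: "finite V \<and> {orig} \<subseteq> V \<and> V \<subseteq> UNIV"
    show "PT V {T. blocked_core V treeb {orig} T = W} = PT V {T. desc V T orig = W}"
    proof (rule PT_cong)
      fix T assume "T \<in> TR V"
      then have "blocked_core V treeb {orig} T = desc V T orig"
        using wtree.core_eq_desc[OF TR_wtree, of V T "{orig}"] V by simp
      then show "T \<in> {T. blocked_core V treeb {orig} T = W} \<longleftrightarrow> T \<in> {T. desc V T orig = W}" by simp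
    qed
  qed simp_all
  moreover have "((\<lambda>V. PT V {T. blocked_core V treeb {orig} T = W}) \<longlongrightarrow> core_prob \<mu> {orig} W) (finite_subsets_at_top UNIV)"
    by (rule PT_core_limit[OF assms(2-4) W(1)]) (use W in simp)
  ultimately show "((\<lambda>V. PT V {T. desc V T orig = W}) \<longlongrightarrow> core_prob \<mu> {orig} W) (finite_subsets_at_top UNIV)"
    by (rule Lim_transform_eventually[rotated])
qed

lemma PV_nonneg: "0 \<le> PV V E"
  unfolding PV_def by simp

lemma mixing_limit:
  fixes \<mu> :: "('d::finite) config measure"
  assumes "CARD('d) \<ge> 2" and \<mu>: "prob_space \<mu>" "sets \<mu> = sets OmegaM" "weak_limit \<mu>"
    and B: "finite B" and E: "depends_on E B" and e: "0 < e"
  shows "\<exists>F. finite F \<and> (\<forall>A S. finite S \<longrightarrow> S \<inter> F = {} \<longrightarrow> depends_on A S \<longrightarrow>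
    measure \<mu> (Omega \<inter> E) * measure \<mu> (Omega \<inter> A) - e \<le> measure \<mu> (Omega \<inter> (A \<inter> E)))"
proof -
  interpret prob_space \<mu> by (rule \<mu>(1))
  interpret core_limits "core_prob \<mu> {orig}" by (rule core_limits_weak_limit[OF assms(1) \<mu>])
  define \<delta> where "\<delta> = e / 3"
  have \<delta>: "0 < \<delta>" unfolding \<delta>_def using e by simp
  let ?m = "measure \<mu> (Omega \<inter> E)"
  \<comment> \<open>Truncated at 0, since the lower bound is multiplied into estimates that need a
    factor between 0 and 1.\<close>
  define \<gamma> where "\<gamma> = max 0 (?m - \<delta>)"
  have \<gamma>01: "0 \<le> \<gamma>" "\<gamma> \<le> 1" unfolding \<gamma>_def using \<delta> order_trans[OF _ prob_le_1[of "Omega \<inter> E"]] by (simp_all add: diff_le_eq add_increasing2)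
  have "\<forall>\<^sub>F V in finite_subsets_at_top UNIV. ?m - \<delta> < PV V E"
    by (rule order_tendstoD(1)[OF weak_limit_cylinder[OF \<mu> B E]]) (use \<delta> in simp)
  then obtain U0 where U0: "finite U0" "\<And>V. finite V \<Longrightarrow> U0 \<subseteq> V \<Longrightarrow> ?m - \<delta> < PV V E"
    unfolding eventually_finite_subsets_at_top by auto
  define V0 where "V0 = U0 \<union> B"
  have V0: "finite V0" "B \<subseteq> V0" unfolding V0_def using U0 B by auto
  have \<gamma>: "\<gamma> \<le> PV V E" if "finite V" "V0 \<subseteq> V" for V
    using U0(2)[OF that(1)] that(2) PV_nonneg[of V E] unfolding V0_def \<gamma>_def by simp
  obtain F1 V1 where F1: "finite F1" "finite V1"
    "\<And>V. finite V \<Longrightarrow> V1 \<subseteq> V \<Longrightarrow> PT V {T. \<not> blocked_core V treeb V0 T \<subseteq> F1} \<le> \<delta>"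
    using one_ended[OF V0(1) \<delta>] by auto
  \<comment> \<open>One-endedness is used twice, from \<open>V0\<close> to \<open>C\<close> and from
    \<open>C\<close> to \<open>F\<close>. Here \<open>V0\<close> is so large that every volume
    containing it gives \<open>E\<close> nearly its limiting probability.\<close>
  define C where "C = F1 \<union> B"
  have C: "finite C" "B \<subseteq> C" unfolding C_def using F1 B by auto
  obtain F V2 where F: "finite F" "finite V2"
    "\<And>V. finite V \<Longrightarrow> V2 \<subseteq> V \<Longrightarrow> PT V {T. \<not> blocked_core V treeb C T \<subseteq> F} \<le> \<delta>"
    using one_ended[OF C(1) \<delta>] by auto
  show ?thesis
  proof (intro exI[of _ F] conjI allI impI F(1))
    fix A :: "'d config set" and S assume S: "finite S" "S \<inter> F = {}" and A: "depends_on A S"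
    have AE: "depends_on (A \<inter> E) (S \<union> B)" using A E unfolding depends_on_def by blast
    have ev: "\<forall>\<^sub>F V in finite_subsets_at_top UNIV. \<gamma> * PV V A - 2 * \<delta> \<le> PV V (A \<inter> E)"
      unfolding eventually_finite_subsets_at_top
    proof (intro exI[of _ "V0 \<union> V1 \<union> C \<union> V2 \<union> S"] conjI allI impI)
      show "finite (V0 \<union> V1 \<union> C \<union> V2 \<union> S)" using V0 F1 C F S by simp
      fix V :: "'d site set" assume "finite V \<and> V0 \<union> V1 \<union> C \<union> V2 \<union> S \<subseteq> V \<and> V \<subseteq> UNIV"
      then have V: "finite V" "V0 \<subseteq> V" "V1 \<subseteq> V" "C \<subseteq> V" "V2 \<subseteq> V" "S \<subseteq> V" by auto
      have "PT V {T. \<not> blocked_core V treeb V0 T \<subseteq> C} \<le> PT V {T. \<not> blocked_core V treeb V0 T \<subseteq> F1}"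
        by (rule PT_mono[OF V(1)]) (auto simp: C_def)
      then have 1: "PT V {T. \<not> blocked_core V treeb V0 T \<subseteq> C} \<le> \<delta>" using F1(3)[OF V(1,3)] by simp
      show "\<gamma> * PV V A - 2 * \<delta> \<le> PV V (A \<inter> E)"
        by (rule mixing_lower[OF V(1) V0(2) C(2) V(2,4) E A V(6) S(2) \<gamma> \<gamma>01 1 F(3)[OF V(1,5)]])
    qed simp
    have "\<gamma> * measure \<mu> (Omega \<inter> A) - 2 * \<delta> \<le> measure \<mu> (Omega \<inter> (A \<inter> E))"
    proof (rule tendsto_le[OF _ _ _ ev])
      show "((\<lambda>V. PV V (A \<inter> E)) \<longlongrightarrow> measure \<mu> (Omega \<inter> (A \<inter> E))) (finite_subsets_at_top UNIV)"
        by (rule weak_limit_cylinder[OF \<mu> _ AE]) (use S B in simp)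
      show "((\<lambda>V. \<gamma> * PV V A - 2 * \<delta>) \<longlongrightarrow> \<gamma> * measure \<mu> (Omega \<inter> A) - 2 * \<delta>) (finite_subsets_at_top UNIV)"
        by (intro tendsto_intros weak_limit_cylinder[OF \<mu> S(1) A])
    qed simp
    moreover have "(?m - \<delta>) * measure \<mu> (Omega \<inter> A) \<le> \<gamma> * measure \<mu> (Omega \<inter> A)"
      by (rule mult_right_mono) (simp_all add: \<gamma>_def)
    moreover have "\<delta> * measure \<mu> (Omega \<inter> A) \<le> \<delta> * 1" using \<delta> by (intro mult_left_mono) auto
    moreover have "e = 3 * \<delta>" unfolding \<delta>_def by simp
    ultimately show "?m * measure \<mu> (Omega \<inter> A) - e \<le> measure \<mu> (Omega \<inter> (A \<inter> E))"
      by (simp add: left_diff_distrib)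
  qed
qed

subsection \<open>Triviality of the tail\<close>

text \<open>The approximable sets form a sigma-algebra; measurability is carried along because the
  union step needs it. The support is kept inside \<open>N\<close>, so tail events are approximated
  by events far away.\<close>

lemma cylinder_approx:
  fixes \<mu> :: "('d::finite) config measure"
  assumes \<mu>: "prob_space \<mu>" "sets \<mu> = sets OmegaM"
    and A: "A \<in> sigma_sets Omega {{\<eta> \<in> Omega. \<eta> x \<in> B} | x B. x \<in> N}"
  shows "A \<in> sets \<mu> \<and> (\<forall>e>0. \<exists>S A'. finite S \<and> S \<subseteq> N \<and> depends_on A' S \<and> measure \<mu> (sym_diff A (Omega \<inter> A')) \<le> e)"
  using A
proof induction
  case (Basic A)
  then obtain x B where x: "A = {\<eta> \<in> Omega. \<eta> x \<in> B}" "x \<in> N" by blast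
  have d: "depends_on {\<eta>. \<eta> x \<in> B} {x}" unfolding depends_on_def by simp
  have eq: "A = Omega \<inter> {\<eta>. \<eta> x \<in> B}" unfolding x by blast
  have "A \<in> sets \<mu>" unfolding eq \<mu>(2) by (rule cylinder_sets[OF _ d]) simp
  moreover have "\<exists>S A'. finite S \<and> S \<subseteq> N \<and> depends_on A' S \<and> measure \<mu> (sym_diff A (Omega \<inter> A')) \<le> e" if "e > 0" for e
    by (rule exI[of _ "{x}"], rule exI[of _ "{\<eta>. \<eta> x \<in> B}"]) (use x(2) d that in \<open>simp add: eq\<close>)
  ultimately show ?case by blast
next
  case Empty
  have "\<exists>S A'. finite S \<and> S \<subseteq> N \<and> depends_on A' S \<and> measure \<mu> (sym_diff {} (Omega \<inter> A')) \<le> e" if "e > 0" for e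
    by (rule exI[of _ "{}"], rule exI[of _ "{}"]) (use that in \<open>simp add: depends_on_def\<close>)
  then show ?case by simp
next
  case (Compl A)
  have sp: "space \<mu> = Omega" using sets_eq_imp_space_eq[OF \<mu>(2)] by (simp add: space_OmegaM)
  have "\<exists>S A'. finite S \<and> S \<subseteq> N \<and> depends_on A' S \<and> measure \<mu> (sym_diff (Omega - A) (Omega \<inter> A')) \<le> e" if e: "e > 0" for e
  proof -
    obtain S A' where S: "finite S" "S \<subseteq> N" "depends_on A' S" "measure \<mu> (sym_diff A (Omega \<inter> A')) \<le> e"
      using Compl.IH e by blast
    have "A \<subseteq> Omega" using Compl.IH sets.sets_into_space[of A \<mu>] sp by blast
    then have "sym_diff (Omega - A) (Omega \<inter> - A') = sym_diff A (Omega \<inter> A')" by blast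
    moreover have "depends_on (- A') S" using S(3) unfolding depends_on_def by simp
    ultimately show ?thesis using S by metis
  qed
  moreover have "Omega - A \<in> sets \<mu>" using Compl.IH sets.compl_sets[of A \<mu>] sp by simp
  ultimately show ?case by blast
next
  case (Union A)
  interpret prob_space \<mu> by (rule \<mu>(1))
  have Am: "A i \<in> sets \<mu>" for i using Union.IH by blast
  have "\<exists>S A'. finite S \<and> S \<subseteq> N \<and> depends_on A' S \<and> measure \<mu> (sym_diff (\<Union>i. A i) (Omega \<inter> A')) \<le> e" if e: "e > 0" for e
  proof -
    let ?B = "\<lambda>n. \<Union>i<n. A i"
    have "(\<lambda>n. measure \<mu> (?B n)) \<longlonglongrightarrow> measure \<mu> (\<Union>n. ?B n)"
      by (rule finite_Lim_measure_incseq) (use Am in \<open>auto simp: incseq_def intro: less_le_trans\<close>)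
    moreover have "(\<Union>n. ?B n) = (\<Union>i. A i)" by auto
    ultimately have "\<forall>\<^sub>F n in sequentially. measure \<mu> (\<Union>i. A i) - e / 2 < measure \<mu> (?B n)"
      using e by (intro order_tendstoD(1)[where y = "measure \<mu> (\<Union>i. A i)"]) auto
    then obtain n where n: "measure \<mu> (\<Union>i. A i) - e / 2 < measure \<mu> (?B n)" unfolding eventually_sequentially by blast
    \<comment> \<open>Half of the error is spent on truncating the union and the rest is shared by
      \<open>n\<close> approximations; the added 1 covers \<open>n = 0\<close>.\<close>
    define d where "d = e / (2 * (real n + 1))"
    have d: "0 < d" unfolding d_def using e by simp
    obtain S A' where S: "\<And>i. finite (S i)" "\<And>i. S i \<subseteq> N" "\<And>i. depends_on (A' i) (S i)"
      "\<And>i. measure \<mu> (sym_diff (A i) (Omega \<inter> A' i)) \<le> d"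
    proof -
      have "\<forall>i. \<exists>SA. finite (fst SA) \<and> fst SA \<subseteq> N \<and> depends_on (snd SA) (fst SA) \<and> measure \<mu> (sym_diff (A i) (Omega \<inter> snd SA)) \<le> d"
        using Union.IH d by (simp add: split_paired_Ex)
      then obtain f where f: "\<forall>i. finite (fst (f i)) \<and> fst (f i) \<subseteq> N \<and> depends_on (snd (f i)) (fst (f i))
          \<and> measure \<mu> (sym_diff (A i) (Omega \<inter> snd (f i))) \<le> d"
        unfolding choice_iff by (elim exE)
      show ?thesis by (rule that[of "\<lambda>i. fst (f i)" "\<lambda>i. snd (f i)"]) (use f in auto)
    qed
    have meas: "sym_diff (A i) (Omega \<inter> A' i) \<in> sets \<mu>" for i
      using Am[of i] cylinder_sets[OF S(1) S(3), of i] \<mu>(2) by auto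
    have dep: "depends_on (\<Union>i<n. A' i) (\<Union>i<n. S i)"
      using S(3) unfolding depends_on_def by (auto, blast+)
    have "sym_diff (\<Union>i. A i) (Omega \<inter> (\<Union>i<n. A' i)) \<subseteq> ((\<Union>i. A i) - ?B n) \<union> (\<Union>i<n. sym_diff (A i) (Omega \<inter> A' i))" by blast
    then have "measure \<mu> (sym_diff (\<Union>i. A i) (Omega \<inter> (\<Union>i<n. A' i))) \<le> measure \<mu> (((\<Union>i. A i) - ?B n) \<union> (\<Union>i<n. sym_diff (A i) (Omega \<inter> A' i)))"
      by (rule finite_measure_mono) (use Am meas in auto)
    also have "\<dots> \<le> measure \<mu> ((\<Union>i. A i) - ?B n) + measure \<mu> (\<Union>i<n. sym_diff (A i) (Omega \<inter> A' i))"
      by (rule measure_Un_le) (use Am meas in auto)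
    also have "measure \<mu> ((\<Union>i. A i) - ?B n) \<le> e / 2"
    proof -
      have "measure \<mu> ((\<Union>i. A i) - ?B n) = measure \<mu> (\<Union>i. A i) - measure \<mu> (?B n)"
        by (rule finite_measure_Diff) (use Am in auto)
      then show ?thesis using n by simp
    qed
    also have "measure \<mu> (\<Union>i<n. sym_diff (A i) (Omega \<inter> A' i)) \<le> (\<Sum>i<n. measure \<mu> (sym_diff (A i) (Omega \<inter> A' i)))"
      by (rule finite_measure_subadditive_finite) (use meas in auto)
    also have "\<dots> \<le> (\<Sum>i<n. d)" by (rule sum_mono) (rule S(4))
    also have "\<dots> \<le> e / 2" unfolding d_def using e by (simp add: field_simps)
    finally have "measure \<mu> (sym_diff (\<Union>i. A i) (Omega \<inter> (\<Union>i<n. A' i))) \<le> e" by simp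
    moreover have "finite (\<Union>i<n. S i)" "(\<Union>i<n. S i) \<subseteq> N" using S(1,2) by auto
    ultimately show ?thesis using dep by blast
  qed
  moreover have "(\<Union>i. A i) \<in> sets \<mu>" using Am by blast
  ultimately show ?case by blast
qed

lemma finite_norm1_bound: "finite F \<Longrightarrow> \<exists>n. \<forall>x\<in>F. norm1 x < int n"
proof (induction rule: finite_induct)
  case (insert y F)
  then obtain n where "\<forall>x\<in>F. norm1 x < int n" by blast
  then have "\<forall>x\<in>insert y F. norm1 x < int (n + nat (norm1 y + 1))" by force
  then show ?case by blast
qed simp

theorem theorem9p1:
  fixes \<mu> :: "('d::finite) config measure"
  assumes "CARD('d) \<ge> 2"
    and "prob_space \<mu>"
    and "sets \<mu> = sets OmegaM"
    and "weak_limit \<mu>"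
  shows "\<forall>A \<in> tail_field. measure \<mu> A = 0 \<or> measure \<mu> A = 1"
proof
  fix A :: "'d config set" assume A: "A \<in> tail_field"
  interpret prob_space \<mu> by (rule assms(2))
  have sp: "space \<mu> = Omega" using sets_eq_imp_space_eq[OF assms(3)] by (simp add: space_OmegaM)
  have tail: "A \<in> sigma_sets Omega {{\<eta> \<in> Omega. \<eta> x \<in> B} | x B. x \<in> {x. norm1 x \<ge> int n}}" for n
    using A unfolding tail_field_def by simp
  have Am: "A \<in> sets \<mu>" using cylinder_approx[OF assms(2,3) tail] by blast
  let ?a = "measure \<mu> A"
  have "?a * (1 - ?a) \<le> 5 * e" if e: "e > 0" for e
  proof -
    have cA: "Omega - A \<in> sigma_sets Omega {{\<eta> \<in> Omega. \<eta> x \<in> B} | x B. x \<in> {x. norm1 x \<ge> int 0}}"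
      by (rule sigma_sets.Compl[OF tail])
    obtain B E where B: "finite B" "depends_on E B" and E: "measure \<mu> (sym_diff (Omega - A) (Omega \<inter> E)) \<le> e"
      using cylinder_approx[OF assms(2,3) cA] e by blast
    obtain F where F: "finite F" "\<And>A S. finite S \<Longrightarrow> S \<inter> F = {} \<Longrightarrow> depends_on A S \<Longrightarrow>
        measure \<mu> (Omega \<inter> E) * measure \<mu> (Omega \<inter> A) - e \<le> measure \<mu> (Omega \<inter> (A \<inter> E))"
      using mixing_limit[OF assms B e] by auto
    obtain n where n: "\<forall>x\<in>F. norm1 x < int n" using finite_norm1_bound[OF F(1)] by blast
    obtain S A' where S: "finite S" "S \<subseteq> {x. norm1 x \<ge> int n}" "depends_on A' S" and A': "measure \<mu> (sym_diff A (Omega \<inter> A')) \<le> e"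
      using cylinder_approx[OF assms(2,3) tail[of n]] e by blast
    have Em: "Omega \<inter> E \<in> sets \<mu>" unfolding assms(3) by (rule cylinder_sets[OF B])
    have A'm: "Omega \<inter> A' \<in> sets \<mu>" unfolding assms(3) by (rule cylinder_sets[OF S(1,3)])
    have "S \<inter> F = {}" using S(2) n by force
    then have mix: "measure \<mu> (Omega \<inter> E) * measure \<mu> (Omega \<inter> A') - e \<le> measure \<mu> (Omega \<inter> (A' \<inter> E))"
      using F(2) S by blast
    have cAm: "Omega - A \<in> sets \<mu>" using sets.compl_sets[OF Am] sp by simp
    have sdm: "sym_diff (Omega - A) (Omega \<inter> E) \<in> sets \<mu>" "sym_diff A (Omega \<inter> A') \<in> sets \<mu>"
      using Am Em A'm cAm by auto
    have le: "measure \<mu> X \<le> measure \<mu> Y + measure \<mu> Z" if "X \<subseteq> Y \<union> Z" "Y \<in> sets \<mu>" "Z \<in> sets \<mu>" for X Y Z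
    proof -
      have "measure \<mu> X \<le> measure \<mu> (Y \<union> Z)" by (rule finite_measure_mono) (use that in auto)
      then show ?thesis using measure_Un_le[OF that(2,3)] by simp
    qed
    \<comment> \<open>A point of both approximations is misplaced by one of them, as it lies either
      in \<open>A\<close> or in its complement. So the intersection is nearly null while mixing
      bounds it below by the product.\<close>
    have "measure \<mu> (Omega \<inter> (A' \<inter> E)) \<le> measure \<mu> (sym_diff (Omega - A) (Omega \<inter> E)) + measure \<mu> (sym_diff A (Omega \<inter> A'))"
      by (rule le[OF _ sdm]) blast
    then have 1: "measure \<mu> (Omega \<inter> (A' \<inter> E)) \<le> 2 * e" using E A' by simp
    have "?a \<le> measure \<mu> (Omega \<inter> A') + measure \<mu> (sym_diff A (Omega \<inter> A'))" by (rule le[OF _ A'm sdm(2)]) blast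
    then have 2: "?a - e \<le> measure \<mu> (Omega \<inter> A')" using A' by simp
    have "measure \<mu> (Omega - A) \<le> measure \<mu> (Omega \<inter> E) + measure \<mu> (sym_diff (Omega - A) (Omega \<inter> E))"
      by (rule le[OF _ Em sdm(1)]) blast
    then have 3: "(1 - ?a) - e \<le> measure \<mu> (Omega \<inter> E)" using E prob_compl[OF Am] sp by simp
    let ?x = "measure \<mu> (Omega \<inter> A')" and ?y = "measure \<mu> (Omega \<inter> E)"
    have "?a * (1 - ?a) \<le> (?x + e) * (1 - ?a)" using 2 by (intro mult_right_mono) auto
    also have "\<dots> = ?x * (1 - ?a) + e * (1 - ?a)" by (rule distrib_right)
    also have "\<dots> \<le> ?x * (?y + e) + e * 1"
      using 3 e by (intro add_mono mult_left_mono) auto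
    also have "\<dots> = ?y * ?x + ?x * e + e" by (simp add: distrib_left)
    also have "?x * e \<le> 1 * e" using e by (intro mult_right_mono) auto
    finally show ?thesis using mix 1 by simp
  qed
  then have "?a * (1 - ?a) \<le> 0 + e" if "e > 0" for e using that by (metis add_0 divide_pos_pos nonzero_mult_div_cancel_left times_divide_eq_right zero_less_numeral zero_neq_numeral)
  then have "?a * (1 - ?a) \<le> 0" by (rule field_le_epsilon)
  moreover have "0 \<le> ?a * (1 - ?a)" by simp
  ultimately have "?a * (1 - ?a) = 0" by simp
  then show "?a = 0 \<or> ?a = 1" by simp
qed

end
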